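(* Let $\mathcal{V}=(\mathcal{G},\mathcal{L},P)$ be a densely valued $\ell$-group. Then $\mathcal{V}$ is algebraically closed (in the class of densely valued $\ell$-groups) if and only if $\mathcal{G}$ is divisible, $\mathcal{L}$ is a Boolean lattice, and $\mathcal{V}$ has patching.
   Context: All $\ell$-groups are abelian lattice-ordered groups. A valued $\ell$-group is a triple $(\mathcal{G},\mathcal{L},P)$ with $\mathcal{G}$ an $\ell$-group, $\mathcal{L}$ a bounded distributive lattice ($\sqcap,\sqcup,\bot,\top,\sqsubseteq$), and $P:\mathcal{G}\to\mathcal{L}$ such that for all $a,b$: $P(a\wedge b)=P(a)\sqcap P(b)$, $P(a\vee b)=P(a)\sqcup P(b)$, $P(0)=\top$, $P(a)\sqcap P(b)\sqsubseteq P(a+b)$, and every element of $\mathcal{L}$ other than $\bot$ is of the form $P(a)$; it is densely valued if moreover $P(a)=\top$ implies $a\geq0$. Valued $\ell$-groups are structures in the two-sorted language $\mathcal{L}_{\mathrm{vlgrp}}$ with a group sort $\mathbb{G}$ (symbols $0,+,-,\wedge,\vee$), a lattice sort $\mathbb{L}$ (symbols $\bot,\top,\sqcap,\sqcup$) and a function symbol $P:\mathbb{G}\to\mathbb{L}$; $\mathcal{V}\leq\mathcal{W}$ means $\mathcal{V}$ is a substructure of $\mathcal{W}$. A densely valued $\ell$-group $\mathcal{V}$ is algebraically closed if for every densely valued $\ell$-group $\mathcal{W}$ with $\mathcal{V}\leq\mathcal{W}$, every positive existential $\mathcal{L}_{\mathrm{vlgrp}}$-formula $\phi(\bar v)$ and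 every tuple $\bar c$ from $\mathcal{V}$ of matching sorts, $\mathcal{W}\models\phi(\bar c)$ implies $\mathcal{V}\models\phi(\bar c)$. $\mathcal{V}$ has patching if for all $f,g,\phi,\psi\in\mathcal{G}$ with $P(f)\sqcap P(g)\sqsubseteq P(\phi-\psi)\sqcap P(\psi-\phi)$ there exists $\chi\in\mathcal{G}$ with $P(f)\sqsubseteq P(\phi-\chi)\sqcap P(\chi-\phi)$ and $P(g)\sqsubseteq P(\psi-\chi)\sqcap P(\chi-\psi)$. A Boolean lattice is a complemented bounded distributive lattice.
   Formalization: The formal theorem excludes the one structure with G={0} and L={⊥,⊤}, ⊥≠⊤, where the claim fails: it is divisible, Boolean and has patching, but ∃a P(a)=⊥ holds in the extension (ℤ,{⊥,⊤}) and not in it. *)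

theory Defs
  imports "HOL-Algebra.Group"
begin

text \<open>Structures for the two-sorted language: one field per symbol, plus a carrier for each sort.\<close>

record ('g, 'l) vlgrp =
  gcar :: "'g set"
  gzero :: 'g
  gadd :: "'g \<Rightarrow> 'g \<Rightarrow> 'g"
  gneg :: "'g \<Rightarrow> 'g"
  gmeet :: "'g \<Rightarrow> 'g \<Rightarrow> 'g"
  gjoin :: "'g \<Rightarrow> 'g \<Rightarrow> 'g"
  lcar :: "'l set"
  lbot :: 'l
  ltop :: 'l
  lmeet :: "'l \<Rightarrow> 'l \<Rightarrow> 'l"
  ljoin :: "'l \<Rightarrow> 'l \<Rightarrow> 'l"
  val :: "'g \<Rightarrow> 'l"

definition ggroup :: "('g, 'l) vlgrp \<Rightarrow> 'g monoid" where
  "ggroup V = \<lparr>carrier = gcar V, mult = gadd V, one = gzero V\<rparr>"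

definition gle :: "('g, 'l) vlgrp \<Rightarrow> 'g \<Rightarrow> 'g \<Rightarrow> bool" where
  "gle V a b \<longleftrightarrow> gmeet V a b = a"

definition lle :: "('g, 'l) vlgrp \<Rightarrow> 'l \<Rightarrow> 'l \<Rightarrow> bool" where
  "lle V x y \<longleftrightarrow> lmeet V x y = x"

definition gdiff :: "('g, 'l) vlgrp \<Rightarrow> 'g \<Rightarrow> 'g \<Rightarrow> 'g" where
  "gdiff V a b = gadd V a (gneg V b)"

locale lattice_on =
  fixes A :: "'a set" and meet join :: "'a \<Rightarrow> 'a \<Rightarrow> 'a"
  assumes meet_closed: "\<lbrakk>a \<in> A; b \<in> A\<rbrakk> \<Longrightarrow> meet a b \<in> A"
    and join_closed: "\<lbrakk>a \<in> A; b \<in> A\<rbrakk> \<Longrightarrow> join a b \<in> A"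
    and meet_commute: "\<lbrakk>a \<in> A; b \<in> A\<rbrakk> \<Longrightarrow> meet a b = meet b a"
    and join_commute: "\<lbrakk>a \<in> A; b \<in> A\<rbrakk> \<Longrightarrow> join a b = join b a"
    and meet_assoc: "\<lbrakk>a \<in> A; b \<in> A; c \<in> A\<rbrakk> \<Longrightarrow> meet (meet a b) c = meet a (meet b c)"
    and join_assoc: "\<lbrakk>a \<in> A; b \<in> A; c \<in> A\<rbrakk> \<Longrightarrow> join (join a b) c = join a (join b c)"
    and meet_join_absorb: "\<lbrakk>a \<in> A; b \<in> A\<rbrakk> \<Longrightarrow> meet a (join a b) = a"
    and join_meet_absorb: "\<lbrakk>a \<in> A; b \<in> A\<rbrakk> \<Longrightarrow> join a (meet a b) = a"

locale bounded_distrib_lattice_on = lattice_on +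
  fixes bot top :: 'a
  assumes bot_closed: "bot \<in> A"
    and top_closed: "top \<in> A"
    and meet_bot: "a \<in> A \<Longrightarrow> meet bot a = bot"
    and meet_top: "a \<in> A \<Longrightarrow> meet top a = a"
    and meet_join_distrib:
      "\<lbrakk>a \<in> A; b \<in> A; c \<in> A\<rbrakk> \<Longrightarrow> meet a (join b c) = join (meet a b) (meet a c)"

locale valued_lgroup =
  fixes V :: "('g, 'l) vlgrp"
  assumes group: "comm_group (ggroup V)"
    and neg: "a \<in> gcar V \<Longrightarrow> gneg V a = inv\<^bsub>ggroup V\<^esub> a"
    and glattice: "lattice_on (gcar V) (gmeet V) (gjoin V)"
    and translation: "\<lbrakk>a \<in> gcar V; b \<in> gcar V; c \<in> gcar V; gle V a b\<rbrakk>
        \<Longrightarrow> gle V (gadd V a c) (gadd V b c)"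
    and llattice: "bounded_distrib_lattice_on (lcar V) (lmeet V) (ljoin V) (lbot V) (ltop V)"
    and val_closed: "a \<in> gcar V \<Longrightarrow> val V a \<in> lcar V"
    and val_meet: "\<lbrakk>a \<in> gcar V; b \<in> gcar V\<rbrakk>
        \<Longrightarrow> val V (gmeet V a b) = lmeet V (val V a) (val V b)"
    and val_join: "\<lbrakk>a \<in> gcar V; b \<in> gcar V\<rbrakk>
        \<Longrightarrow> val V (gjoin V a b) = ljoin V (val V a) (val V b)"
    and val_zero: "val V (gzero V) = ltop V"
    and val_add: "\<lbrakk>a \<in> gcar V; b \<in> gcar V\<rbrakk>
        \<Longrightarrow> lle V (lmeet V (val V a) (val V b)) (val V (gadd V a b))"
    and val_surj: "\<lbrakk>x \<in> lcar V; x \<noteq> lbot V\<rbrakk> \<Longrightarrow> \<exists>a\<in>gcar V. x = val V a"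

locale densely_valued_lgroup = valued_lgroup +
  assumes dense: "\<lbrakk>a \<in> gcar V; val V a = ltop V\<rbrakk> \<Longrightarrow> gle V (gzero V) a"

datatype gterm =
  GVar nat | GZero | GAdd gterm gterm | GNeg gterm | GMeet gterm gterm | GJoin gterm gterm

datatype lterm =
  LVar nat | LBot | LTop | LMeet lterm lterm | LJoin lterm lterm | LVal gterm

datatype pe_formula =
  GEq gterm gterm | LEq lterm lterm
  | And pe_formula pe_formula | Or pe_formula pe_formula
  | ExG nat pe_formula | ExL nat pe_formula

primrec geval :: "('g, 'l) vlgrp \<Rightarrow> (nat \<Rightarrow> 'g) \<Rightarrow> gterm \<Rightarrow> 'g" where
  "geval V v (GVar n) = v n"
| "geval V v GZero = gzero V"
| "geval V v (GAdd s t) = gadd V (geval V v s) (geval V v t)"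
| "geval V v (GNeg s) = gneg V (geval V v s)"
| "geval V v (GMeet s t) = gmeet V (geval V v s) (geval V v t)"
| "geval V v (GJoin s t) = gjoin V (geval V v s) (geval V v t)"

primrec leval :: "('g, 'l) vlgrp \<Rightarrow> (nat \<Rightarrow> 'g) \<Rightarrow> (nat \<Rightarrow> 'l) \<Rightarrow> lterm \<Rightarrow> 'l" where
  "leval V v w (LVar n) = w n"
| "leval V v w LBot = lbot V"
| "leval V v w LTop = ltop V"
| "leval V v w (LMeet s t) = lmeet V (leval V v w s) (leval V v w t)"
| "leval V v w (LJoin s t) = ljoin V (leval V v w s) (leval V v w t)"
| "leval V v w (LVal s) = val V (geval V v s)"

primrec sat :: "('g, 'l) vlgrp \<Rightarrow> (nat \<Rightarrow> 'g) \<Rightarrow> (nat \<Rightarrow> 'l) \<Rightarrow> pe_formula \<Rightarrow> bool" where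
  "sat V v w (GEq s t) \<longleftrightarrow> geval V v s = geval V v t"
| "sat V v w (LEq s t) \<longleftrightarrow> leval V v w s = leval V v w t"
| "sat V v w (And \<phi> \<psi>) \<longleftrightarrow> sat V v w \<phi> \<and> sat V v w \<psi>"
| "sat V v w (Or \<phi> \<psi>) \<longleftrightarrow> sat V v w \<phi> \<or> sat V v w \<psi>"
| "sat V v w (ExG n \<phi>) \<longleftrightarrow> (\<exists>a\<in>gcar V. sat V (v(n := a)) w \<phi>)"
| "sat V v w (ExL n \<phi>) \<longleftrightarrow> (\<exists>x\<in>lcar V. sat V v (w(n := x)) \<phi>)"

text \<open>
  An embedding identifies \<open>V\<close> with a substructure of \<open>W\<close>.  Satisfaction is invariant under
  isomorphism, so quantifying over embeddings amounts to quantifying over extensions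
  \<open>V \<le> W\<close>, without requiring the carriers to live in the same type.
\<close>

definition vl_embedding ::
    "('g \<Rightarrow> 'h) \<Rightarrow> ('l \<Rightarrow> 'm) \<Rightarrow> ('g, 'l) vlgrp \<Rightarrow> ('h, 'm) vlgrp \<Rightarrow> bool" where
  "vl_embedding e d V W \<longleftrightarrow>
     e ` gcar V \<subseteq> gcar W \<and> inj_on e (gcar V) \<and>
     d ` lcar V \<subseteq> lcar W \<and> inj_on d (lcar V) \<and>
     e (gzero V) = gzero W \<and>
     (\<forall>a\<in>gcar V. e (gneg V a) = gneg W (e a)) \<and>
     (\<forall>a\<in>gcar V. \<forall>b\<in>gcar V. e (gadd V a b) = gadd W (e a) (e b)) \<and>
     (\<forall>a\<in>gcar V. \<forall>b\<in>gcar V. e (gmeet V a b) = gmeet W (e a) (e b)) \<and>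
     (\<forall>a\<in>gcar V. \<forall>b\<in>gcar V. e (gjoin V a b) = gjoin W (e a) (e b)) \<and>
     d (lbot V) = lbot W \<and> d (ltop V) = ltop W \<and>
     (\<forall>x\<in>lcar V. \<forall>y\<in>lcar V. d (lmeet V x y) = lmeet W (d x) (d y)) \<and>
     (\<forall>x\<in>lcar V. \<forall>y\<in>lcar V. d (ljoin V x y) = ljoin W (d x) (d y)) \<and>
     (\<forall>a\<in>gcar V. d (val V a) = val W (e a))"

text \<open>
  HOL cannot quantify over types inside a formula, so the types \<open>'h\<close> and \<open>'m\<close> in which the
  extensions have their carriers are parameters of the definition.  The property holds with
  respect to all extensions whatsoever iff it holds for all sufficiently large \<open>'h\<close> and \<open>'m\<close>,
  as every extension can be copied into a larger type.  By the Loewenheim-Skolem theorem it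
  does not depend on \<open>'h\<close> and \<open>'m\<close> once they are infinite and at least as large as the
  carriers of \<open>V\<close>.
\<close>

definition algebraically_closed ::
    "'h itself \<Rightarrow> 'm itself \<Rightarrow> ('g, 'l) vlgrp \<Rightarrow> bool" where
  "algebraically_closed TH TM V \<longleftrightarrow>
     (\<forall>(W :: ('h, 'm) vlgrp) e d \<phi> v w.
        densely_valued_lgroup W \<longrightarrow> vl_embedding e d V W \<longrightarrow>
        range v \<subseteq> gcar V \<longrightarrow> range w \<subseteq> lcar V \<longrightarrow>
        sat W (e \<circ> v) (d \<circ> w) \<phi> \<longrightarrow> sat V v w \<phi>)"

definition divisible :: "('g, 'l) vlgrp \<Rightarrow> bool" where
  "divisible V \<longleftrightarrow>
     (\<forall>n::nat. n > 0 \<longrightarrow> (\<forall>a\<in>gcar V. \<exists>b\<in>gcar V. b [^]\<^bsub>ggroup V\<^esub> n = a))"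

definition boolean :: "('g, 'l) vlgrp \<Rightarrow> bool" where
  "boolean V \<longleftrightarrow>
     bounded_distrib_lattice_on (lcar V) (lmeet V) (ljoin V) (lbot V) (ltop V) \<and>
     (\<forall>x\<in>lcar V. \<exists>y\<in>lcar V. lmeet V x y = lbot V \<and> ljoin V x y = ltop V)"

definition patching :: "('g, 'l) vlgrp \<Rightarrow> bool" where
  "patching V \<longleftrightarrow>
     (\<forall>f\<in>gcar V. \<forall>g\<in>gcar V. \<forall>\<phi>\<in>gcar V. \<forall>\<psi>\<in>gcar V.
        lle V (lmeet V (val V f) (val V g))
              (lmeet V (val V (gdiff V \<phi> \<psi>)) (val V (gdiff V \<psi> \<phi>))) \<longrightarrow>
        (\<exists>\<chi>\<in>gcar V.
           lle V (val V f) (lmeet V (val V (gdiff V \<phi> \<chi>)) (val V (gdiff V \<chi> \<phi>))) \<and>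
           lle V (val V g) (lmeet V (val V (gdiff V \<psi> \<chi>)) (val V (gdiff V \<chi> \<psi>)))))"

text \<open>
  The equivalence fails for exactly one structure: the zero group valued in the two-element
  lattice.  There \<open>\<exists>a. P a = \<bottom>\<close> fails, although it holds in the extension with the
  integers as group; all other conditions of the equivalence are satisfied.
\<close>

definition int_vlgrp :: "int set \<Rightarrow> (int, bool) vlgrp" where
  "int_vlgrp A =
     \<lparr>gcar = A, gzero = 0, gadd = (+), gneg = uminus, gmeet = min, gjoin = max,
      lcar = UNIV, lbot = False, ltop = True, lmeet = (\<and>), ljoin = (\<or>), val = (\<lambda>a. a \<ge> 0)\<rparr>"

lemma int_vlgrp_densely_valued:
  assumes A: "A = {0} \<or> A = UNIV"
  shows "densely_valued_lgroup (int_vlgrp A)"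
proof -
  have grp: "comm_group (ggroup (int_vlgrp A))"
  proof (rule comm_groupI)
    fix x assume "x \<in> carrier (ggroup (int_vlgrp A))"
    then show "\<exists>y\<in>carrier (ggroup (int_vlgrp A)).
        y \<otimes>\<^bsub>ggroup (int_vlgrp A)\<^esub> x = \<one>\<^bsub>ggroup (int_vlgrp A)\<^esub>"
      using A by (intro bexI[of _ "- x"]) (auto simp: ggroup_def int_vlgrp_def)
  qed (use A in \<open>auto simp: ggroup_def int_vlgrp_def add.assoc add.commute\<close>)
  then interpret G: comm_group "ggroup (int_vlgrp A)" .
  have inv: "- a = inv\<^bsub>ggroup (int_vlgrp A)\<^esub> a" if "a \<in> A" for a
    using A that by (intro G.inv_equality[symmetric]) (auto simp: ggroup_def int_vlgrp_def)
  have surj: "\<exists>a\<in>A. x = (a \<ge> 0)" if "x" for x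
    using A that by (intro bexI[of _ 0]) auto
  have glat: "lattice_on A min (max :: int \<Rightarrow> _)"
    using A by unfold_locales
      (auto simp: min.commute max.commute min.assoc max.assoc min_def max_def)
  have llat: "bounded_distrib_lattice_on UNIV (\<and>) (\<or>) False True"
    by unfold_locales auto
  have trans: "gle (int_vlgrp A) (a + c) (b + c)" if "gle (int_vlgrp A) a b" for a b c
    using that by (auto simp: gle_def int_vlgrp_def)
  have nonneg: "gle (int_vlgrp A) 0 a" if "a \<ge> 0" for a
    using that by (auto simp: gle_def int_vlgrp_def)
  show ?thesis
  proof (intro densely_valued_lgroup.intro valued_lgroup.intro
      densely_valued_lgroup_axioms.intro grp)
    show "lattice_on (gcar (int_vlgrp A)) (gmeet (int_vlgrp A)) (gjoin (int_vlgrp A))"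
      using glat by (simp add: int_vlgrp_def)
  qed (use inv trans nonneg surj llat in \<open>auto simp: int_vlgrp_def lle_def\<close>)
qed

lemma zero_group_counterexample:
  defines "V \<equiv> int_vlgrp {0}"
  shows "densely_valued_lgroup V" "divisible V" "boolean V" "patching V"
    and "\<not> algebraically_closed TYPE(int) TYPE(bool) V"
proof -
  show dv: "densely_valued_lgroup V"
    unfolding V_def by (rule int_vlgrp_densely_valued) simp
  then interpret densely_valued_lgroup V .
  interpret comm_group "ggroup V" by (rule group)
  have "x [^]\<^bsub>ggroup V\<^esub> (n::nat) = 0" if "x = 0" for n x
    using nat_pow_one[of n] that by (simp add: ggroup_def V_def int_vlgrp_def)
  then show "divisible V"
    by (simp add: divisible_def V_def int_vlgrp_def)
  show "boolean V"
    unfolding boolean_def using llattice by (auto simp: V_def int_vlgrp_def)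
  show "patching V"
    by (auto simp: patching_def lle_def gdiff_def V_def int_vlgrp_def)
  have "sat (int_vlgrp UNIV) v w (ExG 0 (LEq (LVal (GVar 0)) LBot))" for v w
    by (auto simp: int_vlgrp_def intro: exI[of _ "-1"])
  moreover have "vl_embedding id id V (int_vlgrp UNIV)"
    by (auto simp: vl_embedding_def V_def int_vlgrp_def)
  moreover have "\<not> sat V (\<lambda>_. 0) (\<lambda>_. True) (ExG 0 (LEq (LVal (GVar 0)) LBot))"
    by (simp add: V_def int_vlgrp_def)
  moreover have "range (\<lambda>_. 0) \<subseteq> gcar V" "range (\<lambda>_. True) \<subseteq> lcar V"
    by (auto simp: V_def int_vlgrp_def)
  moreover have "densely_valued_lgroup (int_vlgrp UNIV)"
    by (rule int_vlgrp_densely_valued) simp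
  ultimately show "\<not> algebraically_closed TYPE(int) TYPE(bool) V"
    unfolding algebraically_closed_def by blast
qed

end

theory Submission
  imports Defs
begin

text \<open>
  At a prime filter \<open>p\<close> of the lattice, \<open>P(b - a) \<in> p\<close> is a total preorder on the group, and in a
  densely valued l-group an equation holds iff it holds at all prime filters.

  Sufficiency: in a positive existential formula that is true in an extension \<open>W\<close>, fix the true
  disjuncts.  Each prime filter \<open>p\<close> of \<open>V\<close> lies below a prime filter \<open>q\<close> of \<open>W\<close>.  At \<open>p\<close>, \<open>V\<close> is a
  nontrivial divisible totally preordered group, so that solutions at \<open>q\<close> can be replaced by
  solutions at \<open>p\<close> (an Ehrenfeucht-Fraisse argument).  These persist over some \<open>u \<in> p\<close>.  The
  elements of the lattice over which the formula is solvable form an ideal, because solutions over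
  disjoint elements can be patched.  No prime filter avoids this ideal, which therefore contains
  the top element.

  Necessity: multiplication by \<open>n\<close> embeds \<open>V\<close> into itself.  The group of all families of elements of
  \<open>V\<close> indexed by the prime filters, taken modulo the families that vanish everywhere, is an
  extension of \<open>V\<close> that has patching and is valued in a power set.
\<close>


section \<open>Prime filters\<close>

text \<open>Gluing is the obstacle that shapes sufficiency. Witnesses found at single prime filters
  vary with the filter, and so may the true branch of a disjunction; pieces solved along different
  branches need not glue to a solution of any branch. The branches are therefore read off from the
  one global solution in \<open>W\<close>, and satisfaction is studied relative to a set of prime
  filters, with one witness for the whole set.

  The groups at \<open>p\<close> and \<open>q\<close> are compared through integer combinations of
  bounded size of finitely many elements. To answer one element of \<open>W\<close>, its multiples
  up to \<open>N\<close> are compared with combinations of size \<open>N\<close>; clearing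
  denominators by \<open>N!\<close> and taking a difference leads to the size
  \<open>2 * (fact N * N)\<close>.

  A zero group at \<open>p\<close> would leave no room for answers. Over a Boolean lattice it forces
  a zero group globally with \<open>lbot V \<noteq> ltop V\<close>, the excluded structure. In the
  converse the lattice is not yet known to be Boolean, so a prime filter with zero group may occur.
  Every value contains that filter, so that nonempty sets omitting it could not be values of
  families; this is why another group is used at such a coordinate.\<close>

context lattice_on
begin

definition leq :: "'a \<Rightarrow> 'a \<Rightarrow> bool" where
  "leq x y \<longleftrightarrow> meet x y = x"

lemma meet_idem: "x \<in> A \<Longrightarrow> meet x x = x"
  by (metis join_meet_absorb meet_closed meet_join_absorb)

lemma leq_refl: "x \<in> A \<Longrightarrow> leq x x"
  by (simp add: leq_def meet_idem)

lemma leq_trans: "\<lbrakk>leq x y; leq y z; x \<in> A; y \<in> A; z \<in> A\<rbrakk> \<Longrightarrow> leq x z"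
  unfolding leq_def by (metis meet_assoc)

lemma leq_antisym: "\<lbrakk>leq x y; leq y x; x \<in> A; y \<in> A\<rbrakk> \<Longrightarrow> x = y"
  unfolding leq_def by (metis meet_commute)

lemma meet_leq1: "\<lbrakk>x \<in> A; y \<in> A\<rbrakk> \<Longrightarrow> leq (meet x y) x"
  unfolding leq_def by (metis meet_assoc meet_commute meet_idem)

lemma meet_leq2: "\<lbrakk>x \<in> A; y \<in> A\<rbrakk> \<Longrightarrow> leq (meet x y) y"
  by (metis meet_leq1 meet_commute)

lemma meet_greatest: "\<lbrakk>leq z x; leq z y; x \<in> A; y \<in> A; z \<in> A\<rbrakk> \<Longrightarrow> leq z (meet x y)"
  unfolding leq_def by (metis meet_assoc)

lemma meet_mono:
  assumes "leq x x'" "leq y y'" "x \<in> A" "y \<in> A" "x' \<in> A" "y' \<in> A"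
  shows "leq (meet x y) (meet x' y')"
proof (rule meet_greatest)
  show "leq (meet x y) x'"
    using assms meet_closed meet_leq1 leq_trans[of "meet x y" x x'] by blast
  show "leq (meet x y) y'"
    using assms meet_closed meet_leq2 leq_trans[of "meet x y" y y'] by blast
qed (use assms meet_closed in auto)

lemma leq_iff_join: "\<lbrakk>x \<in> A; y \<in> A\<rbrakk> \<Longrightarrow> leq x y \<longleftrightarrow> join x y = y"
  unfolding leq_def by (metis meet_join_absorb join_meet_absorb meet_commute join_commute)

lemma join_idem: "x \<in> A \<Longrightarrow> join x x = x"
  using leq_iff_join leq_refl by simp

lemma join_leq1: "\<lbrakk>x \<in> A; y \<in> A\<rbrakk> \<Longrightarrow> leq x (join x y)"
  unfolding leq_def by (rule meet_join_absorb)

lemma join_leq2: "\<lbrakk>x \<in> A; y \<in> A\<rbrakk> \<Longrightarrow> leq y (join x y)"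
  by (metis join_leq1 join_commute)

lemma join_least: "\<lbrakk>leq x z; leq y z; x \<in> A; y \<in> A; z \<in> A\<rbrakk> \<Longrightarrow> leq (join x y) z"
  by (simp add: leq_iff_join join_closed join_assoc)

end

context bounded_distrib_lattice_on
begin

lemma leq_top: "x \<in> A \<Longrightarrow> leq x top"
  unfolding leq_def by (metis meet_commute meet_top top_closed)

lemma leq_bot: "x \<in> A \<Longrightarrow> leq bot x"
  unfolding leq_def by (rule meet_bot)

text \<open>Improper filters are included; disjointness from an ideal, which contains
  \<open>bot\<close>, supplies properness where it matters.\<close>

definition filter_on :: "'a set \<Rightarrow> bool" where
  "filter_on F \<longleftrightarrow> F \<subseteq> A \<and> top \<in> F \<and> (\<forall>x\<in>F. \<forall>y\<in>F. meet x y \<in> F)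
     \<and> (\<forall>x\<in>F. \<forall>y\<in>A. leq x y \<longrightarrow> y \<in> F)"

definition ideal_on :: "'a set \<Rightarrow> bool" where
  "ideal_on J \<longleftrightarrow> J \<subseteq> A \<and> bot \<in> J \<and> (\<forall>x\<in>J. \<forall>y\<in>J. join x y \<in> J)
     \<and> (\<forall>x\<in>J. \<forall>y\<in>A. leq y x \<longrightarrow> y \<in> J)"

text \<open>Both lattice operations appear as equivalences, so that membership in \<open>p\<close>
  is a homomorphism onto the truth values. Upward closure is hidden in the one for
  \<open>meet\<close>, since \<open>leq x y\<close> means \<open>meet x y = x\<close>.\<close>

definition prime_filter :: "'a set \<Rightarrow> bool" where
  "prime_filter p \<longleftrightarrow> p \<subseteq> A \<and> top \<in> p \<and> bot \<notin> p
     \<and> (\<forall>x\<in>A. \<forall>y\<in>A. meet x y \<in> p \<longleftrightarrow> x \<in> p \<and> y \<in> p)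
     \<and> (\<forall>x\<in>A. \<forall>y\<in>A. join x y \<in> p \<longleftrightarrow> x \<in> p \<or> y \<in> p)"

lemma prime_filterD:
  assumes "prime_filter p"
  shows "p \<subseteq> A" "top \<in> p" "bot \<notin> p"
    and "\<lbrakk>x \<in> A; y \<in> A\<rbrakk> \<Longrightarrow> meet x y \<in> p \<longleftrightarrow> x \<in> p \<and> y \<in> p"
    and "\<lbrakk>x \<in> A; y \<in> A\<rbrakk> \<Longrightarrow> join x y \<in> p \<longleftrightarrow> x \<in> p \<or> y \<in> p"
  using assms unfolding prime_filter_def by blast+

lemma prime_filter_mono:
  "\<lbrakk>prime_filter p; leq x y; x \<in> p; y \<in> A\<rbrakk> \<Longrightarrow> y \<in> p"
  unfolding prime_filter_def leq_def by (metis subsetD)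

text \<open>\<open>E\<close> is the filter generated by \<open>M\<close> and
  \<open>x\<close>.\<close>

lemma filter_on_extend:
  assumes M: "filter_on M" and x: "x \<in> A"
  defines "E \<equiv> {z \<in> A. \<exists>m\<in>M. leq (meet m x) z}"
  shows "filter_on E" "M \<subseteq> E" "x \<in> E"
proof -
  have MA: "\<And>m. m \<in> M \<Longrightarrow> m \<in> A" and T: "top \<in> M"
    using M unfolding filter_on_def by auto
  show sub: "M \<subseteq> E"
    unfolding E_def using meet_leq1 x MA by blast
  show "x \<in> E"
    unfolding E_def using meet_leq2[of top x] x T top_closed by blast
  have "meet z z' \<in> E" if zz: "z \<in> E" "z' \<in> E" for z z'
  proof -
    obtain m m' where m: "m \<in> M" "m' \<in> M" "leq (meet m x) z" "leq (meet m' x) z'"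
      and z: "z \<in> A" "z' \<in> A"
      using zz unfolding E_def by blast
    let ?k = "meet m m'"
    have "?k \<in> M" using m M unfolding filter_on_def by blast
    then have k: "?k \<in> M" "?k \<in> A" using MA by auto
    have c: "meet ?k x \<in> A" "meet m x \<in> A" "meet m' x \<in> A"
      using k x m MA meet_closed by auto
    have "leq (meet ?k x) (meet m x)" "leq (meet ?k x) (meet m' x)"
      using meet_mono[OF meet_leq1 leq_refl, of m m' x] meet_mono[OF meet_leq2 leq_refl, of m m' x]
        m MA x k by auto
    then have "leq (meet ?k x) z" "leq (meet ?k x) z'"
      using m z c leq_trans by blast+
    then have "leq (meet ?k x) (meet z z')"
      using z c meet_greatest by blast
    then show ?thesis unfolding E_def using k z meet_closed by blast
  qed
  moreover have "z' \<in> E" if z: "z \<in> E" "z' \<in> A" "leq z z'" for z z'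
  proof -
    obtain m where m: "m \<in> M" "leq (meet m x) z" using z unfolding E_def by blast
    then have "leq (meet m x) z'"
      using z MA x meet_closed leq_trans[of "meet m x" z z'] unfolding E_def by blast
    then show ?thesis using m z unfolding E_def by blast
  qed
  ultimately show "filter_on E"
    unfolding filter_on_def using sub T unfolding E_def by blast
qed

text \<open>If neither \<open>x\<close> nor \<open>y\<close> is in \<open>M\<close>, adding either
  one makes the filter hit \<open>J\<close>, so \<open>meet m x\<close> and \<open>meet m' y\<close>
  lie in \<open>J\<close> for some \<open>m\<close>, \<open>m'\<close> in \<open>M\<close>. By
  distributivity \<open>J\<close> then contains the meet of \<open>m\<close>, \<open>m'\<close> and
  \<open>join x y\<close>, which \<open>join x y \<in> M\<close> would put into
  \<open>M\<close>.\<close>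

lemma maximal_disjoint_filter_prime:
  assumes M: "filter_on M" and J: "ideal_on J" and disj: "M \<inter> J = {}"
    and max: "\<And>N. \<lbrakk>filter_on N; N \<inter> J = {}; M \<subseteq> N\<rbrakk> \<Longrightarrow> N = M"
  shows "prime_filter M"
proof -
  have MA: "M \<subseteq> A" and T: "top \<in> M" and Jb: "bot \<in> J"
    using M J unfolding filter_on_def ideal_on_def by auto
  have up: "\<And>x y. \<lbrakk>x \<in> M; y \<in> A; leq x y\<rbrakk> \<Longrightarrow> y \<in> M"
    and meetM: "\<And>x y. \<lbrakk>x \<in> M; y \<in> M\<rbrakk> \<Longrightarrow> meet x y \<in> M"
    using M unfolding filter_on_def by auto
  have hit: "\<exists>m\<in>M. meet m x \<in> J" if x: "x \<in> A" "x \<notin> M" for x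
  proof -
    let ?E = "{z \<in> A. \<exists>m\<in>M. leq (meet m x) z}"
    have "?E \<inter> J \<noteq> {}"
      using max[of ?E] filter_on_extend[OF M x(1)] x by blast
    then obtain z m where "z \<in> J" "m \<in> M" "leq (meet m x) z" by auto
    then show ?thesis
      using J MA x meet_closed unfolding ideal_on_def by blast
  qed
  have prime: "x \<in> M \<or> y \<in> M" if xy: "x \<in> A" "y \<in> A" "join x y \<in> M" for x y
  proof (rule ccontr)
    assume "\<not> ?thesis"
    then obtain m m' where m: "m \<in> M" "m' \<in> M" "meet m x \<in> J" "meet m' y \<in> J"
      using hit xy by blast
    let ?k = "meet m m'"
    have mA: "m \<in> A" "m' \<in> A" "?k \<in> A" using m MA meet_closed by auto
    have "leq (meet ?k x) (meet m x)" "leq (meet ?k y) (meet m' y)"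
      using meet_mono[OF meet_leq1 leq_refl, of m m' x] meet_mono[OF meet_leq2 leq_refl, of m m' y]
        mA xy by auto
    then have "meet ?k x \<in> J" "meet ?k y \<in> J"
      using J m mA xy meet_closed unfolding ideal_on_def by blast+
    then have "meet ?k (join x y) \<in> J"
      using J mA xy unfolding ideal_on_def by (simp add: meet_join_distrib)
    moreover have "meet ?k (join x y) \<in> M"
      using meetM m xy by blast
    ultimately show False using disj by blast
  qed
  show ?thesis
    unfolding prime_filter_def
  proof (intro conjI ballI)
    fix x y assume xy: "x \<in> A" "y \<in> A"
    show "meet x y \<in> M \<longleftrightarrow> x \<in> M \<and> y \<in> M"
      using up[OF _ _ meet_leq1[OF xy]] up[OF _ _ meet_leq2[OF xy]] meetM xy by blast
    show "join x y \<in> M \<longleftrightarrow> x \<in> M \<or> y \<in> M"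
      using prime[OF xy] up[OF _ _ join_leq1[OF xy]] up[OF _ _ join_leq2[OF xy]]
        join_closed[OF xy] by blast
  qed (use MA T Jb disj in auto)
qed

text \<open>Stone's prime filter theorem: the union of a chain of filters disjoint from
  \<open>J\<close> is again one, and Zorn's lemma yields a maximal one above
  \<open>F\<close>.\<close>

theorem prime_filter_exists:
  assumes F: "filter_on F" and J: "ideal_on J" and disj: "F \<inter> J = {}"
  shows "\<exists>p. prime_filter p \<and> F \<subseteq> p \<and> p \<inter> J = {}"
proof -
  define C where "C = {P. filter_on P \<and> F \<subseteq> P \<and> P \<inter> J = {}}"
  have "\<exists>M\<in>C. \<forall>X\<in>C. M \<subseteq> X \<longrightarrow> X = M"
  proof (rule subset_Zorn_nonempty)
    show "C \<noteq> {}" unfolding C_def using F disj by blast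
  next
    fix K assume K: "K \<noteq> {}" "subset.chain C K"
    then have KC: "\<And>P. P \<in> K \<Longrightarrow> P \<in> C"
      and lin: "\<And>P Q. \<lbrakk>P \<in> K; Q \<in> K\<rbrakk> \<Longrightarrow> P \<subseteq> Q \<or> Q \<subseteq> P"
      unfolding subset.chain_def by blast+
    have "meet x y \<in> \<Union>K" if xy: "x \<in> \<Union>K" "y \<in> \<Union>K" for x y
    proof -
      obtain P where "P \<in> K" "x \<in> P" "y \<in> P"
        using xy lin by blast
      then show ?thesis using KC unfolding C_def filter_on_def by blast
    qed
    moreover have "\<Union>K \<subseteq> A" "top \<in> \<Union>K" "F \<subseteq> \<Union>K" "\<Union>K \<inter> J = {}"
      "\<forall>x\<in>\<Union>K. \<forall>y\<in>A. leq x y \<longrightarrow> y \<in> \<Union>K"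
      using K(1) KC unfolding C_def filter_on_def by blast+
    ultimately show "\<Union>K \<in> C"
      unfolding C_def filter_on_def by blast
  qed
  then obtain M where M: "M \<in> C" and max: "\<And>X. \<lbrakk>X \<in> C; M \<subseteq> X\<rbrakk> \<Longrightarrow> X = M"
    by blast
  have "prime_filter M"
    using M max by (intro maximal_disjoint_filter_prime[OF _ J]) (auto simp: C_def)
  then show ?thesis using M unfolding C_def by blast
qed

text \<open>The principal filter of \<open>x\<close> and the principal ideal of \<open>y\<close> are
  disjoint exactly when \<open>x\<close> is not below \<open>y\<close>.\<close>

lemma prime_filter_separates:
  assumes xy: "x \<in> A" "y \<in> A" and n: "\<not> leq x y"
  shows "\<exists>p. prime_filter p \<and> x \<in> p \<and> y \<notin> p"
proof -
  let ?F = "{z \<in> A. leq x z}" and ?J = "{z \<in> A. leq z y}"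
  have "filter_on ?F"
    unfolding filter_on_def using xy leq_top top_closed meet_closed meet_greatest
    by (auto dest: leq_trans[of x])
  moreover have "ideal_on ?J"
    unfolding ideal_on_def using xy leq_bot bot_closed join_closed join_least
    by (auto dest: leq_trans[of _ _ y])
  moreover have "?F \<inter> ?J = {}" using n xy leq_trans by blast
  ultimately obtain p where "prime_filter p" "?F \<subseteq> p" "p \<inter> ?J = {}"
    using prime_filter_exists by meson
  then show ?thesis using xy leq_refl by blast
qed

lemma leq_iff_prime_filters:
  assumes "x \<in> A" "y \<in> A"
  shows "leq x y \<longleftrightarrow> (\<forall>p. prime_filter p \<longrightarrow> x \<in> p \<longrightarrow> y \<in> p)"
  using assms prime_filter_separates prime_filter_mono by blast

lemma eq_iff_prime_filters:
  assumes "x \<in> A" "y \<in> A"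
  shows "x = y \<longleftrightarrow> (\<forall>p. prime_filter p \<longrightarrow> (x \<in> p \<longleftrightarrow> y \<in> p))"
  using leq_iff_prime_filters[OF assms] leq_iff_prime_filters[OF assms(2,1)]
    leq_antisym[OF _ _ assms] by blast

end

section \<open>Totally preordered abelian groups\<close>

text \<open>Only a preorder, because distinct group elements may coincide at a prime filter; this
  avoids forming a quotient for each filter.\<close>

locale preordered_group = comm_group G for G (structure) +
  fixes le :: "'a \<Rightarrow> 'a \<Rightarrow> bool" (infix "\<preceq>" 50)
  assumes le_refl: "x \<in> carrier G \<Longrightarrow> x \<preceq> x"
    and le_trans: "\<lbrakk>x \<preceq> y; y \<preceq> z; x \<in> carrier G; y \<in> carrier G; z \<in> carrier G\<rbrakk> \<Longrightarrow> x \<preceq> z"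
    and le_total: "\<lbrakk>x \<in> carrier G; y \<in> carrier G\<rbrakk> \<Longrightarrow> x \<preceq> y \<or> y \<preceq> x"
    and le_mult: "\<lbrakk>x \<preceq> y; x \<in> carrier G; y \<in> carrier G; z \<in> carrier G\<rbrakk> \<Longrightarrow> x \<otimes> z \<preceq> y \<otimes> z"
begin

lemma le_mult_cancel:
  assumes "x \<in> carrier G" "y \<in> carrier G" "z \<in> carrier G"
  shows "x \<otimes> z \<preceq> y \<otimes> z \<longleftrightarrow> x \<preceq> y"
proof
  assume "x \<otimes> z \<preceq> y \<otimes> z"
  then have "x \<otimes> z \<otimes> inv z \<preceq> y \<otimes> z \<otimes> inv z"
    by (rule le_mult) (use assms in auto)
  moreover have "a \<otimes> z \<otimes> inv z = a" if "a \<in> carrier G" for a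
    using that assms by (simp add: m_assoc)
  ultimately show "x \<preceq> y" using assms by simp
qed (use assms le_mult in auto)

lemma le_iff_one_le:
  assumes "x \<in> carrier G" "y \<in> carrier G"
  shows "x \<preceq> y \<longleftrightarrow> \<one> \<preceq> y \<otimes> inv x"
  using le_mult_cancel[of x y "inv x"] assms by simp

lemma le_mult_mono:
  assumes "x \<preceq> y" "x' \<preceq> y'" "x \<in> carrier G" "y \<in> carrier G" "x' \<in> carrier G" "y' \<in> carrier G"
  shows "x \<otimes> x' \<preceq> y \<otimes> y'"
proof (rule le_trans)
  show "x \<otimes> x' \<preceq> y \<otimes> x'" using assms le_mult by auto
  show "y \<otimes> x' \<preceq> y \<otimes> y'" using assms le_mult[of x' y' y] by (simp add: m_comm)
qed (use assms in auto)

lemma le_pow_mono: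
  assumes "x \<preceq> y" "x \<in> carrier G" "y \<in> carrier G"
  shows "x [^] (n::nat) \<preceq> y [^] n"
  by (induction n) (use assms le_mult_mono le_refl in auto)

lemma le_inv_iff:
  assumes "x \<in> carrier G" "y \<in> carrier G"
  shows "inv x \<preceq> inv y \<longleftrightarrow> y \<preceq> x"
  using le_iff_one_le[of "inv x" "inv y"] le_iff_one_le[of y x] assms by (simp add: m_comm)

lemma le_pow_iff:
  assumes n: "n > 0" and x: "x \<in> carrier G" and y: "y \<in> carrier G"
  shows "x [^] (n::nat) \<preceq> y [^] n \<longleftrightarrow> x \<preceq> y"
proof
  assume le: "x [^] n \<preceq> y [^] n"
  obtain m where m: "n = Suc m" using n gr0_implies_Suc by blast
  show "x \<preceq> y"
  proof (rule ccontr)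
    assume "\<not> x \<preceq> y"
    then have "y \<preceq> x" using le_total x y by blast
    then have "y [^] m \<preceq> x [^] m" using x y le_pow_mono by blast
    then have "y [^] m \<otimes> x \<preceq> x [^] n" using x y le_mult m by simp
    then have "y [^] m \<otimes> x \<preceq> y [^] m \<otimes> y" using le x y m by (simp, meson le_trans m_closed nat_pow_closed)
    then show False
      using \<open>\<not> x \<preceq> y\<close> le_mult_cancel[of x y "y [^] m"] x y by (simp add: m_comm)
  qed
qed (use x y le_pow_mono in blast)

lemma le_one_iff_inv: "x \<in> carrier G \<Longrightarrow> x \<preceq> \<one> \<longleftrightarrow> \<one> \<preceq> inv x"
  using le_iff_one_le[of x \<one>] by simp

lemma finite_has_greatest:
  assumes "finite X" "X \<noteq> {}" "X \<subseteq> carrier G"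
  shows "\<exists>m\<in>X. \<forall>x\<in>X. x \<preceq> m"
  using assms
proof (induction rule: finite_ne_induct)
  case (singleton x)
  then show ?case using le_refl by auto
next
  case (insert x F)
  then obtain m where m: "m \<in> F" "\<forall>y\<in>F. y \<preceq> m" by auto
  show ?case
  proof (cases "x \<preceq> m")
    case True
    then show ?thesis using m by auto
  next
    case False
    then have "m \<preceq> x" using le_total m insert by blast
    have "y \<preceq> x" if "y \<in> F" for y
      using le_trans[of y m x] \<open>m \<preceq> x\<close> m insert that by blast
    then show ?thesis using insert le_refl by auto
  qed
qed

lemma finite_has_least:
  assumes "finite X" "X \<noteq> {}" "X \<subseteq> carrier G"
  shows "\<exists>m\<in>X. \<forall>x\<in>X. m \<preceq> x"
proof -
  have "\<exists>m\<in>m_inv G ` X. \<forall>x\<in>m_inv G ` X. x \<preceq> m"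
    using assms by (intro finite_has_greatest) auto
  then show ?thesis using assms le_inv_iff by (auto simp: subset_iff)
qed

text \<open>Divisibility makes the order dense and a nontrivial element removes endpoints: between
  the greatest element of \<open>L\<close> and the least of \<open>U\<close> lies their midpoint,
  and when one side is empty a shift by the strictly positive \<open>c\<close> or its inverse leaves
  the other side behind.\<close>

lemma cut_filled:
  assumes div: "\<And>x n. \<lbrakk>x \<in> carrier G; n > 0\<rbrakk> \<Longrightarrow> \<exists>y\<in>carrier G. y [^] (n::nat) = x"
    and nontriv: "\<exists>c\<in>carrier G. \<not> c \<preceq> \<one>"
    and fin: "finite L" "finite U" and sub: "L \<subseteq> carrier G" "U \<subseteq> carrier G"
    and less: "\<And>l u. \<lbrakk>l \<in> L; u \<in> U\<rbrakk> \<Longrightarrow> \<not> u \<preceq> l"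
  shows "\<exists>y\<in>carrier G. (\<forall>l\<in>L. \<not> y \<preceq> l) \<and> (\<forall>u\<in>U. \<not> u \<preceq> y)"
proof -
  obtain c where c: "c \<in> carrier G" "\<not> c \<preceq> \<one>" using nontriv by blast
  have above: "\<not> m \<otimes> c \<preceq> m" if "m \<in> carrier G" for m
    using c le_mult_cancel[of c \<one> m] that by (simp add: m_comm)
  have below: "\<not> m \<preceq> m \<otimes> inv c" if "m \<in> carrier G" for m
    using c le_mult_cancel[of \<one> "inv c" m] le_one_iff_inv[of c] that by (simp add: m_comm)
  consider "L = {}" "U = {}" | "L \<noteq> {}" "U = {}" | "L = {}" "U \<noteq> {}" | "L \<noteq> {}" "U \<noteq> {}" by blast
  then show ?thesis
  proof cases
    case 1
    then show ?thesis by auto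
  next
    case 2
    then obtain m where m: "m \<in> L" "\<forall>l\<in>L. l \<preceq> m"
      using finite_has_greatest[OF fin(1) _ sub(1)] by blast
    have "\<not> m \<otimes> c \<preceq> l" if "l \<in> L" for l
      using above[of m] le_trans[of "m \<otimes> c" l m] m that sub c m_closed by blast
    then show ?thesis using 2 c m sub by (intro bexI[of _ "m \<otimes> c"]) auto
  next
    case 3
    then obtain m where m: "m \<in> U" "\<forall>l\<in>U. m \<preceq> l"
      using finite_has_least[OF fin(2) _ sub(2)] by blast
    have "\<not> u \<preceq> m \<otimes> inv c" if "u \<in> U" for u
      using below[of m] le_trans[of m u "m \<otimes> inv c"] m that sub c m_closed inv_closed by blast
    then show ?thesis using 3 c m sub by (intro bexI[of _ "m \<otimes> inv c"]) auto
  next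
    case 4
    obtain l where l: "l \<in> L" "\<forall>x\<in>L. x \<preceq> l" 
      using finite_has_greatest[OF fin(1) 4(1) sub(1)] by blast
    obtain u where u: "u \<in> U" "\<forall>x\<in>U. u \<preceq> x" 
      using finite_has_least[OF fin(2) 4(2) sub(2)] by blast
    have lu: "l \<in> carrier G" "u \<in> carrier G" using l u sub by auto
    \<comment> \<open>\<open>y\<close> is the midpoint of \<open>l\<close> and \<open>u\<close>,
      written multiplicatively.\<close>
    obtain y where y: "y \<in> carrier G" "y [^] (2::nat) = l \<otimes> u"
      using div[of "l \<otimes> u" 2] lu by auto
    then have yy: "y \<otimes> y = l \<otimes> u" by (simp add: numeral_2_eq_2)
    have nl: "\<not> y \<preceq> l"
    proof
      assume "y \<preceq> l"
      then have "l \<otimes> u \<preceq> l \<otimes> l" using le_mult_mono[of y l y l] yy y lu by simp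
      then show False using le_mult_cancel[of u l l] lu less l u by (simp add: m_comm)
    qed
    have nu: "\<not> u \<preceq> y"
    proof
      assume "u \<preceq> y"
      then have "u \<otimes> u \<preceq> l \<otimes> u" using le_mult_mono[of u y u y] yy y lu by simp
      then show False using le_mult_cancel[of u l u] lu less l u by simp
    qed
    have "\<not> y \<preceq> x" if "x \<in> L" for x
      using nl l that lu y sub le_trans[of y x l] by blast
    moreover have "\<not> x \<preceq> y" if "x \<in> U" for x
      using nu u that lu y sub le_trans[of u x y] by blast
    ultimately show ?thesis using y by blast
  qed
qed

end

section \<open>Integer combinations of bounded size\<close>

context comm_group
begin

text \<open>The integer combinations of elements of \<open>X\<close> whose coefficients have absolute values
  adding up to at most \<open>n\<close>.\<close>

primrec combos :: "nat \<Rightarrow> 'a set \<Rightarrow> 'a set" where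
  "combos 0 X = {\<one>}"
| "combos (Suc n) X =
     {s \<otimes> y | s y. s \<in> combos n X \<and> (y = \<one> \<or> y \<in> X \<or> (\<exists>x\<in>X. y = inv x))}"

lemma combos_subset: "X \<subseteq> carrier G \<Longrightarrow> combos n X \<subseteq> carrier G"
  by (induction n) auto

lemma combosD: "\<lbrakk>s \<in> combos n X; X \<subseteq> carrier G\<rbrakk> \<Longrightarrow> s \<in> carrier G"
  using combos_subset by blast

lemma finite_combos: "finite X \<Longrightarrow> finite (combos n X)"
proof (induction n)
  case (Suc n)
  have "combos (Suc n) X = (\<lambda>(s, y). s \<otimes> y) ` (combos n X \<times> ({\<one>} \<union> X \<union> m_inv G ` X))"
    by auto
  then show ?case using Suc by simp
qed auto

text \<open>The factor \<open>\<one>\<close> allowed at each stage makes \<open>n\<close> an upper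
  bound of the size and not its exact value.\<close>

lemma combos_Suc_mono:
  assumes X: "X \<subseteq> carrier G"
  shows "combos n X \<subseteq> combos (Suc n) X"
proof
  fix s assume s: "s \<in> combos n X"
  then have "s = s \<otimes> \<one>" using combosD X by simp
  then show "s \<in> combos (Suc n) X" using s by auto
qed

lemma combos_mono:
  assumes "n \<le> m" "X \<subseteq> Y" "Y \<subseteq> carrier G"
  shows "combos n X \<subseteq> combos m Y"
proof -
  have "combos n X \<subseteq> combos n Y"
  proof (induction n)
    case (Suc n)
    show ?case
    proof
      fix z assume "z \<in> combos (Suc n) X"
      then obtain s y where "z = s \<otimes> y" "s \<in> combos n X" "y = \<one> \<or> y \<in> X \<or> (\<exists>x\<in>X. y = inv x)"
        by auto
      then have "z = s \<otimes> y \<and> s \<in> combos n Y \<and> (y = \<one> \<or> y \<in> Y \<or> (\<exists>x\<in>Y. y = inv x))"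
        using Suc assms(2) by blast
      then show "z \<in> combos (Suc n) Y" unfolding combos.simps by blast
    qed
  qed simp
  also have "combos n Y \<subseteq> combos m Y"
    using assms(1) by (induction rule: dec_induct) (use combos_Suc_mono assms(3) in blast)+
  finally show ?thesis .
qed

lemma combos_base: "\<lbrakk>x \<in> X; X \<subseteq> carrier G\<rbrakk> \<Longrightarrow> x \<in> combos (Suc 0) X"
  by force

lemma combos_mult:
  assumes X: "X \<subseteq> carrier G" and s: "s \<in> combos m X" and t: "t \<in> combos n X"
  shows "s \<otimes> t \<in> combos (m + n) X"
  using t
proof (induction n arbitrary: t)
  case 0
  then show ?case using s combosD[OF s X] by simp
next
  case (Suc n)
  then obtain r y where r: "t = r \<otimes> y" "r \<in> combos n X" and y: "y = \<one> \<or> y \<in> X \<or> (\<exists>x\<in>X. y = inv x)"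
    by auto
  have "s \<otimes> r \<in> combos (m + n) X" using Suc r by simp
  moreover have "s \<otimes> t = (s \<otimes> r) \<otimes> y"
    using r y s X combosD by (auto simp: m_assoc subset_iff)
  ultimately show ?case using y by auto
qed

lemma combos_inv:
  assumes X: "X \<subseteq> carrier G" and s: "s \<in> combos n X"
  shows "inv s \<in> combos n X"
  using s
proof (induction n arbitrary: s)
  case (Suc n)
  then obtain r y where r: "s = r \<otimes> y" "r \<in> combos n X" and y: "y = \<one> \<or> y \<in> X \<or> (\<exists>x\<in>X. y = inv x)"
    by auto
  then have "y \<in> carrier G" "r \<in> carrier G" using X combosD by auto
  then have "inv s = inv r \<otimes> inv y" using r by (simp add: inv_mult)
  moreover have "inv y = \<one> \<or> inv y \<in> X \<or> (\<exists>x\<in>X. inv y = inv x)"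
    using y X by auto
  ultimately show ?case using Suc r by auto
qed auto

lemma combos_pow:
  assumes X: "X \<subseteq> carrier G" and s: "s \<in> combos n X"
  shows "s [^] (k::nat) \<in> combos (k * n) X"
proof (induction k)
  case (Suc k)
  then show ?case using combos_mult[OF X Suc s] by (simp add: add.commute)
qed simp

text \<open>All factors \<open>z\<close> and \<open>inv z\<close> are collected into one power. The
  result is split by sign because the order lemmas speak of natural powers.\<close>

lemma combos_insert:
  assumes X: "X \<subseteq> carrier G" and z: "z \<in> carrier G" and s: "s \<in> combos n (insert z X)"
  shows "\<exists>t\<in>combos n X. \<exists>k\<le>n. s = t \<otimes> z [^] (k::nat) \<or> s = t \<otimes> inv (z [^] k)"
proof -
  \<comment> \<open>During the induction the exponent is an integer, as the next factor may raise or
    lower it.\<close>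
  have "\<exists>t\<in>combos n X. \<exists>k::int. \<bar>k\<bar> \<le> int n \<and> s = t \<otimes> z [^] k"
    using s
  proof (induction n arbitrary: s)
    case 0
    then show ?case by (intro bexI[of _ \<one>] exI[of _ 0]) auto
  next
    case (Suc n)
    then obtain r y where r: "s = r \<otimes> y" "r \<in> combos n (insert z X)"
      and y: "y = \<one> \<or> y \<in> insert z X \<or> (\<exists>x\<in>insert z X. y = inv x)"
      by auto
    then obtain t k where t: "t \<in> combos n X" and k: "\<bar>k\<bar> \<le> int n" "r = t \<otimes> z [^] k"
      using Suc by blast
    have tc: "t \<in> carrier G" using t X combosD by blast
    consider "y = z" | "y = inv z" | "y = \<one> \<or> y \<in> X \<or> (\<exists>x\<in>X. y = inv x)" using y by auto
    then show ?case
    proof cases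
      case 1
      then have "s = t \<otimes> z [^] (k + 1)"
        using r k tc z by (simp add: m_assoc int_pow_mult)
      then show ?thesis using t k combos_Suc_mono[OF X, of n]
        by (intro bexI[of _ t] exI[of _ "k + 1"]) auto
    next
      case 2
      then have "s = t \<otimes> z [^] (k + (- 1))"
        using r k tc z by (simp only: int_pow_mult int_pow_neg) (simp add: m_assoc)
      then show ?thesis using t k combos_Suc_mono[OF X, of n]
        by (intro bexI[of _ t] exI[of _ "k + (- 1)"]) auto
    next
      case 3
      then have yc: "y \<in> carrier G" using X by auto
      have "s = (t \<otimes> y) \<otimes> z [^] k" using r k tc yc z by (simp add: m_ac)
      moreover have "t \<otimes> y \<in> combos (Suc n) X" using t 3 by auto
      ultimately show ?thesis using k by (intro bexI[of _ "t \<otimes> y"] exI[of _ k]) auto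
    qed
  qed
  then obtain t k where t: "t \<in> combos n X" and k: "\<bar>k\<bar> \<le> int n" "s = t \<otimes> z [^] k" by blast
  show ?thesis
  proof (cases "k \<ge> 0")
    case True
    then have "z [^] k = z [^] nat k" by (subst int_pow_def2) simp
    then have "s = t \<otimes> z [^] nat k" using k by metis
    moreover have "nat k \<le> n" using k by simp
    ultimately show ?thesis using t by blast
  next
    case False
    then have "z [^] k = inv (z [^] nat (- k))" by (subst int_pow_def2) simp
    then have "s = t \<otimes> inv (z [^] nat (- k))" using k by metis
    moreover have "nat (- k) \<le> n" using k by simp
    ultimately show ?thesis using t by blast
  qed
qed

end

section \<open>Matched tuples in two preordered groups\<close>

locale preordered_group_pair =
  A: preordered_group G leG + B: preordered_group H leH
  for G :: "('a, 'p) monoid_scheme" and leG and H :: "('b, 'q) monoid_scheme" and leH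
begin

lemma DirProd_comm_group: "comm_group (G \<times>\<times> H)"
  by (intro group.group_comm_groupI DirProd_group A.is_group B.is_group)
    (auto simp: A.m_comm B.m_comm)

sublocale D: comm_group "G \<times>\<times> H"
  by (rule DirProd_comm_group)

text \<open>A combination formed in the direct product uses the same coefficients in both
  components. Hence this says that corresponding combinations of size at most \<open>n\<close> have
  the same sign: a position of the Ehrenfeucht-Fraisse game.\<close>

definition matched :: "nat \<Rightarrow> ('a \<times> 'b) set \<Rightarrow> bool" where
  "matched n X \<longleftrightarrow>
     (\<forall>(x, y)\<in>D.combos n X. leG \<one>\<^bsub>G\<^esub> x \<longleftrightarrow> leH \<one>\<^bsub>H\<^esub> y)"

lemma DirProd_nat_pow:
  "(x, y) [^]\<^bsub>G \<times>\<times> H\<^esub> (n::nat) = (x [^]\<^bsub>G\<^esub> n, y [^]\<^bsub>H\<^esub> n)"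
  by (induction n) auto

lemma matched_mono:
  "\<lbrakk>matched m Y; n \<le> m; X \<subseteq> Y; Y \<subseteq> carrier G \<times> carrier H\<rbrakk> \<Longrightarrow> matched n X"
  using D.combos_mono[of n m X Y] unfolding matched_def by auto

text \<open>A comparison is a sign condition on the difference, and the sizes of the two sides add
  up.\<close>

lemma matched_le:
  assumes mt: "matched (m + n) X" and X: "X \<subseteq> carrier G \<times> carrier H"
    and s: "(x, y) \<in> D.combos m X" and t: "(x', y') \<in> D.combos n X"
  shows "leG x x' \<longleftrightarrow> leH y y'"
proof -
  have XD: "X \<subseteq> carrier (G \<times>\<times> H)" using X by simp
  have c: "x \<in> carrier G" "x' \<in> carrier G" "y \<in> carrier H" "y' \<in> carrier H"
    using D.combosD[OF s XD] D.combosD[OF t XD] by auto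
  have "(x', y') \<otimes>\<^bsub>G \<times>\<times> H\<^esub> inv\<^bsub>G \<times>\<times> H\<^esub> (x, y) \<in> D.combos (n + m) X"
    by (intro D.combos_mult D.combos_inv XD s t)
  then have "(x' \<otimes>\<^bsub>G\<^esub> inv\<^bsub>G\<^esub> x, y' \<otimes>\<^bsub>H\<^esub> inv\<^bsub>H\<^esub> y) \<in> D.combos (m + n) X"
    using c by (simp add: A.is_group B.is_group add.commute)
  then have "leG \<one>\<^bsub>G\<^esub> (x' \<otimes>\<^bsub>G\<^esub> inv\<^bsub>G\<^esub> x) \<longleftrightarrow> leH \<one>\<^bsub>H\<^esub> (y' \<otimes>\<^bsub>H\<^esub> inv\<^bsub>H\<^esub> y)"
    using mt unfolding matched_def by blast
  then show ?thesis using A.le_iff_one_le[OF c(1,2)] B.le_iff_one_le[OF c(3,4)] by simp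
qed

text \<open>If \<open>a\<close> is equivalent to the second component of some pair in
  \<open>T\<close>, the first component of that pair answers it. Otherwise \<open>a\<close> splits
  \<open>T\<close> into pairs strictly below and strictly above, and the corresponding cut in
  \<open>G\<close> is filled.\<close>

lemma cut_matched:
  assumes div: "\<And>x n. \<lbrakk>x \<in> carrier G; n > 0\<rbrakk> \<Longrightarrow> \<exists>y\<in>carrier G. y [^]\<^bsub>G\<^esub> (n::nat) = x"
    and nontriv: "\<exists>c\<in>carrier G. \<not> leG c \<one>\<^bsub>G\<^esub>"
    and T: "finite T" "T \<subseteq> carrier G \<times> carrier H"
    and le: "\<And>x y x' y'. \<lbrakk>(x, y) \<in> T; (x', y') \<in> T\<rbrakk> \<Longrightarrow> leG x x' \<longleftrightarrow> leH y y'"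
    and a: "a \<in> carrier H"
  shows "\<exists>b\<in>carrier G. \<forall>(x, y)\<in>T. (leG x b \<longleftrightarrow> leH y a) \<and> (leG b x \<longleftrightarrow> leH a y)"
proof (cases "\<exists>(x, y)\<in>T. leH y a \<and> leH a y")
  case True
  then obtain b a' where b: "(b, a') \<in> T" "leH a' a" "leH a a'" by auto
  then have a': "a' \<in> carrier H" and bc: "b \<in> carrier G" using T by auto
  have "(leG x b \<longleftrightarrow> leH y a) \<and> (leG b x \<longleftrightarrow> leH a y)" if xy: "(x, y) \<in> T" for x y
  proof -
    have "y \<in> carrier H" using xy T by auto
    then have "leH y a' \<longleftrightarrow> leH y a" "leH a' y \<longleftrightarrow> leH a y"
      using b a a' B.le_trans[of y a' a] B.le_trans[of y a a'] B.le_trans[of a a' y]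
        B.le_trans[of a' a y] by blast+
    then show ?thesis using le b xy by blast
  qed
  then show ?thesis using bc by blast
next
  case False
  let ?L = "{t \<in> T. leH (snd t) a}" and ?U = "{t \<in> T. leH a (snd t)}"
  have "\<exists>b\<in>carrier G. (\<forall>l\<in>fst ` ?L. \<not> leG b l) \<and> (\<forall>u\<in>fst ` ?U. \<not> leG u b)"
  proof (rule A.cut_filled[OF div nontriv])
    fix l u assume "l \<in> fst ` ?L" "u \<in> fst ` ?U"
    then obtain l' u' where l: "(l, l') \<in> T" "leH l' a" and u: "(u, u') \<in> T" "leH a u'" by auto
    show "\<not> leG u l"
    proof
      assume "leG u l"
      then have "leH u' l'" using le l u by blast
      moreover have "l' \<in> carrier H" "u' \<in> carrier H" using l u T by auto
      ultimately have "leH u' a" using l a B.le_trans[of u' l' a] by blast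
      then show False using False u by blast
    qed
  qed (use T in auto)
  then obtain b where b: "b \<in> carrier G" "\<forall>l\<in>fst ` ?L. \<not> leG b l" "\<forall>u\<in>fst ` ?U. \<not> leG u b"
    by blast
  have "(leG x b \<longleftrightarrow> leH y a) \<and> (leG b x \<longleftrightarrow> leH a y)" if xy: "(x, y) \<in> T" for x y
  proof -
    have c: "x \<in> carrier G" "y \<in> carrier H" using xy T by auto
    consider "leH y a" "\<not> leH a y" | "leH a y" "\<not> leH y a"
      using False xy B.le_total[of y a] a c by blast
    then show ?thesis
    proof cases
      case 1
      then have "x \<in> fst ` ?L" using xy by force
      then show ?thesis using 1 b c A.le_total by blast
    next
      case 2
      then have "x \<in> fst ` ?U" using xy by force
      then show ?thesis using 2 b c A.le_total by blast
    qed
  qed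
  then show ?thesis using b by blast
qed

text \<open>A sign condition on \<open>s + k a\<close> is multiplied by \<open>N! / k\<close>, so that it compares
  \<open>N! a\<close> with a combination of \<open>X\<close>.\<close>

lemma matched_extend:
  assumes div: "\<And>x n. \<lbrakk>x \<in> carrier G; n > 0\<rbrakk> \<Longrightarrow> \<exists>y\<in>carrier G. y [^]\<^bsub>G\<^esub> (n::nat) = x"
    and nontriv: "\<exists>c\<in>carrier G. \<not> leG c \<one>\<^bsub>G\<^esub>"
    and X: "finite X" "X \<subseteq> carrier G \<times> carrier H"
    and mt: "matched (2 * (fact N * N)) X" and a: "a \<in> carrier H"
  shows "\<exists>b\<in>carrier G. matched N (insert (b, a) X)"
proof -
  \<comment> \<open>The factorial is a common multiple of all exponents \<open>k\<close> with
    \<open>0 < k \<le> N\<close> that \<open>a\<close> can carry in a combination of size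
    \<open>N\<close>.\<close>
  define K :: nat where "K = fact N"
  have K: "K > 0" unfolding K_def by simp
  have XD: "X \<subseteq> carrier (G \<times>\<times> H)" using X by simp
  let ?T = "D.combos (K * N) X"
  have T: "?T \<subseteq> carrier G \<times> carrier H" "finite ?T"
    using D.combos_subset[OF XD] D.finite_combos X by auto
  have "\<exists>c\<in>carrier G. \<forall>(x, y)\<in>?T. (leG x c \<longleftrightarrow> leH y (a [^]\<^bsub>H\<^esub> K)) \<and> (leG c x \<longleftrightarrow> leH (a [^]\<^bsub>H\<^esub> K) y)"
  proof (rule cut_matched[OF div nontriv])
    fix x y x' y' assume "(x, y) \<in> ?T" "(x', y') \<in> ?T"
    \<comment> \<open>Both elements have size \<open>K * N\<close>, whence the factor 2 in the
      hypothesis.\<close>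
    moreover have "matched (K * N + K * N) X" using mt unfolding K_def by (simp add: mult_2)
    ultimately show "leG x x' \<longleftrightarrow> leH y y'" using matched_le X by blast
  qed (use T a in auto)
  then obtain c where c: "c \<in> carrier G"
    and cut: "\<And>x y. (x, y) \<in> ?T \<Longrightarrow> (leG x c \<longleftrightarrow> leH y (a [^]\<^bsub>H\<^esub> K)) \<and> (leG c x \<longleftrightarrow> leH (a [^]\<^bsub>H\<^esub> K) y)"
    by blast
  \<comment> \<open>\<open>c\<close> answers the power \<open>a [^] K\<close>; its
    \<open>K\<close>-th root answers \<open>a\<close> itself.\<close>
  obtain b where b: "b \<in> carrier G" "b [^]\<^bsub>G\<^esub> K = c" using div c K by blast
  have pow: "(leG s (b [^]\<^bsub>G\<^esub> k) \<longleftrightarrow> leH t (a [^]\<^bsub>H\<^esub> k)) \<and> (leG (b [^]\<^bsub>G\<^esub> k) s \<longleftrightarrow> leH (a [^]\<^bsub>H\<^esub> k) t)"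
    if st: "(s, t) \<in> D.combos N X" and k: "k \<le> N" "k > 0" for s t k
  proof -
    \<comment> \<open>Raising to the power \<open>m = K / k\<close> turns \<open>b [^] k\<close>
      into \<open>c\<close> and keeps the size of \<open>(s, t)\<close> within \<open>K * N\<close>,
      where the cut is controlled.\<close>
    obtain m where m: "K = k * m" using k unfolding K_def by (metis dvdE dvd_fact One_nat_def Suc_leI)
    have m0: "m > 0" using m K by (metis gr0I mult_0_right)
    have sc: "s \<in> carrier G" "t \<in> carrier H" using D.combosD[OF st XD] by auto
    have "(s [^]\<^bsub>G\<^esub> m, t [^]\<^bsub>H\<^esub> m) \<in> D.combos (m * N) X"
      using D.combos_pow[OF XD st, of m] by (simp add: DirProd_nat_pow)
    moreover have "m * N \<le> K * N" using m k by auto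
    ultimately have "(s [^]\<^bsub>G\<^esub> m, t [^]\<^bsub>H\<^esub> m) \<in> ?T"
      using D.combos_mono[of "m * N" "K * N" X X] XD by blast
    from cut[OF this] show ?thesis
      using A.le_pow_iff[OF m0] B.le_pow_iff[OF m0] sc b a m
      by (metis A.nat_pow_pow B.nat_pow_pow A.nat_pow_closed B.nat_pow_closed)
  qed
  have one: "leG \<one>\<^bsub>G\<^esub> s \<longleftrightarrow> leH \<one>\<^bsub>H\<^esub> t" if st: "(s, t) \<in> D.combos N X" for s t
  proof -
    have "N \<le> 2 * (fact N * N)" by (simp add: mult_2 trans_le_add1)
    then have "matched N X" using matched_mono[OF mt _ subset_refl] X by blast
    then show ?thesis using st unfolding matched_def by blast
  qed
  have "leG \<one>\<^bsub>G\<^esub> x \<longleftrightarrow> leH \<one>\<^bsub>H\<^esub> y" if xy: "(x, y) \<in> D.combos N (insert (b, a) X)" for x y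
  proof -
    have "(b, a) \<in> carrier (G \<times>\<times> H)" using a b by simp
    then obtain s t k where st: "(s, t) \<in> D.combos N X" and k: "k \<le> N"
      and or: "(x, y) = (s, t) \<otimes>\<^bsub>G \<times>\<times> H\<^esub> (b, a) [^]\<^bsub>G \<times>\<times> H\<^esub> k \<or>
        (x, y) = (s, t) \<otimes>\<^bsub>G \<times>\<times> H\<^esub> inv\<^bsub>G \<times>\<times> H\<^esub> ((b, a) [^]\<^bsub>G \<times>\<times> H\<^esub> k)"
      using D.combos_insert[OF XD _ xy] by auto
    have sc: "s \<in> carrier G" "t \<in> carrier H" using D.combosD[OF st XD] by auto
    have pc: "b [^]\<^bsub>G\<^esub> k \<in> carrier G" "a [^]\<^bsub>H\<^esub> k \<in> carrier H" using a b by auto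
    have inv: "(inv\<^bsub>G\<^esub> s, inv\<^bsub>H\<^esub> t) \<in> D.combos N X"
      using D.combos_inv[OF XD st] sc by (simp add: A.is_group B.is_group)
    consider "x = s \<otimes>\<^bsub>G\<^esub> b [^]\<^bsub>G\<^esub> k" "y = t \<otimes>\<^bsub>H\<^esub> a [^]\<^bsub>H\<^esub> k"
      | "x = s \<otimes>\<^bsub>G\<^esub> inv\<^bsub>G\<^esub> (b [^]\<^bsub>G\<^esub> k)" "y = t \<otimes>\<^bsub>H\<^esub> inv\<^bsub>H\<^esub> (a [^]\<^bsub>H\<^esub> k)"
      using or pc by (auto simp: DirProd_nat_pow A.is_group B.is_group)
    then show ?thesis
    proof cases
      case 1
      have "leG \<one>\<^bsub>G\<^esub> x \<longleftrightarrow> leG (inv\<^bsub>G\<^esub> s) (b [^]\<^bsub>G\<^esub> k)"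
        "leH \<one>\<^bsub>H\<^esub> y \<longleftrightarrow> leH (inv\<^bsub>H\<^esub> t) (a [^]\<^bsub>H\<^esub> k)"
        using 1 sc pc A.le_iff_one_le[of "inv\<^bsub>G\<^esub> s" "b [^]\<^bsub>G\<^esub> k"]
          B.le_iff_one_le[of "inv\<^bsub>H\<^esub> t" "a [^]\<^bsub>H\<^esub> k"] by (simp_all add: A.m_comm B.m_comm)
      then show ?thesis
        using pow[OF inv k] one[OF st] 1 sc by (cases "k = 0") auto
    next
      case 2
      have "leG \<one>\<^bsub>G\<^esub> x \<longleftrightarrow> leG (b [^]\<^bsub>G\<^esub> k) s" "leH \<one>\<^bsub>H\<^esub> y \<longleftrightarrow> leH (a [^]\<^bsub>H\<^esub> k) t"
        using 2 sc pc A.le_iff_one_le[of "b [^]\<^bsub>G\<^esub> k" s]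
          B.le_iff_one_le[of "a [^]\<^bsub>H\<^esub> k" t] by simp_all
      then show ?thesis
        using pow[OF st k] one[OF st] 2 sc by (cases "k = 0") auto
    qed
  qed
  then have "matched N (insert (b, a) X)" unfolding matched_def by blast
  then show ?thesis using b by blast
qed

end

section \<open>The total preorder of a valued l-group at a prime filter\<close>

definition le_at :: "('g, 'l) vlgrp \<Rightarrow> 'l set \<Rightarrow> 'g \<Rightarrow> 'g \<Rightarrow> bool" where
  "le_at V p a b \<longleftrightarrow> val V (gdiff V b a) \<in> p"

definition eq_at :: "('g, 'l) vlgrp \<Rightarrow> 'l set \<Rightarrow> 'g \<Rightarrow> 'g \<Rightarrow> bool" where
  "eq_at V p a b \<longleftrightarrow> le_at V p a b \<and> le_at V p b a"

lemma ggroup_simps [simp]: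
  "carrier (ggroup V) = gcar V" "mult (ggroup V) = gadd V" "one (ggroup V) = gzero V"
  by (simp_all add: ggroup_def)

context valued_lgroup
begin

sublocale G: comm_group "ggroup V"
  by (rule group)

sublocale GL: lattice_on "gcar V" "gmeet V" "gjoin V"
  by (rule glattice)

sublocale L: bounded_distrib_lattice_on "lcar V" "lmeet V" "ljoin V" "lbot V" "ltop V"
  by (rule llattice)

lemma inv_ggroup [simp]: "a \<in> gcar V \<Longrightarrow> inv\<^bsub>ggroup V\<^esub> a = gneg V a"
  by (simp add: neg)

lemma gzero_closed [simp]: "gzero V \<in> gcar V"
  and gadd_closed [simp]: "\<lbrakk>a \<in> gcar V; b \<in> gcar V\<rbrakk> \<Longrightarrow> gadd V a b \<in> gcar V"
  and gneg_closed [simp]: "a \<in> gcar V \<Longrightarrow> gneg V a \<in> gcar V"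
  using G.one_closed G.m_closed[of a b] G.inv_closed[of a] by simp_all

lemma gdiff_closed [simp]: "\<lbrakk>a \<in> gcar V; b \<in> gcar V\<rbrakk> \<Longrightarrow> gdiff V a b \<in> gcar V"
  by (simp add: gdiff_def)

lemma gmeet_closed [simp]: "\<lbrakk>a \<in> gcar V; b \<in> gcar V\<rbrakk> \<Longrightarrow> gmeet V a b \<in> gcar V"
  and gjoin_closed [simp]: "\<lbrakk>a \<in> gcar V; b \<in> gcar V\<rbrakk> \<Longrightarrow> gjoin V a b \<in> gcar V"
  by (simp_all add: GL.meet_closed GL.join_closed)

lemma lattice_ops_closed [simp]:
  "\<lbrakk>x \<in> lcar V; y \<in> lcar V\<rbrakk> \<Longrightarrow> lmeet V x y \<in> lcar V"
  "\<lbrakk>x \<in> lcar V; y \<in> lcar V\<rbrakk> \<Longrightarrow> ljoin V x y \<in> lcar V"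
  "lbot V \<in> lcar V" "ltop V \<in> lcar V"
  by (simp_all add: L.meet_closed L.join_closed L.bot_closed L.top_closed)

declare val_closed [simp]

lemma gadd_simps [simp]:
  "a \<in> gcar V \<Longrightarrow> gadd V (gzero V) a = a"
  "a \<in> gcar V \<Longrightarrow> gadd V a (gzero V) = a"
  "a \<in> gcar V \<Longrightarrow> gadd V (gneg V a) a = gzero V"
  "a \<in> gcar V \<Longrightarrow> gadd V a (gneg V a) = gzero V"
  "a \<in> gcar V \<Longrightarrow> gneg V (gneg V a) = a"
  "gneg V (gzero V) = gzero V"
  using G.l_one[of a] G.r_one[of a] G.l_inv[of a] G.r_inv[of a] G.inv_inv[of a] G.inv_one
  by simp_all

lemma gadd_assoc:
  "\<lbrakk>a \<in> gcar V; b \<in> gcar V; c \<in> gcar V\<rbrakk> \<Longrightarrow> gadd V (gadd V a b) c = gadd V a (gadd V b c)"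
  using G.m_assoc[of a b c] by simp

lemma gadd_commute: "\<lbrakk>a \<in> gcar V; b \<in> gcar V\<rbrakk> \<Longrightarrow> gadd V a b = gadd V b a"
  using G.m_comm[of a b] by simp

lemma gadd_left_commute:
  "\<lbrakk>a \<in> gcar V; b \<in> gcar V; c \<in> gcar V\<rbrakk> \<Longrightarrow> gadd V a (gadd V b c) = gadd V b (gadd V a c)"
  using G.m_lcomm[of a b c] by simp

lemmas gadd_ac = gadd_assoc gadd_commute gadd_left_commute

lemma gneg_gadd:
  "\<lbrakk>a \<in> gcar V; b \<in> gcar V\<rbrakk> \<Longrightarrow> gneg V (gadd V a b) = gadd V (gneg V a) (gneg V b)"
  using G.inv_mult[of a b] by simp

lemma gadd_cancel [simp]:
  "\<lbrakk>a \<in> gcar V; b \<in> gcar V\<rbrakk> \<Longrightarrow> gadd V a (gadd V (gneg V a) b) = b"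
  "\<lbrakk>a \<in> gcar V; b \<in> gcar V\<rbrakk> \<Longrightarrow> gadd V (gneg V a) (gadd V a b) = b"
  by (simp_all flip: gadd_assoc)

lemma gdiff_translate:
  assumes "a \<in> gcar V" "b \<in> gcar V" "c \<in> gcar V"
  shows "gdiff V (gadd V a c) (gadd V b c) = gdiff V a b"
  using assms by (simp add: gdiff_def gneg_gadd gadd_assoc gadd_commute[of "gneg V b" "gneg V c"])

lemma gdiff_trans:
  assumes "a \<in> gcar V" "b \<in> gcar V" "c \<in> gcar V"
  shows "gadd V (gdiff V b a) (gdiff V c b) = gdiff V c a"
proof -
  have "gadd V (gdiff V b a) (gdiff V c b) = gadd V (gdiff V c b) (gdiff V b a)"
    using assms by (intro gadd_commute) auto
  then show ?thesis using assms by (simp add: gdiff_def gadd_assoc)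
qed

lemma gle_iff_leq: "gle V a b \<longleftrightarrow> GL.leq a b"
  by (simp add: gle_def GL.leq_def)

lemma gle_translate_iff:
  assumes "a \<in> gcar V" "b \<in> gcar V" "c \<in> gcar V"
  shows "gle V (gadd V a c) (gadd V b c) \<longleftrightarrow> gle V a b"
proof
  assume "gle V (gadd V a c) (gadd V b c)"
  then have "gle V (gadd V (gadd V a c) (gneg V c)) (gadd V (gadd V b c) (gneg V c))"
    by (rule translation[rotated 3]) (use assms in auto)
  then show "gle V a b" using assms by (simp add: gadd_assoc)
qed (use assms translation in blast)

text \<open>Translation by \<open>c\<close> is an order automorphism; \<open>?d\<close> is the
  right-hand side moved back by its inverse.\<close>

lemma gadd_gmeet_distrib:
  assumes abc: "a \<in> gcar V" "b \<in> gcar V" "c \<in> gcar V"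
  shows "gadd V (gmeet V a b) c = gmeet V (gadd V a c) (gadd V b c)" (is "?l = ?r")
proof (rule GL.leq_antisym)
  show "GL.leq ?l ?r"
    using abc GL.meet_leq1[of a b] GL.meet_leq2[of a b] gle_translate_iff[of "gmeet V a b" _ c]
    by (intro GL.meet_greatest) (simp_all flip: gle_iff_leq)
  let ?d = "gadd V ?r (gneg V c)"
  have r: "?r = gadd V ?d c" using abc by (simp add: gadd_assoc)
  have "GL.leq ?r (gadd V a c)" "GL.leq ?r (gadd V b c)"
    using abc GL.meet_leq1 GL.meet_leq2 by auto
  then have "GL.leq ?d a" "GL.leq ?d b"
    using r abc gle_translate_iff[of ?d a c] gle_translate_iff[of ?d b c]
    by (simp_all flip: gle_iff_leq)
  then have "gle V ?d (gmeet V a b)"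
    using abc by (simp add: gle_iff_leq GL.meet_greatest)
  then show "GL.leq ?r ?l"
    using r abc gle_translate_iff[of ?d "gmeet V a b" c] by (simp flip: gle_iff_leq)
qed (use abc in auto)

lemma gadd_gjoin_distrib:
  assumes abc: "a \<in> gcar V" "b \<in> gcar V" "c \<in> gcar V"
  shows "gadd V (gjoin V a b) c = gjoin V (gadd V a c) (gadd V b c)" (is "?l = ?r")
proof (rule GL.leq_antisym)
  show "GL.leq ?r ?l"
    using abc GL.join_leq1[of a b] GL.join_leq2[of a b] gle_translate_iff[of _ "gjoin V a b" c]
    by (intro GL.join_least) (simp_all flip: gle_iff_leq)
  let ?d = "gadd V ?r (gneg V c)"
  have r: "?r = gadd V ?d c" using abc by (simp add: gadd_assoc)
  have "GL.leq (gadd V a c) ?r" "GL.leq (gadd V b c) ?r"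
    using abc GL.join_leq1 GL.join_leq2 by auto
  then have "GL.leq a ?d" "GL.leq b ?d"
    using r abc gle_translate_iff[of a ?d c] gle_translate_iff[of b ?d c]
    by (simp_all flip: gle_iff_leq)
  then have "gle V (gjoin V a b) ?d"
    using abc by (simp add: gle_iff_leq GL.join_least)
  then show "GL.leq ?l ?r"
    using r abc gle_translate_iff[of "gjoin V a b" ?d c] by (simp flip: gle_iff_leq)
qed (use abc in auto)

lemma val_top_if_nonneg:
  assumes "a \<in> gcar V" "gle V (gzero V) a"
  shows "val V a = ltop V"
proof -
  have "ltop V = lmeet V (ltop V) (val V a)"
    using val_meet[of "gzero V" a] assms val_zero by (simp add: gle_def)
  then show ?thesis using L.meet_top assms by simp
qed

text \<open>With \<open>y = x \<squnion> -x\<close> and \<open>m = y \<sqinter> 0\<close>, \<open>2 m = 2 y \<sqinter> y \<sqinter> 0 = m\<close> because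
  \<open>2 y \<ge> x + (-x) = 0\<close>.\<close>

lemma gjoin_gneg_nonneg:
  assumes x: "x \<in> gcar V"
  shows "gle V (gzero V) (gjoin V x (gneg V x))"
proof -
  let ?y = "gjoin V x (gneg V x)" and ?z = "gzero V"
  let ?m = "gmeet V ?y ?z"
  have y: "?y \<in> gcar V" "?m \<in> gcar V" using x by auto
  have xy: "gle V x ?y" "gle V (gneg V x) ?y"
    using x GL.join_leq1 GL.join_leq2 by (auto simp: gle_iff_leq)
  then have "gle V (gadd V x (gneg V x)) (gadd V ?y (gneg V x))" "gle V (gadd V (gneg V x) ?y) (gadd V ?y ?y)"
    using x y by (auto intro!: translation simp del: gadd_simps)
  then have yy: "gle V ?z (gadd V ?y ?y)"
    using x y GL.leq_trans[of ?z "gadd V ?y (gneg V x)" "gadd V ?y ?y"]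
    by (simp add: gle_iff_leq gadd_commute)
  have "gadd V ?m ?m = gmeet V (gadd V ?y ?m) ?m"
    using y gadd_gmeet_distrib[of ?y ?z ?m] by simp
  also have "gadd V ?y ?m = gmeet V (gadd V ?y ?y) ?y"
    using y gadd_gmeet_distrib[of ?y ?z ?y] by (simp add: gadd_commute)
  also have "gmeet V (gmeet V (gadd V ?y ?y) ?y) ?m = gmeet V (gadd V ?y ?y) ?m"
    using y GL.meet_assoc[of ?y ?y ?z] by (simp add: GL.meet_assoc GL.meet_idem)
  also have "\<dots> = ?m"
  proof -
    have "GL.leq ?m ?z" using y x GL.meet_leq2 by auto
    then have "GL.leq ?m (gadd V ?y ?y)" using yy y GL.leq_trans[of ?m ?z] by (simp add: gle_iff_leq)
    then show ?thesis using y by (simp add: GL.leq_def GL.meet_commute)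
  qed
  finally have "gadd V (gneg V ?m) (gadd V ?m ?m) = gadd V (gneg V ?m) ?m" by simp
  then have "?m = ?z" using y by simp
  then show ?thesis using y x by (simp add: gle_def GL.meet_commute)
qed

text \<open>Every prime filter thus contains the value of \<open>x\<close> or of its negative, which
  is the source of totality.\<close>

lemma val_join_gneg: "x \<in> gcar V \<Longrightarrow> ljoin V (val V x) (val V (gneg V x)) = ltop V"
  using val_top_if_nonneg[OF _ gjoin_gneg_nonneg] by (simp add: val_join)

lemma le_at_meet_iff:
  assumes p: "L.prime_filter p" and abc: "a \<in> gcar V" "b \<in> gcar V" "c \<in> gcar V"
  shows "le_at V p c (gmeet V a b) \<longleftrightarrow> le_at V p c a \<and> le_at V p c b"
proof -
  have "gdiff V (gmeet V a b) c = gmeet V (gdiff V a c) (gdiff V b c)"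
    using abc by (simp add: gdiff_def gadd_gmeet_distrib)
  then show ?thesis
    using abc L.prime_filterD[OF p] by (simp add: le_at_def val_meet)
qed

text \<open>Primality of \<open>p\<close> turns a join into a maximum at \<open>p\<close>.\<close>

lemma le_at_join_iff:
  assumes p: "L.prime_filter p" and abc: "a \<in> gcar V" "b \<in> gcar V" "c \<in> gcar V"
  shows "le_at V p c (gjoin V a b) \<longleftrightarrow> le_at V p c a \<or> le_at V p c b"
proof -
  have "gdiff V (gjoin V a b) c = gjoin V (gdiff V a c) (gdiff V b c)"
    using abc by (simp add: gdiff_def gadd_gjoin_distrib)
  then show ?thesis
    using abc L.prime_filterD[OF p] by (simp add: le_at_def val_join)
qed

text \<open>Transitivity is the axiom \<open>val_add\<close>, totality is
  \<open>val_join_gneg\<close> together with primality of \<open>p\<close>.\<close>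

lemma le_at_preordered_group:
  assumes p: "L.prime_filter p"
  shows "preordered_group (ggroup V) (le_at V p)"
proof (intro preordered_group.intro preordered_group_axioms.intro, goal_cases)
  case 1 show ?case by (rule group)
next
  case (2 x)
  then show ?case using L.prime_filterD[OF p] by (simp add: le_at_def gdiff_def val_zero)
next
  case (3 x y z)
  let ?a = "gdiff V y x" and ?b = "gdiff V z y"
  have "L.leq (lmeet V (val V ?a) (val V ?b)) (val V (gdiff V z x))"
    using val_add[of ?a ?b] 3 gdiff_trans[of x y z] by (simp add: lle_def L.leq_def)
  then show ?case
    using 3 L.prime_filterD[OF p] L.prime_filter_mono[OF p] by (simp add: le_at_def)
next
  case (4 x y)
  then have "gneg V (gdiff V y x) = gdiff V x y"
    by (simp add: gdiff_def gneg_gadd gadd_commute)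
  then show ?case
    using 4 val_join_gneg[of "gdiff V y x"] L.prime_filterD[OF p] L.prime_filterD(5)[OF p, symmetric]
    by (simp add: le_at_def)
next
  case (5 x y z)
  then show ?case by (simp add: le_at_def gdiff_translate)
qed

section \<open>The operations at a fixed prime filter\<close>

context
  fixes p
  assumes p: "L.prime_filter p"
begin

interpretation P: preordered_group "ggroup V" "le_at V p"
  by (rule le_at_preordered_group[OF p])

lemma le_at_refl: "a \<in> gcar V \<Longrightarrow> le_at V p a a"
  using P.le_refl by simp

lemma le_at_trans:
  "\<lbrakk>le_at V p a b; le_at V p b c; a \<in> gcar V; b \<in> gcar V; c \<in> gcar V\<rbrakk> \<Longrightarrow> le_at V p a c"
  using P.le_trans by simp

lemma le_at_total: "\<lbrakk>a \<in> gcar V; b \<in> gcar V\<rbrakk> \<Longrightarrow> le_at V p a b \<or> le_at V p b a"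
  using P.le_total by simp

lemma eq_at_refl: "a \<in> gcar V \<Longrightarrow> eq_at V p a a"
  by (simp add: eq_at_def le_at_refl)

lemma eq_at_sym: "eq_at V p a b \<Longrightarrow> eq_at V p b a"
  by (simp add: eq_at_def)

lemma eq_at_trans:
  "\<lbrakk>eq_at V p a b; eq_at V p b c; a \<in> gcar V; b \<in> gcar V; c \<in> gcar V\<rbrakk> \<Longrightarrow> eq_at V p a c"
  unfolding eq_at_def using le_at_trans by blast

lemma eq_at_le_cong:
  assumes "eq_at V p a a'" "eq_at V p b b'" "a \<in> gcar V" "a' \<in> gcar V" "b \<in> gcar V" "b' \<in> gcar V"
  shows "le_at V p a b \<longleftrightarrow> le_at V p a' b'"
  using assms le_at_trans[of a b b'] le_at_trans[of a' a b'] le_at_trans[of a' b' b]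
    le_at_trans[of a a' b] unfolding eq_at_def by blast

lemma eq_at_gadd:
  assumes "eq_at V p a a'" "eq_at V p b b'" "a \<in> gcar V" "a' \<in> gcar V" "b \<in> gcar V" "b' \<in> gcar V"
  shows "eq_at V p (gadd V a b) (gadd V a' b')"
  using assms P.le_mult_mono[of a a' b b'] P.le_mult_mono[of a' a b' b] by (simp add: eq_at_def)

lemma eq_at_gneg:
  assumes "eq_at V p a a'" "a \<in> gcar V" "a' \<in> gcar V"
  shows "eq_at V p (gneg V a) (gneg V a')"
  using assms P.le_inv_iff[of a a'] P.le_inv_iff[of a' a] by (simp add: eq_at_def)

lemma gmeet_le_at:
  assumes "a \<in> gcar V" "b \<in> gcar V"
  shows "le_at V p (gmeet V a b) a" "le_at V p (gmeet V a b) b"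
  using le_at_meet_iff[OF p, of a b "gmeet V a b"] le_at_refl assms by auto

lemma le_at_gjoin:
  assumes "a \<in> gcar V" "b \<in> gcar V"
  shows "le_at V p a (gjoin V a b)" "le_at V p b (gjoin V a b)"
  using le_at_join_iff[OF p, of a b a] le_at_join_iff[OF p, of a b b] le_at_refl assms by auto

text \<open>At \<open>p\<close> the meet is the minimum, in either order of the arguments.\<close>

lemma eq_at_gmeet:
  assumes "le_at V p a b" "a \<in> gcar V" "b \<in> gcar V"
  shows "eq_at V p (gmeet V a b) a" "eq_at V p (gmeet V b a) a"
  using assms le_at_meet_iff[OF p, of a b a] le_at_meet_iff[OF p, of b a a] le_at_refl[of a] gmeet_le_at
  by (auto simp: eq_at_def)

lemma eq_at_gjoin:
  assumes "le_at V p a b" "a \<in> gcar V" "b \<in> gcar V"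
  shows "eq_at V p (gjoin V a b) b" "eq_at V p (gjoin V b a) b"
proof -
  have "le_at V p (gjoin V a b) b" "le_at V p (gjoin V b a) b"
    using assms le_at_join_iff[OF p, of a b "gjoin V a b"] le_at_join_iff[OF p, of b a "gjoin V b a"]
      le_at_refl[of "gjoin V a b"] le_at_refl[of "gjoin V b a"]
      le_at_trans[of "gjoin V a b" a b] le_at_trans[of "gjoin V b a" a b] by auto
  then show "eq_at V p (gjoin V a b) b" "eq_at V p (gjoin V b a) b"
    using assms le_at_gjoin by (auto simp: eq_at_def)
qed

lemma eq_at_gmeet_cong:
  assumes "eq_at V p a a'" "eq_at V p b b'" "a \<in> gcar V" "a' \<in> gcar V" "b \<in> gcar V" "b' \<in> gcar V"
  shows "eq_at V p (gmeet V a b) (gmeet V a' b')"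
proof -
  have "le_at V p (gmeet V a b) (gmeet V a' b')"
    if "le_at V p a a'" "le_at V p b b'" "a \<in> gcar V" "a' \<in> gcar V" "b \<in> gcar V" "b' \<in> gcar V" for a a' b b'
    using that gmeet_le_at[of a b] le_at_trans[of "gmeet V a b" a a'] le_at_trans[of "gmeet V a b" b b']
    by (simp add: le_at_meet_iff[OF p])
  then show ?thesis using assms by (simp add: eq_at_def)
qed

lemma eq_at_gjoin_cong:
  assumes "eq_at V p a a'" "eq_at V p b b'" "a \<in> gcar V" "a' \<in> gcar V" "b \<in> gcar V" "b' \<in> gcar V"
  shows "eq_at V p (gjoin V a b) (gjoin V a' b')"
proof -
  have "le_at V p (gjoin V a b) (gjoin V a' b')"
    if "le_at V p a a'" "le_at V p b b'" "a \<in> gcar V" "a' \<in> gcar V" "b \<in> gcar V" "b' \<in> gcar V" for a a' b b'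
    using that le_at_join_iff[OF p, of a b "gjoin V a b"] le_at_refl[of "gjoin V a b"]
      le_at_trans[of "gjoin V a b" a a'] le_at_trans[of "gjoin V a b" b b']
    by (auto simp: le_at_join_iff[OF p])
  then show ?thesis using assms by (simp add: eq_at_def)
qed

lemma val_mem_iff: "a \<in> gcar V \<Longrightarrow> val V a \<in> p \<longleftrightarrow> le_at V p (gzero V) a"
  by (simp add: le_at_def gdiff_def)

lemma val_cong:
  "\<lbrakk>eq_at V p a b; a \<in> gcar V; b \<in> gcar V\<rbrakk> \<Longrightarrow> val V a \<in> p \<longleftrightarrow> val V b \<in> p"
  using eq_at_le_cong[of "gzero V" "gzero V" a b] by (simp add: val_mem_iff eq_at_refl)

end

section \<open>The prime spectrum and its basic open sets\<close>

definition spec :: "'l set set" where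
  "spec = {p. L.prime_filter p}"

definition basic :: "'l \<Rightarrow> 'l set set" where
  "basic u = {p \<in> spec. u \<in> p}"

lemma specD: "p \<in> spec \<Longrightarrow> L.prime_filter p"
  by (simp add: spec_def)

lemma val_eq_top_iff:
  "a \<in> gcar V \<Longrightarrow> val V a = ltop V \<longleftrightarrow> (\<forall>p\<in>spec. val V a \<in> p)"
  using L.eq_iff_prime_filters[of "val V a" "ltop V"] L.prime_filterD(2) by (auto simp: spec_def)

lemma gle_imp_le_at:
  assumes "gle V a b" "a \<in> gcar V" "b \<in> gcar V" "p \<in> spec"
  shows "le_at V p a b"
proof -
  have "gle V (gadd V a (gneg V a)) (gadd V b (gneg V a))"
    using assms by (auto intro!: translation simp del: gadd_simps)
  then have "val V (gdiff V b a) = ltop V" using assms val_top_if_nonneg by (simp add: gdiff_def)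
  then show ?thesis using assms specD L.prime_filterD(2) by (simp add: le_at_def)
qed

lemma eq_at_iff_meet:
  assumes "p \<in> spec" "a \<in> gcar V" "b \<in> gcar V"
  shows "eq_at V p a b \<longleftrightarrow> lmeet V (val V (gdiff V a b)) (val V (gdiff V b a)) \<in> p"
  using assms L.prime_filterD(4)[OF specD] by (auto simp: eq_at_def le_at_def)

end

context densely_valued_lgroup
begin

text \<open>A value that lies in all prime filters is the top element, and density turns the value
  \<open>ltop V\<close> of the difference into an inequality.\<close>

lemma gle_iff_le_at:
  assumes "a \<in> gcar V" "b \<in> gcar V"
  shows "gle V a b \<longleftrightarrow> (\<forall>p\<in>spec. le_at V p a b)"
proof
  assume "\<forall>p\<in>spec. le_at V p a b"
  then have "val V (gdiff V b a) = ltop V"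
    using assms by (simp add: val_eq_top_iff le_at_def)
  then have "gle V (gadd V (gzero V) a) (gadd V (gdiff V b a) a)"
    using assms dense by (auto intro!: translation simp del: gadd_simps)
  then show "gle V a b" using assms by (simp add: gdiff_def gadd_assoc)
qed (use assms gle_imp_le_at in blast)

lemma eq_iff_eq_at:
  assumes "a \<in> gcar V" "b \<in> gcar V"
  shows "a = b \<longleftrightarrow> (\<forall>p\<in>spec. eq_at V p a b)"
proof
  assume "\<forall>p\<in>spec. eq_at V p a b"
  then have "gle V a b" "gle V b a" using assms by (auto simp: gle_iff_le_at eq_at_def)
  then show "a = b" using assms GL.leq_antisym by (simp add: gle_iff_leq)
qed (use assms eq_at_refl specD in blast)

end

section \<open>Satisfaction over a set of prime filters\<close>

lemma range_upd: "\<lbrakk>range v \<subseteq> A; a \<in> A\<rbrakk> \<Longrightarrow> range (v(n := a)) \<subseteq> A"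
  by auto

lemma (in valued_lgroup) geval_closed: "range v \<subseteq> gcar V \<Longrightarrow> geval V v s \<in> gcar V"
  by (induction s) auto

lemma (in valued_lgroup) leval_closed:
  "\<lbrakk>range v \<subseteq> gcar V; range w \<subseteq> lcar V\<rbrakk> \<Longrightarrow> leval V v w t \<in> lcar V"
  by (induction t) (auto simp: geval_closed)

text \<open>A witness, or the branch of a disjunction, is chosen once for all of \<open>S\<close>,
  so this is stronger than satisfaction at each \<open>p \<in> S\<close>. For \<open>S = {p}\<close>
  it is satisfaction in the preordered group at \<open>p\<close>; for the whole spectrum of a
  densely valued group it is ordinary satisfaction.\<close>

primrec sat_on ::
    "('g, 'l) vlgrp \<Rightarrow> 'l set set \<Rightarrow> (nat \<Rightarrow> 'g) \<Rightarrow> (nat \<Rightarrow> 'l) \<Rightarrow> pe_formula \<Rightarrow> bool" where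
  "sat_on V S v w (GEq s t) \<longleftrightarrow> (\<forall>p\<in>S. eq_at V p (geval V v s) (geval V v t))"
| "sat_on V S v w (LEq s t) \<longleftrightarrow> (\<forall>p\<in>S. leval V v w s \<in> p \<longleftrightarrow> leval V v w t \<in> p)"
| "sat_on V S v w (And \<phi> \<psi>) \<longleftrightarrow> sat_on V S v w \<phi> \<and> sat_on V S v w \<psi>"
| "sat_on V S v w (Or \<phi> \<psi>) \<longleftrightarrow> sat_on V S v w \<phi> \<or> sat_on V S v w \<psi>"
| "sat_on V S v w (ExG n \<phi>) \<longleftrightarrow> (\<exists>a\<in>gcar V. sat_on V S (v(n := a)) w \<phi>)"
| "sat_on V S v w (ExL n \<phi>) \<longleftrightarrow> (\<exists>x\<in>lcar V. sat_on V S v (w(n := x)) \<phi>)"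

lemma sat_on_mono: "\<lbrakk>sat_on V S v w \<phi>; T \<subseteq> S\<rbrakk> \<Longrightarrow> sat_on V T v w \<phi>"
  by (induction \<phi> arbitrary: v w) (simp_all add: subset_iff, blast+)

lemma (in densely_valued_lgroup) sat_on_spec:
  "\<lbrakk>range v \<subseteq> gcar V; range w \<subseteq> lcar V\<rbrakk> \<Longrightarrow> sat_on V spec v w \<phi> \<longleftrightarrow> sat V v w \<phi>"
proof (induction \<phi> arbitrary: v w)
  case (GEq s t)
  then show ?case by (simp add: geval_closed eq_iff_eq_at)
next
  case (LEq s t)
  then show ?case
    using L.eq_iff_prime_filters[OF leval_closed leval_closed, of v w v w s t]
    by (simp add: spec_def)
next
  case (ExG n \<phi>)
  have "sat_on V spec (v(n := a)) w \<phi> \<longleftrightarrow> sat V (v(n := a)) w \<phi>" if "a \<in> gcar V" for a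
    by (intro ExG range_upd that)
  then show ?case by simp
next
  case (ExL n \<phi>)
  have "sat_on V spec v (w(n := x)) \<phi> \<longleftrightarrow> sat V v (w(n := x)) \<phi>" if "x \<in> lcar V" for x
    by (intro ExL range_upd that)
  then show ?case by simp
qed auto

context valued_lgroup
begin

text \<open>Any elements serve as witnesses, for instance the constants. This puts the bottom
  element into the ideal of elements over which a formula is solvable.\<close>

lemma sat_on_empty: "sat_on V {} v w \<phi>"
  by (induction \<phi> arbitrary: v w) (auto intro: gzero_closed lattice_ops_closed)

lemma basic_subset: "basic u \<subseteq> spec"
  by (auto simp: basic_def)

lemma basic_bot: "basic (lbot V) = {}"
  using L.prime_filterD(3) by (auto simp: basic_def spec_def)

lemma basic_top: "basic (ltop V) = spec"
  using L.prime_filterD(2) by (auto simp: basic_def spec_def)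

lemma basic_meet: "\<lbrakk>x \<in> lcar V; y \<in> lcar V\<rbrakk> \<Longrightarrow> basic (lmeet V x y) = basic x \<inter> basic y"
  using L.prime_filterD(4) by (auto simp: basic_def spec_def)

lemma basic_join: "\<lbrakk>x \<in> lcar V; y \<in> lcar V\<rbrakk> \<Longrightarrow> basic (ljoin V x y) = basic x \<union> basic y"
  using L.prime_filterD(5) by (auto simp: basic_def spec_def)

lemma leq_iff_basic: "\<lbrakk>x \<in> lcar V; y \<in> lcar V\<rbrakk> \<Longrightarrow> L.leq x y \<longleftrightarrow> basic x \<subseteq> basic y"
  using L.leq_iff_prime_filters[of x y] by (auto simp: basic_def spec_def)

lemma complement_exists:
  assumes "boolean V" "x \<in> lcar V"
  obtains y where "y \<in> lcar V" "basic y = spec - basic x"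
proof -
  obtain y where y: "y \<in> lcar V" "lmeet V x y = lbot V" "ljoin V x y = ltop V"
    using assms unfolding boolean_def by blast
  then have "basic x \<inter> basic y = {}" "basic x \<union> basic y = spec"
    using assms basic_meet[of x y] basic_join[of x y] basic_bot basic_top by auto
  then show ?thesis using that[of y] y by auto
qed

text \<open>The witnesses are kept; only the atomic formulas have to spread from \<open>p\<close> to
  a basic neighbourhood, and they are finitely many.\<close>

lemma sat_on_singleton_compact:
  assumes bool: "boolean V" and p: "p \<in> spec"
  shows "\<lbrakk>range v \<subseteq> gcar V; range w \<subseteq> lcar V; sat_on V {p} v w \<phi>\<rbrakk>
    \<Longrightarrow> \<exists>u\<in>lcar V. u \<in> p \<and> sat_on V (basic u) v w \<phi>"
proof (induction \<phi> arbitrary: v w)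
  case (GEq s t)
  let ?a = "geval V v s" and ?b = "geval V v t"
  let ?u = "lmeet V (val V (gdiff V ?a ?b)) (val V (gdiff V ?b ?a))"
  have c: "?a \<in> gcar V" "?b \<in> gcar V" using GEq geval_closed by auto
  then have "?u \<in> p" "\<forall>r\<in>basic ?u. eq_at V r ?a ?b"
    using GEq p by (auto simp: eq_at_iff_meet basic_def)
  then show ?case using c by auto
next
  case (LEq s t)
  let ?x = "leval V v w s" and ?y = "leval V v w t"
  have c: "?x \<in> lcar V" "?y \<in> lcar V" using LEq leval_closed by auto
  have iff: "?x \<in> p \<longleftrightarrow> ?y \<in> p" using LEq by simp
  have P: "L.prime_filter p" using p specD by blast
  show ?case
  proof (cases "?x \<in> p")
    case True
    then have "lmeet V ?x ?y \<in> p" using iff c L.prime_filterD(4)[OF P] by simp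
    moreover have "\<forall>r\<in>basic (lmeet V ?x ?y). ?x \<in> r \<longleftrightarrow> ?y \<in> r"
      using c by (simp add: basic_meet) (simp add: basic_def)
    ultimately show ?thesis using c by (intro bexI[of _ "lmeet V ?x ?y"]) auto
  next
    case False
    \<comment> \<open>That both sides are false at \<open>p\<close> is a closed condition; the
      complement makes it hold on a basic open set.\<close>
    obtain z where z: "z \<in> lcar V" "basic z = spec - basic (ljoin V ?x ?y)"
      using complement_exists[OF bool, of "ljoin V ?x ?y"] c by auto
    then have z': "basic z = spec - basic ?x - basic ?y" using c by (auto simp: basic_join)
    have "p \<in> basic z" using False iff p unfolding z' by (simp add: basic_def)
    moreover have "\<forall>r\<in>basic z. ?x \<in> r \<longleftrightarrow> ?y \<in> r"
      unfolding z' by (simp add: basic_def)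
    ultimately show ?thesis using z by (intro bexI[of _ z]) (auto simp: basic_def)
  qed
next
  case (And \<phi> \<psi>)
  then obtain u u' where u: "u \<in> lcar V" "u \<in> p" "sat_on V (basic u) v w \<phi>"
    "u' \<in> lcar V" "u' \<in> p" "sat_on V (basic u') v w \<psi>"
    by (metis sat_on.simps(3))
  then have "sat_on V (basic (lmeet V u u')) v w (And \<phi> \<psi>)"
    by (auto simp: basic_meet intro: sat_on_mono)
  moreover have "lmeet V u u' \<in> p" using u L.prime_filterD(4)[OF specD[OF p]] by simp
  ultimately show ?case using u by (intro bexI[of _ "lmeet V u u'"]) auto
next
  case (Or \<phi> \<psi>)
  then show ?case by (metis sat_on.simps(4))
next
  case (ExG n \<phi>)
  then obtain a where "a \<in> gcar V" "sat_on V {p} (v(n := a)) w \<phi>" by auto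
  then show ?case using ExG.IH[OF range_upd[OF ExG.prems(1)] ExG.prems(2)]
    unfolding sat_on.simps by blast
next
  case (ExL n \<phi>)
  then obtain x where "x \<in> lcar V" "sat_on V {p} v (w(n := x)) \<phi>" by auto
  then show ?case using ExL.IH[OF ExL.prems(1) range_upd[OF ExL.prems(2)]]
    unfolding sat_on.simps by blast
qed

subsection \<open>Gluing\<close>

definition agree_on :: "'l set set \<Rightarrow> (nat \<Rightarrow> 'g) \<Rightarrow> (nat \<Rightarrow> 'l) \<Rightarrow> (nat \<Rightarrow> 'g) \<Rightarrow> (nat \<Rightarrow> 'l) \<Rightarrow> bool" where
  "agree_on S v w v' w' \<longleftrightarrow> S \<subseteq> spec
     \<and> range v \<subseteq> gcar V \<and> range w \<subseteq> lcar V \<and> range v' \<subseteq> gcar V \<and> range w' \<subseteq> lcar V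
     \<and> (\<forall>p\<in>S. \<forall>n. eq_at V p (v n) (v' n) \<and> (w n \<in> p \<longleftrightarrow> w' n \<in> p))"

lemma agree_onD:
  assumes "agree_on S v w v' w'"
  shows "range v \<subseteq> gcar V" "range w \<subseteq> lcar V" "range v' \<subseteq> gcar V" "range w' \<subseteq> lcar V"
    and "p \<in> S \<Longrightarrow> L.prime_filter p" "p \<in> S \<Longrightarrow> eq_at V p (v n) (v' n)"
    and "p \<in> S \<Longrightarrow> w n \<in> p \<longleftrightarrow> w' n \<in> p"
  using assms unfolding agree_on_def spec_def by (simp_all add: subset_iff)

lemma agree_on_geval:
  assumes ag: "agree_on S v w v' w'" and pS: "p \<in> S"
  shows "eq_at V p (geval V v s) (geval V v' s)"
proof -
  note r = agree_onD(1,3)[OF ag] and P = agree_onD(5)[OF ag pS] and eq = agree_onD(6)[OF ag pS]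
  show ?thesis
    by (induction s)
      (auto simp: eq eq_at_refl[OF P] geval_closed[OF r(1)] geval_closed[OF r(2)] intro: eq_at_gadd[OF P]
        eq_at_gneg[OF P] eq_at_gmeet_cong[OF P] eq_at_gjoin_cong[OF P])
qed

lemma agree_on_leval:
  assumes ag: "agree_on S v w v' w'" and pS: "p \<in> S"
  shows "leval V v w t \<in> p \<longleftrightarrow> leval V v' w' t \<in> p"
proof -
  note r = agree_onD(1,3,2,4)[OF ag] and P = agree_onD(5)[OF ag pS] and eq = agree_onD(7)[OF ag pS]
  show ?thesis
  proof (induction t)
    case (LVal s)
    then show ?case
      using val_cong[OF P agree_on_geval[OF ag pS, of s]] geval_closed r by simp
  qed (simp_all add: eq L.prime_filterD[OF P] leval_closed[OF r(1,3)] leval_closed[OF r(2,4)])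
qed

lemma agree_on_updG:
  "\<lbrakk>agree_on S v w v' w'; a \<in> gcar V; a' \<in> gcar V; \<forall>p\<in>S. eq_at V p a a'\<rbrakk>
    \<Longrightarrow> agree_on S (v(n := a)) w (v'(n := a')) w'"
  unfolding agree_on_def by (intro conjI range_upd) simp_all

lemma agree_on_updL:
  "\<lbrakk>agree_on S v w v' w'; x \<in> lcar V; x' \<in> lcar V; \<forall>p\<in>S. x \<in> p \<longleftrightarrow> x' \<in> p\<rbrakk>
    \<Longrightarrow> agree_on S v (w(n := x)) v' (w'(n := x'))"
  unfolding agree_on_def by (intro conjI range_upd) simp_all

lemma agree_on_refl:
  "\<lbrakk>S \<subseteq> spec; range v \<subseteq> gcar V; range w \<subseteq> lcar V\<rbrakk> \<Longrightarrow> agree_on S v w v w"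
  unfolding agree_on_def using eq_at_refl[OF specD] by (simp add: subset_iff image_iff) blast

text \<open>Over disjoint elements the compatibility premise of patching is vacuous. Patching
  concerns values of group elements, and bottom need not be one; but over bottom nothing is
  required, so \<open>a\<close> or \<open>a'\<close> itself serves.\<close>

lemma patching_disjoint:
  assumes pat: "patching V" and u: "u \<in> lcar V" "u' \<in> lcar V" and disj: "basic u \<inter> basic u' = {}"
    and a: "a \<in> gcar V" "a' \<in> gcar V"
  shows "\<exists>c\<in>gcar V. (\<forall>p\<in>basic u. eq_at V p a c) \<and> (\<forall>p\<in>basic u'. eq_at V p a' c)"
proof -
  consider "u = lbot V" | "u' = lbot V" | "u \<noteq> lbot V" "u' \<noteq> lbot V" by blast
  then show ?thesis
  proof cases
    case 1
    then show ?thesis using a basic_bot eq_at_refl specD basic_subset by blast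
  next
    case 2
    then show ?thesis using a basic_bot eq_at_refl specD basic_subset by blast
  next
    case 3
    then obtain f g where fg: "f \<in> gcar V" "g \<in> gcar V" "u = val V f" "u' = val V g"
      using u val_surj by meson
    have eq: "L.leq x (lmeet V (val V (gdiff V b c)) (val V (gdiff V c b))) \<longleftrightarrow>
        (\<forall>p\<in>basic x. eq_at V p b c)" if "x \<in> lcar V" "b \<in> gcar V" "c \<in> gcar V" for x b c
      using that by (auto simp: leq_iff_basic eq_at_iff_meet basic_def)
    have "L.leq (lmeet V u u') (lmeet V (val V (gdiff V a a')) (val V (gdiff V a' a)))"
      using u a disj by (simp add: eq basic_meet)
    then obtain c where c: "c \<in> gcar V"
        "L.leq u (lmeet V (val V (gdiff V a c)) (val V (gdiff V c a)))"
        "L.leq u' (lmeet V (val V (gdiff V a' c)) (val V (gdiff V c a')))"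
      using pat a fg unfolding patching_def lle_def L.leq_def by blast
    then show ?thesis using u a eq by blast
  qed
qed

end

section \<open>Splitting formulas into disjunction-free ones\<close>

primrec or_free :: "pe_formula \<Rightarrow> bool" where
  "or_free (GEq s t) \<longleftrightarrow> True"
| "or_free (LEq s t) \<longleftrightarrow> True"
| "or_free (And \<phi> \<psi>) \<longleftrightarrow> or_free \<phi> \<and> or_free \<psi>"
| "or_free (Or \<phi> \<psi>) \<longleftrightarrow> False"
| "or_free (ExG n \<phi>) \<longleftrightarrow> or_free \<phi>"
| "or_free (ExL n \<phi>) \<longleftrightarrow> or_free \<phi>"

primrec disjuncts :: "pe_formula \<Rightarrow> pe_formula set" where
  "disjuncts (GEq s t) = {GEq s t}"
| "disjuncts (LEq s t) = {LEq s t}"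
| "disjuncts (And \<phi> \<psi>) = {And \<phi>' \<psi>' | \<phi>' \<psi>'. \<phi>' \<in> disjuncts \<phi> \<and> \<psi>' \<in> disjuncts \<psi>}"
| "disjuncts (Or \<phi> \<psi>) = disjuncts \<phi> \<union> disjuncts \<psi>"
| "disjuncts (ExG n \<phi>) = ExG n ` disjuncts \<phi>"
| "disjuncts (ExL n \<phi>) = ExL n ` disjuncts \<phi>"

lemma disjuncts_or_free: "\<psi> \<in> disjuncts \<phi> \<Longrightarrow> or_free \<psi>"
  by (induction \<phi> arbitrary: \<psi>) auto

text \<open>Disjunction can be moved outwards past conjunctions and existential quantifiers.\<close>

lemma sat_iff_disjuncts: "sat V v w \<phi> \<longleftrightarrow> (\<exists>\<psi>\<in>disjuncts \<phi>. sat V v w \<psi>)"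
proof (induction \<phi> arbitrary: v w)
  case (And \<phi> \<psi>)
  have "(\<exists>\<theta>\<in>disjuncts (And \<phi> \<psi>). sat V v w \<theta>) \<longleftrightarrow>
      (\<exists>\<phi>'\<in>disjuncts \<phi>. sat V v w \<phi>') \<and> (\<exists>\<psi>'\<in>disjuncts \<psi>. sat V v w \<psi>')"
    by (simp, metis sat.simps(3))
  then show ?case using And by simp
qed (simp_all add: bex_Un, blast+)

context valued_lgroup
begin

text \<open>Three assignments are needed for the induction: below a quantifier the two local
  witnesses differ, and the glued witness agrees with each only over its own piece.\<close>

lemma sat_on_glue:
  assumes bool: "boolean V" and pat: "patching V"
    and u: "u \<in> lcar V" "u' \<in> lcar V" and disj: "basic u \<inter> basic u' = {}"
  shows "\<lbrakk>or_free \<phi>; sat_on V (basic u) v w \<phi>; sat_on V (basic u') v' w' \<phi>;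
      agree_on (basic u) v w v'' w''; agree_on (basic u') v' w' v'' w''\<rbrakk>
    \<Longrightarrow> sat_on V (basic u \<union> basic u') v'' w'' \<phi>"
proof (induction \<phi> arbitrary: v w v' w' v'' w'')
  case (GEq s t)
  have "eq_at V p (geval V v'' s) (geval V v'' t)"
    if ag: "agree_on S v w v'' w''" and p: "p \<in> S" and eq: "eq_at V p (geval V v s) (geval V v t)"
    for S p v w
  proof -
    note r = agree_onD(1,3)[OF ag] and P = agree_onD(5)[OF ag p]
    have "eq_at V p (geval V v'' s) (geval V v s)"
      using agree_on_geval[OF ag p] eq_at_sym[OF P] by blast
    then have "eq_at V p (geval V v'' s) (geval V v t)"
      using eq eq_at_trans[OF P] geval_closed[OF r(1)] geval_closed[OF r(2)] by blast
    then show ?thesis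
      using agree_on_geval[OF ag p] eq_at_trans[OF P] geval_closed[OF r(1)] geval_closed[OF r(2)]
      by blast
  qed
  then show ?case using GEq by auto
next
  case (LEq s t)
  have "leval V v'' w'' s \<in> p \<longleftrightarrow> leval V v'' w'' t \<in> p"
    if ag: "agree_on S v w v'' w''" and sat: "sat_on V S v w (LEq s t)" and p: "p \<in> S"
    for S p v w
    using sat p agree_on_leval[OF ag p, of s] agree_on_leval[OF ag p, of t] by simp
  from this[OF LEq.prems(4,2)] this[OF LEq.prems(5,3)] show ?case
    unfolding sat_on.simps by blast
next
  case (And \<phi> \<psi>)
  then show ?case by auto
next
  case (Or \<phi> \<psi>)
  then show ?case by simp
next
  case (ExG n \<phi>)
  then obtain a a' where a: "a \<in> gcar V" "a' \<in> gcar V"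
    "sat_on V (basic u) (v(n := a)) w \<phi>" "sat_on V (basic u') (v'(n := a')) w' \<phi>" by auto
  obtain c where c: "c \<in> gcar V" "\<forall>p\<in>basic u. eq_at V p a c" "\<forall>p\<in>basic u'. eq_at V p a' c"
    using patching_disjoint[OF pat u disj] a by blast
  have "sat_on V (basic u \<union> basic u') (v''(n := c)) w'' \<phi>"
    using ExG.prems(1)
    by (intro ExG.IH[OF _ a(3,4)] agree_on_updG[OF ExG.prems(4)] agree_on_updG[OF ExG.prems(5)] a c)
      simp
  then show ?case using c by auto
next
  case (ExL n \<phi>)
  then obtain x x' where x: "x \<in> lcar V" "x' \<in> lcar V"
    "sat_on V (basic u) v (w(n := x)) \<phi>" "sat_on V (basic u') v' (w'(n := x')) \<phi>" by auto
  \<comment> \<open>\<open>?y\<close> is \<open>x\<close> over \<open>u\<close> and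
    \<open>x'\<close> over \<open>u'\<close>.\<close>
  let ?y = "ljoin V (lmeet V u x) (lmeet V u' x')"
  have y: "?y \<in> lcar V" using x u by simp
  have "basic ?y = basic u \<inter> basic x \<union> basic u' \<inter> basic x'"
    using x u by (simp add: basic_meet basic_join)
  then have "\<forall>p\<in>basic u. x \<in> p \<longleftrightarrow> ?y \<in> p" "\<forall>p\<in>basic u'. x' \<in> p \<longleftrightarrow> ?y \<in> p"
    using disj by (auto simp: basic_def)
  then have "sat_on V (basic u \<union> basic u') v'' (w''(n := ?y)) \<phi>"
    using ExL.prems(1)
    by (intro ExL.IH[OF _ x(3,4)] agree_on_updL[OF ExL.prems(4)] agree_on_updL[OF ExL.prems(5)] x y)
      simp
  then show ?case using y by auto
qed

lemma sat_on_basic_ideal: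
  assumes bool: "boolean V" and pat: "patching V" and \<phi>: "or_free \<phi>"
    and r: "range v \<subseteq> gcar V" "range w \<subseteq> lcar V"
  shows "L.ideal_on {u \<in> lcar V. sat_on V (basic u) v w \<phi>}"
  unfolding L.ideal_on_def
proof (intro conjI ballI impI)
  show "lbot V \<in> {u \<in> lcar V. sat_on V (basic u) v w \<phi>}"
    by (simp add: basic_bot sat_on_empty)
next
  fix x y assume x: "x \<in> {u \<in> lcar V. sat_on V (basic u) v w \<phi>}"
    and y: "y \<in> {u \<in> lcar V. sat_on V (basic u) v w \<phi>}"
  \<comment> \<open>Gluing requires disjoint pieces, so the part of \<open>y\<close> inside
    \<open>x\<close> is cut off with a complement.\<close>
  obtain z where z: "z \<in> lcar V" "basic z = spec - basic x"
    using complement_exists[OF bool] x by blast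
  let ?y = "lmeet V y z"
  have y': "?y \<in> lcar V" "basic ?y = basic y - basic x"
    using y z basic_subset by (auto simp: basic_meet)
  have "sat_on V (basic x \<union> basic ?y) v w \<phi>"
  proof (rule sat_on_glue[OF bool pat _ _ _ \<phi>])
    show "sat_on V (basic ?y) v w \<phi>" using y y' sat_on_mono[of V "basic y"] by simp
    show "agree_on (basic x) v w v w" "agree_on (basic ?y) v w v w"
      by (intro agree_on_refl basic_subset r)+
  qed (use x y' in auto)
  moreover have "basic x \<union> basic ?y = basic (ljoin V x y)"
    using x y y' basic_join by auto
  ultimately show "ljoin V x y \<in> {u \<in> lcar V. sat_on V (basic u) v w \<phi>}"
    using x y by simp
next
  fix x y assume "x \<in> {u \<in> lcar V. sat_on V (basic u) v w \<phi>}" "y \<in> lcar V" "L.leq y x"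
  then show "y \<in> {u \<in> lcar V. sat_on V (basic u) v w \<phi>}"
    using leq_iff_basic[of y x] sat_on_mono by auto
qed auto

end

section \<open>Transfer of satisfaction between prime filters\<close>

locale valued_lgroup_pair = V: valued_lgroup V + W: valued_lgroup W
  for V :: "('g, 'l) vlgrp" and W :: "('h, 'm) vlgrp" +
  fixes p q
  assumes p: "p \<in> V.spec" and q: "q \<in> W.spec"
begin

lemma primes: "V.L.prime_filter p" "W.L.prime_filter q"
  using p q V.specD W.specD by auto

sublocale preordered_group_pair "ggroup V" "le_at V p" "ggroup W" "le_at W q"
  by (intro preordered_group_pair.intro V.le_at_preordered_group W.le_at_preordered_group primes)

text \<open>Only finitely many variables enter, because cuts are filled against finite sets.\<close>

definition pairs :: "nat \<Rightarrow> (nat \<Rightarrow> 'g) \<Rightarrow> (nat \<Rightarrow> 'h) \<Rightarrow> ('g \<times> 'h) set" where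
  "pairs N v v' = (\<lambda>n. (v n, v' n)) ` {..<N}"

text \<open>The parameter \<open>N\<close> bounds the indices of the variables as well as the size of their integer
  combinations.\<close>

definition linked :: "nat \<Rightarrow> (nat \<Rightarrow> 'g) \<Rightarrow> (nat \<Rightarrow> 'l) \<Rightarrow> (nat \<Rightarrow> 'h) \<Rightarrow> (nat \<Rightarrow> 'm) \<Rightarrow> bool" where
  "linked N v w v' w' \<longleftrightarrow>
     range v \<subseteq> gcar V \<and> range w \<subseteq> lcar V \<and> range v' \<subseteq> gcar W \<and> range w' \<subseteq> lcar W
     \<and> matched N (pairs N v v') \<and> (\<forall>n. w n \<in> p \<longleftrightarrow> w' n \<in> q)"

lemma linkedD:
  assumes "linked N v w v' w'"
  shows "range v \<subseteq> gcar V" "range w \<subseteq> lcar V" "range v' \<subseteq> gcar W" "range w' \<subseteq> lcar W"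
    and "matched N (pairs N v v')" "w n \<in> p \<longleftrightarrow> w' n \<in> q"
  using assms unfolding linked_def by auto

lemma pairs_subset:
  "\<lbrakk>range v \<subseteq> gcar V; range v' \<subseteq> gcar W\<rbrakk> \<Longrightarrow> pairs N v v' \<subseteq> gcar V \<times> gcar W"
  unfolding pairs_def by auto

lemma pairs_mono: "N \<le> M \<Longrightarrow> pairs N v v' \<subseteq> pairs M v v'"
  unfolding pairs_def by auto

lemma linked_mono:
  assumes l: "linked M v w v' w'" and "N \<le> M"
  shows "linked N v w v' w'"
  using linkedD[OF l] matched_mono[of M "pairs M v v'" N "pairs N v v'"] assms(2)
    pairs_mono pairs_subset unfolding linked_def by simp

definition represents :: "nat \<Rightarrow> (nat \<Rightarrow> 'g) \<Rightarrow> (nat \<Rightarrow> 'h) \<Rightarrow> nat \<Rightarrow> gterm \<Rightarrow> 'g \<Rightarrow> 'h \<Rightarrow> bool" where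
  "represents N v v' n s x y \<longleftrightarrow> (x, y) \<in> D.combos n (pairs N v v')
     \<and> eq_at V p (geval V v s) x \<and> eq_at W q (geval W v' s) y"

lemma representsD:
  assumes l: "linked N v w v' w'" and r: "represents N v v' n s x y"
  shows "x \<in> gcar V" "y \<in> gcar W" "(x, y) \<in> D.combos n (pairs N v v')"
    "eq_at V p (geval V v s) x" "eq_at W q (geval W v' s) y"
    "geval V v s \<in> gcar V" "geval W v' s \<in> gcar W"
  using r D.combosD[of "(x, y)" n "pairs N v v'"] pairs_subset linkedD[OF l]
  unfolding represents_def by (auto simp: V.geval_closed W.geval_closed)

lemma represents_le_iff:
  assumes l: "linked N v w v' w'" and s: "represents N v v' m s x y"
    and t: "represents N v v' n t x' y'" and N: "m + n \<le> N"
  shows "le_at V p x x' \<longleftrightarrow> le_at W q y y'"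
proof (rule matched_le)
  have "pairs N v v' \<subseteq> gcar V \<times> gcar W" by (intro pairs_subset linkedD[OF l])
  then show sub: "pairs N v v' \<subseteq> carrier (ggroup V) \<times> carrier (ggroup W)" by simp
  show "matched (m + n) (pairs N v v')"
    by (rule matched_mono[OF linkedD(5)[OF l] N _ sub]) simp
qed (use representsD[OF l s] representsD[OF l t] in blast)+

text \<open>At a prime filter a meet or join equals one of its arguments. Linked assignments compare
  the arguments alike on both sides, hence select the same one, and each term reduces to an integer
  combination of the variables. The bound \<open>n\<close> depends on the term alone, the
  combination also on the assignments.\<close>

lemma geval_represented:
  "\<exists>n. \<forall>N v w v' w'. n \<le> N \<longrightarrow> linked N v w v' w' \<longrightarrow> (\<exists>x y. represents N v v' n s x y)"
proof (induction s)
  case (GVar k)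
  \<comment> \<open>Size 1 would do for a single variable; \<open>Suc k\<close> makes
    \<open>n \<le> N\<close> also guarantee that the index \<open>k\<close> is below
    \<open>N\<close>.\<close>
  have "represents N v v' (Suc k) (GVar k) (v k) (v' k)"
    if "Suc k \<le> N" and l: "linked N v w v' w'" for N v w v' w'
  proof -
    note r = linkedD(1,3)[OF l]
    have "pairs N v v' \<subseteq> carrier (ggroup V \<times>\<times> ggroup W)"
      using pairs_subset[OF r] by simp
    moreover have "(v k, v' k) \<in> pairs N v v'" using that unfolding pairs_def by auto
    ultimately have "(v k, v' k) \<in> D.combos (Suc k) (pairs N v v')"
      using D.combos_base[of "(v k, v' k)" "pairs N v v'"]
        D.combos_mono[of "Suc 0" "Suc k" "pairs N v v'" "pairs N v v'"]
      by (auto simp del: D.combos.simps)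
    moreover have "v k \<in> gcar V" "v' k \<in> gcar W" using r by auto
    ultimately show ?thesis
      unfolding represents_def using V.eq_at_refl[OF primes(1)] W.eq_at_refl[OF primes(2)]
      by (simp del: D.combos.simps)
  qed
  then show ?case by blast
next
  case GZero
  have "represents N v v' 0 GZero (gzero V) (gzero W)" for N v v'
    unfolding represents_def using V.eq_at_refl[OF primes(1)] W.eq_at_refl[OF primes(2)] by simp
  then show ?case by blast
next
  case (GAdd s t)
  then obtain m n where IH:
    "\<And>N v w v' w'. \<lbrakk>m \<le> N; linked N v w v' w'\<rbrakk> \<Longrightarrow> \<exists>x y. represents N v v' m s x y"
    "\<And>N v w v' w'. \<lbrakk>n \<le> N; linked N v w v' w'\<rbrakk> \<Longrightarrow> \<exists>x y. represents N v v' n t x y" by metis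
  have "\<exists>x y. represents N v v' (m + n) (GAdd s t) x y"
    if N: "m + n \<le> N" and l: "linked N v w v' w'" for N v w v' w'
  proof -
    obtain x y x' y' where r: "represents N v v' m s x y" "represents N v v' n t x' y'"
      using IH(1)[OF _ l] IH(2)[OF _ l] N by (meson add_leD1 add_leD2)
    note D = representsD[OF l r(1)] representsD[OF l r(2)]
    have "pairs N v v' \<subseteq> carrier (ggroup V \<times>\<times> ggroup W)"
      using pairs_subset[OF linkedD(1,3)[OF l]] by simp
    then have "(gadd V x x', gadd W y y') \<in> D.combos (m + n) (pairs N v v')"
      using D.combos_mult[OF _ D(3) D(10)] by simp
    then have "represents N v v' (m + n) (GAdd s t) (gadd V x x') (gadd W y y')"
      unfolding represents_def using D V.eq_at_gadd[OF primes(1)] W.eq_at_gadd[OF primes(2)] by simp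
    then show ?thesis by blast
  qed
  then show ?case by blast
next
  case (GNeg s)
  then obtain n where IH:
    "\<And>N v w v' w'. \<lbrakk>n \<le> N; linked N v w v' w'\<rbrakk> \<Longrightarrow> \<exists>x y. represents N v v' n s x y" by metis
  have "\<exists>x y. represents N v v' n (GNeg s) x y"
    if N: "n \<le> N" and l: "linked N v w v' w'" for N v w v' w'
  proof -
    obtain x y where r: "represents N v v' n s x y" using IH[OF N l] by blast
    note D = representsD[OF l r]
    have "pairs N v v' \<subseteq> carrier (ggroup V \<times>\<times> ggroup W)"
      using pairs_subset[OF linkedD(1,3)[OF l]] by simp
    then have "(gneg V x, gneg W y) \<in> D.combos n (pairs N v v')"
      using D.combos_inv[OF _ D(3)] D by (simp add: V.G.is_group W.G.is_group)
    then have "represents N v v' n (GNeg s) (gneg V x) (gneg W y)"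
      unfolding represents_def using D V.eq_at_gneg[OF primes(1)] W.eq_at_gneg[OF primes(2)] by simp
    then show ?thesis by blast
  qed
  then show ?case by blast
next
  case (GMeet s t)
  then obtain m n where IH:
    "\<And>N v w v' w'. \<lbrakk>m \<le> N; linked N v w v' w'\<rbrakk> \<Longrightarrow> \<exists>x y. represents N v v' m s x y"
    "\<And>N v w v' w'. \<lbrakk>n \<le> N; linked N v w v' w'\<rbrakk> \<Longrightarrow> \<exists>x y. represents N v v' n t x y" by metis
  have "\<exists>x y. represents N v v' (m + n) (GMeet s t) x y"
    if N: "m + n \<le> N" and l: "linked N v w v' w'" for N v w v' w'
  proof -
    obtain x y x' y' where r: "represents N v v' m s x y" "represents N v v' n t x' y'"
      using IH(1)[OF _ l] IH(2)[OF _ l] N by (meson add_leD1 add_leD2)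
    note D = representsD[OF l r(1)] representsD[OF l r(2)]
    \<comment> \<open>The difference of the arguments has size at most \<open>m + n \<le> N\<close>,
      so its sign is the same on both sides.\<close>
    have le: "le_at V p x x' \<longleftrightarrow> le_at W q y y'" "le_at V p x' x \<longleftrightarrow> le_at W q y' y"
      using represents_le_iff[OF l r N] represents_le_iff[OF l r(2,1)] N by (simp_all add: add.commute)
    have eqV: "eq_at V p (gmeet V (geval V v s) (geval V v t)) (gmeet V x x')"
      using D V.eq_at_gmeet_cong[OF primes(1)] by blast
    have eqW: "eq_at W q (gmeet W (geval W v' s) (geval W v' t)) (gmeet W y y')"
      using D W.eq_at_gmeet_cong[OF primes(2)] by blast
    have sub: "pairs N v v' \<subseteq> carrier (ggroup V \<times>\<times> ggroup W)"
      using pairs_subset[OF linkedD(1,3)[OF l]] by simp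
    have up: "(x, y) \<in> D.combos (m + n) (pairs N v v')" "(x', y') \<in> D.combos (m + n) (pairs N v v')"
      using D(3,10) D.combos_mono[OF _ subset_refl sub, of m "m + n"]
        D.combos_mono[OF _ subset_refl sub, of n "m + n"] by auto
    consider "le_at V p x x'" | "le_at V p x' x"
      using V.le_at_total[OF primes(1)] D by blast
    then show ?thesis
    proof cases
      case 1
      then have "eq_at V p (gmeet V x x') x" "eq_at W q (gmeet W y y') y"
        using D le V.eq_at_gmeet[OF primes(1)] W.eq_at_gmeet[OF primes(2)] by auto
      then have "represents N v v' (m + n) (GMeet s t) x y"
        unfolding represents_def geval.simps
        using up D eqV eqW by (meson V.eq_at_trans[OF primes(1)] W.eq_at_trans[OF primes(2)] V.gmeet_closed W.gmeet_closed)
      then show ?thesis by blast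
    next
      case 2
      then have "eq_at V p (gmeet V x x') x'" "eq_at W q (gmeet W y y') y'"
        using D le V.eq_at_gmeet[OF primes(1)] W.eq_at_gmeet[OF primes(2)] by auto
      then have "represents N v v' (m + n) (GMeet s t) x' y'"
        unfolding represents_def geval.simps
        using up D eqV eqW by (meson V.eq_at_trans[OF primes(1)] W.eq_at_trans[OF primes(2)] V.gmeet_closed W.gmeet_closed)
      then show ?thesis by blast
    qed
  qed
  then show ?case by blast
next
  case (GJoin s t)
  then obtain m n where IH:
    "\<And>N v w v' w'. \<lbrakk>m \<le> N; linked N v w v' w'\<rbrakk> \<Longrightarrow> \<exists>x y. represents N v v' m s x y"
    "\<And>N v w v' w'. \<lbrakk>n \<le> N; linked N v w v' w'\<rbrakk> \<Longrightarrow> \<exists>x y. represents N v v' n t x y" by metis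
  have "\<exists>x y. represents N v v' (m + n) (GJoin s t) x y"
    if N: "m + n \<le> N" and l: "linked N v w v' w'" for N v w v' w'
  proof -
    obtain x y x' y' where r: "represents N v v' m s x y" "represents N v v' n t x' y'"
      using IH(1)[OF _ l] IH(2)[OF _ l] N by (meson add_leD1 add_leD2)
    note D = representsD[OF l r(1)] representsD[OF l r(2)]
    have le: "le_at V p x x' \<longleftrightarrow> le_at W q y y'" "le_at V p x' x \<longleftrightarrow> le_at W q y' y"
      using represents_le_iff[OF l r N] represents_le_iff[OF l r(2,1)] N by (simp_all add: add.commute)
    have eqV: "eq_at V p (gjoin V (geval V v s) (geval V v t)) (gjoin V x x')"
      using D V.eq_at_gjoin_cong[OF primes(1)] by blast
    have eqW: "eq_at W q (gjoin W (geval W v' s) (geval W v' t)) (gjoin W y y')"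
      using D W.eq_at_gjoin_cong[OF primes(2)] by blast
    have sub: "pairs N v v' \<subseteq> carrier (ggroup V \<times>\<times> ggroup W)"
      using pairs_subset[OF linkedD(1,3)[OF l]] by simp
    have up: "(x, y) \<in> D.combos (m + n) (pairs N v v')" "(x', y') \<in> D.combos (m + n) (pairs N v v')"
      using D(3,10) D.combos_mono[OF _ subset_refl sub, of m "m + n"]
        D.combos_mono[OF _ subset_refl sub, of n "m + n"] by auto
    consider "le_at V p x x'" | "le_at V p x' x"
      using V.le_at_total[OF primes(1)] D by blast
    then show ?thesis
    proof cases
      case 1
      then have "eq_at V p (gjoin V x x') x'" "eq_at W q (gjoin W y y') y'"
        using D le V.eq_at_gjoin[OF primes(1)] W.eq_at_gjoin[OF primes(2)] by auto
      then have "represents N v v' (m + n) (GJoin s t) x' y'"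
        unfolding represents_def geval.simps
        using up D eqV eqW by (meson V.eq_at_trans[OF primes(1)] W.eq_at_trans[OF primes(2)] V.gjoin_closed W.gjoin_closed)
      then show ?thesis by blast
    next
      case 2
      then have "eq_at V p (gjoin V x x') x" "eq_at W q (gjoin W y y') y"
        using D le V.eq_at_gjoin[OF primes(1)] W.eq_at_gjoin[OF primes(2)] by auto
      then have "represents N v v' (m + n) (GJoin s t) x y"
        unfolding represents_def geval.simps
        using up D eqV eqW by (meson V.eq_at_trans[OF primes(1)] W.eq_at_trans[OF primes(2)] V.gjoin_closed W.gjoin_closed)
      then show ?thesis by blast
    qed
  qed
  then show ?case by blast
qed

lemma geval_le_iff:
  "\<exists>n. \<forall>v w v' w'. linked n v w v' w' \<longrightarrow>
     (le_at V p (geval V v s) (geval V v t) \<longleftrightarrow> le_at W q (geval W v' s) (geval W v' t))"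
proof -
  obtain m n where IH:
    "\<And>N v w v' w'. \<lbrakk>m \<le> N; linked N v w v' w'\<rbrakk> \<Longrightarrow> \<exists>x y. represents N v v' m s x y"
    "\<And>N v w v' w'. \<lbrakk>n \<le> N; linked N v w v' w'\<rbrakk> \<Longrightarrow> \<exists>x y. represents N v v' n t x y"
    using geval_represented[of s] geval_represented[of t] by metis
  have "le_at V p (geval V v s) (geval V v t) \<longleftrightarrow> le_at W q (geval W v' s) (geval W v' t)"
    if l: "linked (m + n) v w v' w'" for v w v' w'
  proof -
    obtain x y x' y' where r: "represents (m + n) v v' m s x y" "represents (m + n) v v' n t x' y'"
      using IH(1)[OF _ l] IH(2)[OF _ l] by (meson le_add1 le_add2)
    note D = representsD[OF l r(1)] representsD[OF l r(2)]
    have "le_at V p (geval V v s) (geval V v t) \<longleftrightarrow> le_at V p x x'"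
      by (intro V.eq_at_le_cong[OF primes(1)] D)
    moreover have "le_at W q (geval W v' s) (geval W v' t) \<longleftrightarrow> le_at W q y y'"
      by (intro W.eq_at_le_cong[OF primes(2)] D)
    ultimately show ?thesis using represents_le_iff[OF l r] by simp
  qed
  then show ?thesis by blast
qed

lemma leval_iff:
  "\<exists>n. \<forall>v w v' w'. linked n v w v' w' \<longrightarrow> (leval V v w t \<in> p \<longleftrightarrow> leval W v' w' t \<in> q)"
proof (induction t)
  case (LVar k)
  then show ?case using linkedD(6) by auto
next
  case LBot
  then show ?case using primes V.L.prime_filterD(3) W.L.prime_filterD(3) by auto
next
  case LTop
  then show ?case using primes V.L.prime_filterD(2) W.L.prime_filterD(2) by auto
next
  case (LMeet s t)
  then obtain m n where IH:
    "\<And>v w v' w'. linked m v w v' w' \<Longrightarrow> leval V v w s \<in> p \<longleftrightarrow> leval W v' w' s \<in> q"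
    "\<And>v w v' w'. linked n v w v' w' \<Longrightarrow> leval V v w t \<in> p \<longleftrightarrow> leval W v' w' t \<in> q" by metis
  have "leval V v w (LMeet s t) \<in> p \<longleftrightarrow> leval W v' w' (LMeet s t) \<in> q"
    if l: "linked (max m n) v w v' w'" for v w v' w'
    using IH(1)[OF linked_mono[OF l]] IH(2)[OF linked_mono[OF l]]
      V.L.prime_filterD(4)[OF primes(1)] W.L.prime_filterD(4)[OF primes(2)]
    by (simp add: V.leval_closed[OF linkedD(1,2)[OF l]] W.leval_closed[OF linkedD(3,4)[OF l]])
  then show ?case by blast
next
  case (LJoin s t)
  then obtain m n where IH:
    "\<And>v w v' w'. linked m v w v' w' \<Longrightarrow> leval V v w s \<in> p \<longleftrightarrow> leval W v' w' s \<in> q"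
    "\<And>v w v' w'. linked n v w v' w' \<Longrightarrow> leval V v w t \<in> p \<longleftrightarrow> leval W v' w' t \<in> q" by metis
  have "leval V v w (LJoin s t) \<in> p \<longleftrightarrow> leval W v' w' (LJoin s t) \<in> q"
    if l: "linked (max m n) v w v' w'" for v w v' w'
    using IH(1)[OF linked_mono[OF l]] IH(2)[OF linked_mono[OF l]]
      V.L.prime_filterD(5)[OF primes(1)] W.L.prime_filterD(5)[OF primes(2)]
    by (simp add: V.leval_closed[OF linkedD(1,2)[OF l]] W.leval_closed[OF linkedD(3,4)[OF l]])
  then show ?case by blast
next
  case (LVal s)
  \<comment> \<open>The value of \<open>s\<close> lies in the prime filter iff \<open>s\<close> is
    nonnegative there, which is a comparison with \<open>GZero\<close>.\<close>
  obtain n where n: "\<And>v w v' w'. linked n v w v' w' \<Longrightarrow>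
     (le_at V p (geval V v GZero) (geval V v s) \<longleftrightarrow> le_at W q (geval W v' GZero) (geval W v' s))"
    using geval_le_iff by metis
  have "leval V v w (LVal s) \<in> p \<longleftrightarrow> leval W v' w' (LVal s) \<in> q"
    if l: "linked n v w v' w'" for v w v' w'
    using n[OF l] V.val_mem_iff[OF primes(1)] W.val_mem_iff[OF primes(2)]
    by (simp add: V.geval_closed[OF linkedD(1)[OF l]] W.geval_closed[OF linkedD(3)[OF l]])
  then show ?case by blast
qed

text \<open>One move of the game: \<open>a\<close> is played in \<open>W\<close> and answered by
  \<open>b\<close> in \<open>V\<close>, at the price of shrinking the bound to
  \<open>N\<close>.\<close>

lemma linked_updG:
  assumes div: "divisible V" and nontriv: "\<exists>c\<in>gcar V. \<not> le_at V p c (gzero V)"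
    and l: "linked (2 * (fact N * N)) v w v' w'" and a: "a \<in> gcar W"
  shows "\<exists>b\<in>gcar V. linked N (v(n := b)) w (v'(n := a)) w'"
proof -
  let ?M = "2 * (fact N * N)"
  let ?X = "pairs ?M v v'"
  note D = linkedD[OF l]
  have X: "?X \<subseteq> gcar V \<times> gcar W" "finite ?X"
    using pairs_subset D unfolding pairs_def by auto
  have "\<exists>b\<in>carrier (ggroup V). matched N (insert (b, a) ?X)"
    by (rule matched_extend) (use div nontriv X a D in \<open>auto simp: divisible_def\<close>)
  then obtain b where b: "b \<in> gcar V" "matched N (insert (b, a) ?X)" by auto
  have "N \<le> ?M" by (simp add: mult_2 trans_le_add1)
  have "(\<lambda>m. ((v(n := b)) m, (v'(n := a)) m)) k \<in> insert (b, a) ?X" if "k < N" for k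
  proof -
    have "k < ?M" using that \<open>N \<le> ?M\<close> by (rule less_le_trans)
    then have "(v k, v' k) \<in> ?X" unfolding pairs_def by blast
    then show ?thesis by (cases "k = n") auto
  qed
  then have "pairs N (v(n := b)) (v'(n := a)) \<subseteq> insert (b, a) ?X"
    unfolding pairs_def by blast
  then have "matched N (pairs N (v(n := b)) (v'(n := a)))"
    using matched_mono[OF b(2) le_refl] X b a by simp
  then have "linked N (v(n := b)) w (v'(n := a)) w'"
    unfolding linked_def using D a b by (intro conjI range_upd) simp_all
  then show ?thesis using b by blast
qed

text \<open>Atomic formulas transfer both ways, quantifiers only from \<open>W\<close> to
  \<open>V\<close>, as only \<open>V\<close> is known to be divisible and nontrivial at its prime
  filter. Each group quantifier enlarges the bound once.\<close>

lemma sat_on_transfer: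
  assumes div: "divisible V" and nontriv: "\<exists>c\<in>gcar V. \<not> le_at V p c (gzero V)"
  shows "\<exists>n. \<forall>v w v' w'. linked n v w v' w' \<longrightarrow> sat_on W {q} v' w' \<phi> \<longrightarrow> sat_on V {p} v w \<phi>"
proof (induction \<phi>)
  case (GEq s t)
  obtain m n where le:
    "\<And>v w v' w'. linked m v w v' w' \<Longrightarrow>
      (le_at V p (geval V v s) (geval V v t) \<longleftrightarrow> le_at W q (geval W v' s) (geval W v' t))"
    "\<And>v w v' w'. linked n v w v' w' \<Longrightarrow>
      (le_at V p (geval V v t) (geval V v s) \<longleftrightarrow> le_at W q (geval W v' t) (geval W v' s))"
    using geval_le_iff[of s t] geval_le_iff[of t s] by metis
  have "sat_on V {p} v w (GEq s t)"
    if l: "linked (max m n) v w v' w'" and sat: "sat_on W {q} v' w' (GEq s t)" for v w v' w'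
    using sat le(1)[OF linked_mono[OF l]] le(2)[OF linked_mono[OF l]] by (simp add: eq_at_def)
  then show ?case by blast
next
  case (LEq s t)
  obtain m n where iff:
    "\<And>v w v' w'. linked m v w v' w' \<Longrightarrow> leval V v w s \<in> p \<longleftrightarrow> leval W v' w' s \<in> q"
    "\<And>v w v' w'. linked n v w v' w' \<Longrightarrow> leval V v w t \<in> p \<longleftrightarrow> leval W v' w' t \<in> q"
    using leval_iff[of s] leval_iff[of t] by metis
  have "sat_on V {p} v w (LEq s t)"
    if l: "linked (max m n) v w v' w'" and sat: "sat_on W {q} v' w' (LEq s t)" for v w v' w'
    using sat iff(1)[OF linked_mono[OF l]] iff(2)[OF linked_mono[OF l]] by simp
  then show ?case by blast
next
  case (And \<phi> \<psi>)
  then obtain m n where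
    "\<And>v w v' w'. \<lbrakk>linked m v w v' w'; sat_on W {q} v' w' \<phi>\<rbrakk> \<Longrightarrow> sat_on V {p} v w \<phi>"
    "\<And>v w v' w'. \<lbrakk>linked n v w v' w'; sat_on W {q} v' w' \<psi>\<rbrakk> \<Longrightarrow> sat_on V {p} v w \<psi>"
    by metis
  moreover have "linked m v w v' w'" "linked n v w v' w'"
    if "linked (max m n) v w v' w'" for v w v' w'
    using linked_mono[OF that] by simp_all
  ultimately show ?case unfolding sat_on.simps by blast
next
  case (Or \<phi> \<psi>)
  then obtain m n where
    "\<And>v w v' w'. \<lbrakk>linked m v w v' w'; sat_on W {q} v' w' \<phi>\<rbrakk> \<Longrightarrow> sat_on V {p} v w \<phi>"
    "\<And>v w v' w'. \<lbrakk>linked n v w v' w'; sat_on W {q} v' w' \<psi>\<rbrakk> \<Longrightarrow> sat_on V {p} v w \<psi>"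
    by metis
  moreover have "linked m v w v' w'" "linked n v w v' w'"
    if "linked (max m n) v w v' w'" for v w v' w'
    using linked_mono[OF that] by simp_all
  ultimately show ?case unfolding sat_on.simps by blast
next
  case (ExG k \<phi>)
  then obtain n where n:
    "\<And>v w v' w'. \<lbrakk>linked n v w v' w'; sat_on W {q} v' w' \<phi>\<rbrakk> \<Longrightarrow> sat_on V {p} v w \<phi>" by metis
  have "sat_on V {p} v w (ExG k \<phi>)"
    if l: "linked (2 * (fact n * n)) v w v' w'" and sat: "sat_on W {q} v' w' (ExG k \<phi>)" for v w v' w'
  proof -
    obtain a where a: "a \<in> gcar W" "sat_on W {q} (v'(k := a)) w' \<phi>" using sat by auto
    then obtain b where "b \<in> gcar V" "linked n (v(k := b)) w (v'(k := a)) w'"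
      using linked_updG[OF div nontriv l] by blast
    then show ?thesis using n a(2) unfolding sat_on.simps by blast
  qed
  then show ?case by blast
next
  case (ExL k \<phi>)
  then obtain n where n:
    "\<And>v w v' w'. \<lbrakk>linked n v w v' w'; sat_on W {q} v' w' \<phi>\<rbrakk> \<Longrightarrow> sat_on V {p} v w \<phi>" by metis
  have "sat_on V {p} v w (ExL k \<phi>)"
    if l: "linked n v w v' w'" and sat: "sat_on W {q} v' w' (ExL k \<phi>)" for v w v' w'
  proof -
    obtain x where x: "x \<in> lcar W" "sat_on W {q} v' (w'(k := x)) \<phi>" using sat by auto
    \<comment> \<open>Of a lattice element only its truth value at the prime filter matters, so top
      and bottom suffice as answers.\<close>
    have "(if x \<in> q then ltop V else lbot V) \<in> p \<longleftrightarrow> x \<in> q"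
      using V.L.prime_filterD(2,3)[OF primes(1)] by auto
    then obtain y where y: "y \<in> lcar V" "y \<in> p \<longleftrightarrow> x \<in> q"
      using V.lattice_ops_closed(3,4) by metis
    have "linked n v (w(k := y)) v' (w'(k := x))"
      using l x(1) y unfolding linked_def by (intro conjI range_upd) simp_all
    then show ?thesis using n x(2) y(1) unfolding sat_on.simps by blast
  qed
  then show ?case by blast
qed

end

section \<open>Embeddings and prime filters\<close>

lemma vl_embeddingD:
  assumes "vl_embedding e d V W"
  shows "a \<in> gcar V \<Longrightarrow> e a \<in> gcar W" "x \<in> lcar V \<Longrightarrow> d x \<in> lcar W"
    "\<lbrakk>x \<in> lcar V; y \<in> lcar V\<rbrakk> \<Longrightarrow> d x = d y \<longleftrightarrow> x = y"
    "e (gzero V) = gzero W" "a \<in> gcar V \<Longrightarrow> e (gneg V a) = gneg W (e a)"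
    "\<lbrakk>a \<in> gcar V; b \<in> gcar V\<rbrakk> \<Longrightarrow> e (gadd V a b) = gadd W (e a) (e b)"
    "d (lbot V) = lbot W" "d (ltop V) = ltop W"
    "\<lbrakk>x \<in> lcar V; y \<in> lcar V\<rbrakk> \<Longrightarrow> d (lmeet V x y) = lmeet W (d x) (d y)"
    "\<lbrakk>x \<in> lcar V; y \<in> lcar V\<rbrakk> \<Longrightarrow> d (ljoin V x y) = ljoin W (d x) (d y)"
    "a \<in> gcar V \<Longrightarrow> d (val V a) = val W (e a)"
  using assms unfolding vl_embedding_def inj_on_def by blast+

text \<open>The injective homomorphism \<open>d\<close> reflects the order. So the filter generated
  by the image of \<open>p\<close> and the ideal generated by the image of its complement are
  disjoint, and a prime filter between them restricts to exactly \<open>p\<close>.\<close>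

lemma prime_filter_above:
  assumes V: "valued_lgroup V" and W: "valued_lgroup W" and emb: "vl_embedding e d V W"
    and p: "p \<in> valued_lgroup.spec V"
  shows "\<exists>q\<in>valued_lgroup.spec W. \<forall>x\<in>lcar V. d x \<in> q \<longleftrightarrow> x \<in> p"
proof -
  interpret V: valued_lgroup V by (rule V)
  interpret W: valued_lgroup W by (rule W)
  have P: "V.L.prime_filter p" using p V.specD by blast
  note PD = V.L.prime_filterD[OF P] and E = vl_embeddingD[OF emb]
  have leq: "W.L.leq (d x) (d y) \<longleftrightarrow> V.L.leq x y" if "x \<in> lcar V" "y \<in> lcar V" for x y
    using that E(3)[of "lmeet V x y" x] by (simp add: V.L.leq_def W.L.leq_def E(9))
  let ?F = "{z \<in> lcar W. \<exists>x\<in>p. W.L.leq (d x) z}"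
  let ?J = "{z \<in> lcar W. \<exists>x\<in>lcar V - p. W.L.leq z (d x)}"
  have "W.L.filter_on ?F"
    unfolding W.L.filter_on_def
  proof (intro conjI ballI impI)
    show "ltop W \<in> ?F" using PD(2) E(8) W.L.leq_refl[of "ltop W"] by force
  next
    fix y z assume "y \<in> ?F" "z \<in> ?F"
    then obtain a b where ab: "a \<in> p" "b \<in> p" "W.L.leq (d a) y" "W.L.leq (d b) z"
      and yz: "y \<in> lcar W" "z \<in> lcar W" by blast
    have c: "a \<in> lcar V" "b \<in> lcar V" using ab PD(1) by auto
    have "W.L.leq (d (lmeet V a b)) (lmeet W y z)"
      using W.L.meet_mono[OF ab(3,4)] yz c E by simp
    moreover have "lmeet V a b \<in> p" using ab c PD(4) by blast
    ultimately show "lmeet W y z \<in> ?F" using yz by auto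
  next
    fix y z assume yz: "y \<in> ?F" "z \<in> lcar W" "W.L.leq y z"
    then obtain a where "a \<in> p" "W.L.leq (d a) y" "y \<in> lcar W" by blast
    moreover have "d a \<in> lcar W" using \<open>a \<in> p\<close> PD(1) E(2) by blast
    ultimately have "W.L.leq (d a) z" using yz W.L.leq_trans[of "d a" y z] by blast
    then show "z \<in> ?F" using yz \<open>a \<in> p\<close> by blast
  qed auto
  moreover have "W.L.ideal_on ?J"
    unfolding W.L.ideal_on_def
  proof (intro conjI ballI impI)
    show "lbot W \<in> ?J" using PD(3) E(7) W.L.leq_refl[of "lbot W"] by force
  next
    fix y z assume "y \<in> ?J" "z \<in> ?J"
    then obtain a b where ab: "a \<in> lcar V - p" "b \<in> lcar V - p" "W.L.leq y (d a)" "W.L.leq z (d b)"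
      and yz: "y \<in> lcar W" "z \<in> lcar W" by blast
    have c: "d a \<in> lcar W" "d b \<in> lcar W" "d (ljoin V a b) = ljoin W (d a) (d b)"
      using ab E by auto
    have "W.L.leq y (d (ljoin V a b))" "W.L.leq z (d (ljoin V a b))"
      using ab yz c W.L.leq_trans[OF ab(3) W.L.join_leq1] W.L.leq_trans[OF ab(4) W.L.join_leq2] by simp_all
    then have "W.L.leq (ljoin W y z) (d (ljoin V a b))"
      using W.L.join_least yz c by simp
    moreover have "ljoin V a b \<in> lcar V - p" using ab PD(5) by auto
    ultimately show "ljoin W y z \<in> ?J" using yz by auto
  next
    fix y z assume yz: "y \<in> ?J" "z \<in> lcar W" "W.L.leq z y"
    then obtain a where "a \<in> lcar V - p" "W.L.leq y (d a)" "y \<in> lcar W" by blast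
    moreover have "d a \<in> lcar W" using \<open>a \<in> lcar V - p\<close> E(2) by blast
    ultimately have "W.L.leq z (d a)" using yz W.L.leq_trans[of z y "d a"] by blast
    then show "z \<in> ?J" using yz \<open>a \<in> lcar V - p\<close> by blast
  qed auto
  moreover have "?F \<inter> ?J = {}"
  proof (rule ccontr)
    assume "?F \<inter> ?J \<noteq> {}"
    then obtain z a b where z: "z \<in> lcar W" and ab: "a \<in> p" "b \<in> lcar V" "b \<notin> p"
      "W.L.leq (d a) z" "W.L.leq z (d b)" by blast
    have a: "a \<in> lcar V" using ab PD(1) by blast
    then have "W.L.leq (d a) (d b)" using ab z W.L.leq_trans[of "d a" z "d b"] E(2) by blast
    then show False using leq a ab V.L.prime_filter_mono[OF P] by blast
  qed
  ultimately obtain q where q: "W.L.prime_filter q" "?F \<subseteq> q" "q \<inter> ?J = {}"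
    using W.L.prime_filter_exists[of ?F ?J] by blast
  have "d x \<in> q \<longleftrightarrow> x \<in> p" if x: "x \<in> lcar V" for x
    using q W.L.leq_refl[OF E(2)[OF x]] E(2)[OF x] x by blast
  then show ?thesis using q W.spec_def by auto
qed

text \<open>All combinations of the pairs \<open>(v n, e (v n))\<close> stay in the graph of
  \<open>e\<close>, and values are preserved; the starting position is therefore matched for every
  bound.\<close>

lemma linked_embedding:
  assumes pair: "valued_lgroup_pair V W p q" and emb: "vl_embedding e d V W"
    and pq: "\<forall>x\<in>lcar V. d x \<in> q \<longleftrightarrow> x \<in> p"
    and r: "range v \<subseteq> gcar V" "range w \<subseteq> lcar V"
  shows "valued_lgroup_pair.linked V W p q n v w (e \<circ> v) (d \<circ> w)"
proof -
  interpret valued_lgroup_pair V W p q by (rule pair)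
  note E = vl_embeddingD[OF emb]
  have graph: "(x, y) \<in> D.combos m (pairs n v (e \<circ> v)) \<Longrightarrow> x \<in> gcar V \<and> y = e x" for m x y
  proof (induction m arbitrary: x y)
    case 0
    then show ?case by (simp add: E(4))
  next
    case (Suc m)
    let ?X = "pairs n v (e \<circ> v)"
    have X: "b \<in> gcar V \<and> c = e b" if "(b, c) \<in> ?X" for b c
      using that r unfolding pairs_def by auto
    obtain s t where s: "s \<in> D.combos m ?X" and xy: "(x, y) = s \<otimes>\<^bsub>ggroup V \<times>\<times> ggroup W\<^esub> t"
      and t: "t = \<one>\<^bsub>ggroup V \<times>\<times> ggroup W\<^esub> \<or> t \<in> ?X \<or> (\<exists>z\<in>?X. t = inv\<^bsub>ggroup V \<times>\<times> ggroup W\<^esub> z)"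
      using Suc.prems unfolding D.combos.simps by blast
    obtain b c where bc: "t = (b, c)" by fastforce
    have "b \<in> gcar V \<and> c = e b"
      using t
    proof (elim disjE bexE)
      fix z assume z: "z \<in> ?X" "t = inv\<^bsub>ggroup V \<times>\<times> ggroup W\<^esub> z"
      obtain b' c' where "z = (b', c')" by fastforce
      then have "b' \<in> gcar V" "c' = e b'" "c' \<in> gcar W" using X z E(1) by auto
      then show ?thesis
        using z bc \<open>z = (b', c')\<close> by (simp add: V.G.is_group W.G.is_group E(5))
    qed (use bc X E(4) in auto)
    moreover obtain b' c' where s': "s = (b', c')" by fastforce
    moreover have "b' \<in> gcar V \<and> c' = e b'" using Suc.IH s s' by blast
    ultimately show ?case using xy bc E(6)[of b' b] by simp
  qed
  have "matched n (pairs n v (e \<circ> v))"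
    unfolding matched_def
  proof (intro ballI, clarify)
    fix x y assume "(x, y) \<in> D.combos n (pairs n v (e \<circ> v))"
    then have x: "x \<in> gcar V" "y = e x" using graph by auto
    moreover have "val W y \<in> q \<longleftrightarrow> val V x \<in> p"
      using pq[rule_format, OF V.val_closed[OF x(1)]] x E(11) by simp
    ultimately show "le_at V p \<one>\<^bsub>ggroup V\<^esub> x \<longleftrightarrow> le_at W q \<one>\<^bsub>ggroup W\<^esub> y"
      using E(1) V.val_mem_iff[OF primes(1), of x] W.val_mem_iff[OF primes(2), of y] by simp
  qed
  then show ?thesis
    unfolding linked_def using r pq E(1,2) by auto
qed

section \<open>The conditions are sufficient\<close>

lemma (in densely_valued_lgroup) val_neq_top_exists:
  assumes "gcar V \<noteq> {gzero V}"
  shows "\<exists>b\<in>gcar V. val V b \<noteq> ltop V"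
proof (rule ccontr)
  obtain a where a: "a \<in> gcar V" "a \<noteq> gzero V" using assms gzero_closed by blast
  assume "\<not> ?thesis"
  then have "\<forall>q\<in>spec. eq_at V q a (gzero V)"
    using a specD L.prime_filterD(2) by (simp add: eq_at_def le_at_def)
  then show False using a eq_iff_eq_at[of a "gzero V"] by simp
qed

text \<open>If the group were trivial at \<open>p\<close>, all values would lie in \<open>p\<close>.
  The complement \<open>y\<close> of a value other than top is then outside \<open>p\<close>, hence
  no value, hence bottom; but a complement of bottom is top.\<close>

lemma (in densely_valued_lgroup) nontrivial_at_prime:
  assumes bool: "boolean V" and triv: "gcar V = {gzero V} \<Longrightarrow> lbot V = ltop V" and p: "p \<in> spec"
  shows "\<exists>c\<in>gcar V. \<not> le_at V p c (gzero V)"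
proof (rule ccontr)
  assume "\<not> ?thesis"
  then have le: "\<And>c. c \<in> gcar V \<Longrightarrow> le_at V p c (gzero V)" by blast
  have P: "L.prime_filter p" using p specD by blast
  have val_p: "val V c \<in> p" if "c \<in> gcar V" for c
    using le[of "gneg V c"] that by (simp add: le_at_def gdiff_def)
  have "lbot V \<noteq> ltop V" using L.prime_filterD(2,3)[OF P] by auto
  then obtain b where b: "b \<in> gcar V" "val V b \<noteq> ltop V"
    using val_neq_top_exists triv by blast
  obtain y where y: "y \<in> lcar V" "lmeet V (val V b) y = lbot V" "ljoin V (val V b) y = ltop V"
    using bool b val_closed unfolding boolean_def by blast
  have "y \<notin> p"
  proof
    assume "y \<in> p"
    then have "lmeet V (val V b) y \<in> p"
      using val_p[OF b(1)] L.prime_filterD(4)[OF P, of "val V b" y] b y by simp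
    then show False using y L.prime_filterD(3)[OF P] by simp
  qed
  then have "y = lbot V" using val_surj[of y] y val_p by blast
  then have "ljoin V (val V b) y = val V b"
    using b L.leq_bot[of "val V b"] L.leq_iff_join[of y "val V b"] y by (simp add: L.join_commute)
  then show False using y b by simp
qed

theorem sat_reflected:
  assumes V: "densely_valued_lgroup V" and W: "densely_valued_lgroup W"
    and emb: "vl_embedding e d V W"
    and triv: "gcar V = {gzero V} \<Longrightarrow> lbot V = ltop V"
    and div: "divisible V" and bool: "boolean V" and pat: "patching V"
    and r: "range v \<subseteq> gcar V" "range w \<subseteq> lcar V"
    and sat: "sat W (e \<circ> v) (d \<circ> w) \<phi>"
  shows "sat V v w \<phi>"
proof -
  interpret V: densely_valued_lgroup V by (rule V)
  interpret W: densely_valued_lgroup W by (rule W)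
  note E = vl_embeddingD[OF emb]
  obtain \<psi> where \<psi>: "\<psi> \<in> disjuncts \<phi>" "sat W (e \<circ> v) (d \<circ> w) \<psi>"
    using sat sat_iff_disjuncts by blast
  let ?J = "{u \<in> lcar V. sat_on V (V.basic u) v w \<psi>}"
  have J: "V.L.ideal_on ?J"
    using V.sat_on_basic_ideal[OF bool pat disjuncts_or_free[OF \<psi>(1)] r] .
  have "ltop V \<in> ?J"
  proof (rule ccontr)
    assume "ltop V \<notin> ?J"
    moreover have "V.L.filter_on {ltop V}"
      unfolding V.L.filter_on_def
      using V.L.meet_idem[of "ltop V"] V.L.leq_antisym[OF _ V.L.leq_top] by auto
    ultimately obtain p where p: "V.L.prime_filter p" "p \<inter> ?J = {}"
      using V.L.prime_filter_exists[OF _ J, of "{ltop V}"] by blast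
    then have pS: "p \<in> V.spec" by (simp add: V.spec_def)
    obtain q where q: "q \<in> W.spec" "\<forall>x\<in>lcar V. d x \<in> q \<longleftrightarrow> x \<in> p"
      using prime_filter_above[OF _ _ emb pS] V.valued_lgroup_axioms W.valued_lgroup_axioms by blast
    have pair: "valued_lgroup_pair V W p q"
      using pS q by unfold_locales auto
    interpret P: valued_lgroup_pair V W p q by (rule pair)
    have "range (e \<circ> v) \<subseteq> gcar W" "range (d \<circ> w) \<subseteq> lcar W" using r E(1,2) by auto
    then have "sat_on W W.spec (e \<circ> v) (d \<circ> w) \<psi>" using \<psi>(2) W.sat_on_spec by blast
    then have "sat_on W {q} (e \<circ> v) (d \<circ> w) \<psi>" using sat_on_mono q by blast
    moreover obtain n where "\<And>v w v' w'. \<lbrakk>P.linked n v w v' w'; sat_on W {q} v' w' \<psi>\<rbrakk> \<Longrightarrow> sat_on V {p} v w \<psi>"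
      using P.sat_on_transfer[OF div V.nontrivial_at_prime[OF bool triv pS]] by blast
    ultimately have "sat_on V {p} v w \<psi>"
      using linked_embedding[OF pair emb q(2) r] by blast
    then obtain u where "u \<in> lcar V" "u \<in> p" "sat_on V (V.basic u) v w \<psi>"
      using V.sat_on_singleton_compact[OF bool pS r] by blast
    then show False using p by blast
  qed
  then have "sat V v w \<psi>" using V.basic_top V.sat_on_spec[OF r] by simp
  then show ?thesis using \<psi>(1) sat_iff_disjuncts by blast
qed

section \<open>Densely valued quotients\<close>

text \<open>The map \<open>i\<close> may identify elements. When its kernel is a congruence, this is
  the quotient, realised inside prescribed types; the operations go through chosen
  preimages.\<close>

definition image_vlgrp ::
    "('g \<Rightarrow> 'h) \<Rightarrow> ('l \<Rightarrow> 'm) \<Rightarrow> ('g, 'l) vlgrp \<Rightarrow> ('h, 'm) vlgrp" where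
  "image_vlgrp i j V =
     (let r = inv_into (gcar V) i; s = inv_into (lcar V) j in
     \<lparr>gcar = i ` gcar V, gzero = i (gzero V),
      gadd = (\<lambda>x y. i (gadd V (r x) (r y))), gneg = (\<lambda>x. i (gneg V (r x))),
      gmeet = (\<lambda>x y. i (gmeet V (r x) (r y))), gjoin = (\<lambda>x y. i (gjoin V (r x) (r y))),
      lcar = j ` lcar V, lbot = j (lbot V), ltop = j (ltop V),
      lmeet = (\<lambda>x y. j (lmeet V (s x) (s y))), ljoin = (\<lambda>x y. j (ljoin V (s x) (s y))),
      val = (\<lambda>x. j (val V (r x)))\<rparr>)"

context valued_lgroup
begin

definition equiv :: "'g \<Rightarrow> 'g \<Rightarrow> bool" where
  "equiv a b \<longleftrightarrow> (\<forall>p\<in>spec. eq_at V p a b)"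

lemma equiv_iff_val:
  assumes "a \<in> gcar V" "b \<in> gcar V"
  shows "equiv a b \<longleftrightarrow> val V (gdiff V a b) = ltop V \<and> val V (gdiff V b a) = ltop V"
  using assms by (auto simp: equiv_def val_eq_top_iff eq_at_def le_at_def)

lemma equiv_refl: "a \<in> gcar V \<Longrightarrow> equiv a a"
  using eq_at_refl specD by (simp add: equiv_def)

lemma equiv_sym: "equiv a b \<Longrightarrow> equiv b a"
  by (simp add: equiv_def eq_at_def)

lemma equiv_trans:
  "\<lbrakk>equiv a b; equiv b c; a \<in> gcar V; b \<in> gcar V; c \<in> gcar V\<rbrakk> \<Longrightarrow> equiv a c"
  unfolding equiv_def using eq_at_trans specD by meson

lemma equiv_ops:
  assumes "equiv a a'" "equiv b b'" "a \<in> gcar V" "a' \<in> gcar V" "b \<in> gcar V" "b' \<in> gcar V"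
  shows "equiv (gadd V a b) (gadd V a' b')" "equiv (gneg V a) (gneg V a')"
    "equiv (gmeet V a b) (gmeet V a' b')" "equiv (gjoin V a b) (gjoin V a' b')"
  using assms specD unfolding equiv_def
  by (simp_all add: eq_at_gadd eq_at_gneg eq_at_gmeet_cong eq_at_gjoin_cong)

lemma equiv_val: "\<lbrakk>equiv a b; a \<in> gcar V; b \<in> gcar V\<rbrakk> \<Longrightarrow> val V a = val V b"
  using L.eq_iff_prime_filters[of "val V a" "val V b"] val_cong
  unfolding equiv_def spec_def by simp

text \<open>Each class is represented by one of its elements, so the quotient fits into any type
  that has room for the group itself.\<close>

lemma quotient_map_exists:
  assumes h: "inj (h :: 'g \<Rightarrow> 'h)"
  shows "\<exists>i :: 'g \<Rightarrow> 'h. \<forall>a\<in>gcar V. \<forall>b\<in>gcar V. i a = i b \<longleftrightarrow> equiv a b"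
proof -
  define c where "c a = (SOME b. b \<in> gcar V \<and> equiv a b)" for a
  have c: "c a \<in> gcar V" "equiv a (c a)" if "a \<in> gcar V" for a
  proof -
    have "\<exists>b. b \<in> gcar V \<and> equiv a b" using that equiv_refl by blast
    from someI_ex[OF this] show "c a \<in> gcar V" "equiv a (c a)" unfolding c_def by auto
  qed
  have "c a = c b \<longleftrightarrow> equiv a b" if ab: "a \<in> gcar V" "b \<in> gcar V" for a b
  proof
    assume "equiv a b"
    then have "(\<lambda>x. x \<in> gcar V \<and> equiv a x) = (\<lambda>x. x \<in> gcar V \<and> equiv b x)"
      using ab equiv_trans equiv_sym by blast
    then show "c a = c b" unfolding c_def by simp
  next
    assume "c a = c b"
    then show "equiv a b" using ab c equiv_trans equiv_sym by metis
  qed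
  then show ?thesis using h by (intro exI[of _ "h \<circ> c"]) (simp add: inj_eq)
qed

context
  fixes i :: "'g \<Rightarrow> 'h" and j :: "'l \<Rightarrow> 'm" and W
  assumes i: "\<And>a b. \<lbrakk>a \<in> gcar V; b \<in> gcar V\<rbrakk> \<Longrightarrow> i a = i b \<longleftrightarrow> equiv a b"
    and j: "\<And>x y. \<lbrakk>x \<in> lcar V; y \<in> lcar V\<rbrakk> \<Longrightarrow> j x = j y \<longleftrightarrow> x = y"
  defines W: "W \<equiv> image_vlgrp i j V"
begin

lemma image_carriers:
  "gcar W = i ` gcar V" "lcar W = j ` lcar V"
  "gzero W = i (gzero V)" "lbot W = j (lbot V)" "ltop W = j (ltop V)"
  by (simp_all add: W image_vlgrp_def Let_def)

lemma inv_into_equiv: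
  assumes "a \<in> gcar V"
  shows "inv_into (gcar V) i (i a) \<in> gcar V" "equiv (inv_into (gcar V) i (i a)) a"
  using assms i f_inv_into_f[of "i a" i "gcar V"] by (simp_all add: inv_into_into)

lemma inv_into_lcar: "x \<in> lcar V \<Longrightarrow> inv_into (lcar V) j (j x) = x"
  using j by (intro inv_into_f_f) (simp_all add: inj_on_def)

lemma image_gadd: "\<lbrakk>a \<in> gcar V; b \<in> gcar V\<rbrakk> \<Longrightarrow> gadd W (i a) (i b) = i (gadd V a b)"
  and image_gmeet: "\<lbrakk>a \<in> gcar V; b \<in> gcar V\<rbrakk> \<Longrightarrow> gmeet W (i a) (i b) = i (gmeet V a b)"
  and image_gjoin: "\<lbrakk>a \<in> gcar V; b \<in> gcar V\<rbrakk> \<Longrightarrow> gjoin W (i a) (i b) = i (gjoin V a b)"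
  using equiv_ops(1,3,4)[OF inv_into_equiv(2)[of a] inv_into_equiv(2)[of b]] inv_into_equiv(1)
  by (simp_all add: W image_vlgrp_def Let_def i)

lemma image_gneg: "a \<in> gcar V \<Longrightarrow> gneg W (i a) = i (gneg V a)"
  using equiv_ops(2)[OF inv_into_equiv(2)[of a] inv_into_equiv(2)[of a]] inv_into_equiv(1)
  by (simp add: W image_vlgrp_def Let_def i)

lemma image_val: "a \<in> gcar V \<Longrightarrow> val W (i a) = j (val V a)"
  using equiv_val[OF inv_into_equiv(2)[of a]] inv_into_equiv(1)
  by (simp add: W image_vlgrp_def Let_def)

lemma image_lattice_ops:
  "\<lbrakk>x \<in> lcar V; y \<in> lcar V\<rbrakk> \<Longrightarrow> lmeet W (j x) (j y) = j (lmeet V x y)"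
  "\<lbrakk>x \<in> lcar V; y \<in> lcar V\<rbrakk> \<Longrightarrow> ljoin W (j x) (j y) = j (ljoin V x y)"
  by (simp_all add: W image_vlgrp_def Let_def inv_into_lcar)

lemmas image_simps = image_carriers image_gadd image_gmeet image_gjoin image_gneg image_val
  image_lattice_ops

text \<open>The quotient creates density: an element of value top is nonnegative at every prime
  filter, so its meet with zero is equivalent to zero.\<close>

lemma image_densely_valued: "densely_valued_lgroup W"
proof -
  have grp: "comm_group (ggroup W)"
  proof (rule comm_groupI)
    fix x assume "x \<in> carrier (ggroup W)"
    then obtain a where a: "a \<in> gcar V" "x = i a" by (auto simp: image_simps)
    then show "\<exists>y\<in>carrier (ggroup W). y \<otimes>\<^bsub>ggroup W\<^esub> x = \<one>\<^bsub>ggroup W\<^esub>"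
      by (intro bexI[of _ "i (gneg V a)"]) (simp_all add: image_simps)
  qed (auto simp: image_simps gadd_ac)
  then interpret G': comm_group "ggroup W" .
  have neg': "gneg W x = inv\<^bsub>ggroup W\<^esub> x" if "x \<in> gcar W" for x
  proof -
    obtain a where a: "a \<in> gcar V" "x = i a" using \<open>x \<in> gcar W\<close> by (auto simp: image_simps)
    then show ?thesis
      by (intro G'.inv_equality[symmetric]) (simp_all add: image_simps)
  qed
  have glat: "lattice_on (gcar W) (gmeet W) (gjoin W)"
    by unfold_locales
      (auto simp: image_simps GL.meet_assoc GL.join_assoc GL.meet_join_absorb GL.join_meet_absorb
        intro: arg_cong[where f = i, OF GL.meet_commute] arg_cong[where f = i, OF GL.join_commute])
  have llat: "bounded_distrib_lattice_on (lcar W) (lmeet W) (ljoin W) (lbot W) (ltop W)"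
    by unfold_locales
      (auto simp: image_simps L.meet_assoc L.join_assoc L.meet_join_absorb L.join_meet_absorb
        L.meet_bot L.meet_top L.meet_join_distrib
        intro: arg_cong[where f = j, OF L.meet_commute] arg_cong[where f = j, OF L.join_commute])
  have trans: "gle W (gadd W x z) (gadd W y z)"
    if xyz: "x \<in> gcar W" "y \<in> gcar W" "z \<in> gcar W" and le: "gle W x y" for x y z
  proof -
    obtain a b c where abc: "a \<in> gcar V" "b \<in> gcar V" "c \<in> gcar V" "x = i a" "y = i b" "z = i c"
      using xyz by (auto simp: image_simps)
    then have "i (gmeet V a b) = i a" using le by (simp add: gle_def image_simps)
    then have "gadd W (i (gmeet V a b)) (i c) = gadd W (i a) (i c)" by simp
    then show ?thesis using abc by (simp add: gle_def image_simps gadd_gmeet_distrib)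
  qed
  have dense': "gle W (gzero W) x" if x: "x \<in> gcar W" and top: "val W x = ltop W" for x
  proof -
    obtain a where a: "a \<in> gcar V" "x = i a" using x by (auto simp: image_simps)
    then have "val V a = ltop V" using top j by (simp add: image_simps)
    then have "\<forall>p\<in>spec. le_at V p (gzero V) a"
      using a val_mem_iff[OF specD] L.prime_filterD(2)[OF specD] by metis
    then have "equiv (gmeet V (gzero V) a) (gzero V)"
      using a eq_at_gmeet(1)[OF specD] by (simp add: equiv_def)
    then show ?thesis using a i by (simp add: gle_def image_simps)
  qed
  have surj: "\<exists>a\<in>gcar W. x = val W a" if "x \<in> lcar W" "x \<noteq> lbot W" for x
    using that val_surj by (auto simp: image_simps)
  show ?thesis
  proof (intro densely_valued_lgroup.intro valued_lgroup.intro densely_valued_lgroup_axioms.intro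
      grp neg' glat llat trans dense' surj)
    fix a b assume "a \<in> gcar W" "b \<in> gcar W"
    then show "val W (gmeet W a b) = lmeet W (val W a) (val W b)"
      "val W (gjoin W a b) = ljoin W (val W a) (val W b)"
      "lle W (lmeet W (val W a) (val W b)) (val W (gadd W a b))"
      using val_add by (auto simp: image_simps val_meet val_join lle_def)
  qed (auto simp: image_simps val_zero)
qed

lemma image_geval: "range v \<subseteq> gcar V \<Longrightarrow> geval W (i \<circ> v) s = i (geval V v s)"
  by (induction s) (simp_all add: image_simps geval_closed)

lemma image_leval:
  "\<lbrakk>range v \<subseteq> gcar V; range w \<subseteq> lcar V\<rbrakk> \<Longrightarrow> leval W (i \<circ> v) (j \<circ> w) t = j (leval V v w t)"
  by (induction t) (simp_all add: image_simps leval_closed geval_closed image_geval)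

text \<open>Truth in the quotient can thus be computed with representatives.\<close>

lemma image_sat:
  "\<lbrakk>range v \<subseteq> gcar V; range w \<subseteq> lcar V\<rbrakk> \<Longrightarrow>
     sat W (i \<circ> v) (j \<circ> w) \<phi> \<longleftrightarrow> sat_on V spec v w \<phi>"
proof (induction \<phi> arbitrary: v w)
  case (GEq s t)
  then show ?case
    unfolding sat.simps sat_on.simps image_geval[OF GEq(1)]
    by (simp add: geval_closed i equiv_def)
next
  case (LEq s t)
  have "leval V v w s = leval V v w t \<longleftrightarrow> sat_on V spec v w (LEq s t)"
    using L.eq_iff_prime_filters[OF leval_closed[OF LEq] leval_closed[OF LEq], of s t]
    by (simp add: spec_def)
  then show ?case
    unfolding sat.simps image_leval[OF LEq] by (simp add: LEq leval_closed j)
next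
  case (ExG n \<phi>)
  have "sat W ((i \<circ> v)(n := i a)) (j \<circ> w) \<phi> \<longleftrightarrow> sat_on V spec (v(n := a)) w \<phi>"
    if "a \<in> gcar V" for a
    using ExG.IH[OF range_upd[OF ExG.prems(1) that] ExG.prems(2)] unfolding fun_upd_comp .
  then show ?case unfolding sat.simps sat_on.simps image_carriers by blast
next
  case (ExL n \<phi>)
  have "sat W (i \<circ> v) ((j \<circ> w)(n := j x)) \<phi> \<longleftrightarrow> sat_on V spec v (w(n := x)) \<phi>"
    if "x \<in> lcar V" for x
    using ExL.IH[OF ExL.prems(1) range_upd[OF ExL.prems(2) that]] unfolding fun_upd_comp .
  then show ?case unfolding sat.simps sat_on.simps image_carriers by blast
qed simp_all

end

end

text \<open>Differs from \<open>vl_embedding\<close> by the injectivity of \<open>e\<close>, as the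
  target may still have to be made densely valued by a quotient.\<close>

definition vl_hom :: "('g \<Rightarrow> 'h) \<Rightarrow> ('l \<Rightarrow> 'm) \<Rightarrow> ('g, 'l) vlgrp \<Rightarrow> ('h, 'm) vlgrp \<Rightarrow> bool" where
  "vl_hom e d V W \<longleftrightarrow>
     e ` gcar V \<subseteq> gcar W \<and> d ` lcar V \<subseteq> lcar W \<and> inj_on d (lcar V) \<and>
     e (gzero V) = gzero W \<and>
     (\<forall>a\<in>gcar V. e (gneg V a) = gneg W (e a)) \<and>
     (\<forall>a\<in>gcar V. \<forall>b\<in>gcar V. e (gadd V a b) = gadd W (e a) (e b)) \<and>
     (\<forall>a\<in>gcar V. \<forall>b\<in>gcar V. e (gmeet V a b) = gmeet W (e a) (e b)) \<and>
     (\<forall>a\<in>gcar V. \<forall>b\<in>gcar V. e (gjoin V a b) = gjoin W (e a) (e b)) \<and>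
     d (lbot V) = lbot W \<and> d (ltop V) = ltop W \<and>
     (\<forall>x\<in>lcar V. \<forall>y\<in>lcar V. d (lmeet V x y) = lmeet W (d x) (d y)) \<and>
     (\<forall>x\<in>lcar V. \<forall>y\<in>lcar V. d (ljoin V x y) = ljoin W (d x) (d y)) \<and>
     (\<forall>a\<in>gcar V. d (val V a) = val W (e a))"

text \<open>Injectivity of \<open>e\<close> modulo the kernel of the valuation is automatic: \<open>d\<close> is injective and
  \<open>V\<close> is densely valued.\<close>

lemma algebraically_closedD:
  fixes U :: "('a, 'b) vlgrp" and h :: "'a \<Rightarrow> 'h" and k :: "'b \<Rightarrow> 'm"
  assumes ac: "algebraically_closed TYPE('h) TYPE('m) V" and V: "densely_valued_lgroup V"
    and U: "valued_lgroup U" and hk: "inj h" "inj k" and hom: "vl_hom e d V U"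
    and r: "range v \<subseteq> gcar V" "range w \<subseteq> lcar V"
    and sat: "sat_on U (valued_lgroup.spec U) (e \<circ> v) (d \<circ> w) \<phi>"
  shows "sat V v w \<phi>"
proof -
  interpret V: densely_valued_lgroup V by (rule V)
  interpret U: valued_lgroup U by (rule U)
  obtain i :: "'a \<Rightarrow> 'h"
    where i: "\<And>a b. \<lbrakk>a \<in> gcar U; b \<in> gcar U\<rbrakk> \<Longrightarrow> i a = i b \<longleftrightarrow> U.equiv a b"
    using U.quotient_map_exists[OF hk(1)] by blast
  have k: "\<And>x y. \<lbrakk>x \<in> lcar U; y \<in> lcar U\<rbrakk> \<Longrightarrow> k x = k y \<longleftrightarrow> x = y"
    using hk by (simp add: inj_eq)
  let ?W = "image_vlgrp i k U"
  note S = U.image_simps[OF i k]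
  have e: "\<And>a. a \<in> gcar V \<Longrightarrow> e a \<in> gcar U" and d: "\<And>x. x \<in> lcar V \<Longrightarrow> d x \<in> lcar U"
    using hom unfolding vl_hom_def by auto
  have inj: "inj_on (i \<circ> e) (gcar V)"
  proof (rule inj_onI)
    fix a b assume ab: "a \<in> gcar V" "b \<in> gcar V" "(i \<circ> e) a = (i \<circ> e) b"
    have diff: "val U (gdiff U (e x) (e y)) = d (val V (gdiff V x y))" if "x \<in> gcar V" "y \<in> gcar V" for x y
    proof -
      have "gdiff U (e x) (e y) = e (gdiff V x y)"
        using that hom unfolding vl_hom_def gdiff_def by simp
      moreover have "val U (e (gdiff V x y)) = d (val V (gdiff V x y))"
        using that hom V.gdiff_closed unfolding vl_hom_def by metis
      ultimately show ?thesis by simp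
    qed
    have "U.equiv (e a) (e b)" using ab e i by simp
    then have "d (val V (gdiff V a b)) = d (ltop V)" "d (val V (gdiff V b a)) = d (ltop V)"
      using ab e hom U.equiv_iff_val[of "e a" "e b"] diff unfolding vl_hom_def by simp_all
    moreover have "inj_on d (lcar V)" using hom unfolding vl_hom_def by blast
    ultimately have "val V (gdiff V a b) = ltop V" "val V (gdiff V b a) = ltop V"
      using ab by (simp_all add: inj_on_eq_iff)
    then show "a = b"
      using ab V.equiv_iff_val[of a b] V.eq_iff_eq_at[of a b] by (simp add: V.equiv_def)
  qed
  have "vl_embedding (i \<circ> e) (k \<circ> d) V ?W"
    unfolding vl_embedding_def
  proof (intro conjI)
    show "inj_on (k \<circ> d) (lcar V)"
      using hom hk(2) unfolding vl_hom_def by (simp add: comp_inj_on inj_on_subset)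
  qed (use hom inj e d in \<open>simp_all add: S vl_hom_def image_subset_iff\<close>)
  moreover have "densely_valued_lgroup ?W"
    using U.image_densely_valued[OF i k] by simp
  moreover have "sat ?W ((i \<circ> e) \<circ> v) ((k \<circ> d) \<circ> w) \<phi>"
  proof -
    have "range (e \<circ> v) \<subseteq> gcar U" "range (d \<circ> w) \<subseteq> lcar U" using r e d by auto
    then have "sat ?W (i \<circ> (e \<circ> v)) (k \<circ> (d \<circ> w)) \<phi>"
      using sat U.image_sat[OF i k] by blast
    then show ?thesis by (simp add: comp_assoc)
  qed
  ultimately show ?thesis
    using ac r unfolding algebraically_closed_def by blast
qed

section \<open>Divisibility is necessary\<close>

text \<open>In a densely valued l-group \<open>V\<close>, multiplication by \<open>n > 0\<close> embeds \<open>V\<close> into itself.  Hence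
  \<open>V\<close> is an extension of itself in which every element of the smaller copy is divisible by \<open>n\<close>.\<close>

primrec gpow :: "gterm \<Rightarrow> nat \<Rightarrow> gterm" where
  "gpow s 0 = GZero"
| "gpow s (Suc n) = GAdd (gpow s n) s"

lemma geval_gpow: "geval V v (gpow s n) = geval V v s [^]\<^bsub>ggroup V\<^esub> n"
  by (induction n) (simp_all add: nat_pow_def)

text \<open>At each prime filter the \<open>n\<close>-th multiple preserves and reflects the order,
  hence minima, maxima and signs. So values are unchanged, and the lattice part of the embedding is
  the identity.\<close>

lemma (in densely_valued_lgroup) multiplication_hom:
  assumes n: "n > 0"
  shows "vl_hom (\<lambda>a. a [^]\<^bsub>ggroup V\<^esub> (n::nat)) id V V"
proof -
  let ?e = "\<lambda>a. a [^]\<^bsub>ggroup V\<^esub> n"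
  have closed: "?e a \<in> gcar V" if "a \<in> gcar V" for a
    using G.nat_pow_closed[of a n] that by simp
  have le: "le_at V p (?e a) (?e b) \<longleftrightarrow> le_at V p a b"
    if "p \<in> spec" "a \<in> gcar V" "b \<in> gcar V" for p a b
    using preordered_group.le_pow_iff[OF le_at_preordered_group[OF specD[OF that(1)]] n] that by simp
  have zero: "?e (gzero V) = gzero V" using G.nat_pow_one[of n] by simp
  have lattice: "?e (gmeet V a b) = gmeet V (?e a) (?e b) \<and> ?e (gjoin V a b) = gjoin V (?e a) (?e b)"
    if ab: "a \<in> gcar V" "b \<in> gcar V" for a b
  proof -
    \<comment> \<open>Both orders of the arguments are treated at once, so that \<open>x\<close> may
      be taken below \<open>y\<close> at \<open>p\<close>.\<close>
    have "eq_at V p (?e (gmeet V x y)) (gmeet V (?e x) (?e y)) \<and>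
        eq_at V p (?e (gmeet V y x)) (gmeet V (?e y) (?e x)) \<and>
        eq_at V p (?e (gjoin V x y)) (gjoin V (?e x) (?e y)) \<and>
        eq_at V p (?e (gjoin V y x)) (gjoin V (?e y) (?e x))"
      if p: "p \<in> spec" and xy: "le_at V p x y" "x \<in> gcar V" "y \<in> gcar V" for p x y
    proof -
      note P = specD[OF p]
      have pow: "eq_at V p (?e a) (?e b)" if "eq_at V p a b" "a \<in> gcar V" "b \<in> gcar V" for a b
        using that le p by (simp add: eq_at_def)
      have "le_at V p (?e x) (?e y)" using xy le p by simp
      note M = eq_at_gmeet[OF P this closed[OF xy(2)] closed[OF xy(3)]]
        and J = eq_at_gjoin[OF P this closed[OF xy(2)] closed[OF xy(3)]]
      note M' = pow[OF eq_at_gmeet(1)[OF P xy]] pow[OF eq_at_gmeet(2)[OF P xy]]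
        and J' = pow[OF eq_at_gjoin(1)[OF P xy]] pow[OF eq_at_gjoin(2)[OF P xy]]
      show ?thesis
        using xy closed
        by (intro conjI eq_at_trans[OF P M'(1) eq_at_sym[OF P M(1)]]
            eq_at_trans[OF P M'(2) eq_at_sym[OF P M(2)]] eq_at_trans[OF P J'(1) eq_at_sym[OF P J(1)]]
            eq_at_trans[OF P J'(2) eq_at_sym[OF P J(2)]]) simp_all
    qed
    then have "\<forall>p\<in>spec. eq_at V p (?e (gmeet V a b)) (gmeet V (?e a) (?e b)) \<and>
        eq_at V p (?e (gjoin V a b)) (gjoin V (?e a) (?e b))"
      using ab le_at_total[OF specD] by blast
    then show ?thesis using ab closed by (simp add: eq_iff_eq_at)
  qed
  have val: "val V (?e a) = val V a" if a: "a \<in> gcar V" for a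
  proof -
    have "val V (?e a) \<in> p \<longleftrightarrow> val V a \<in> p" if "p \<in> spec" for p
      using le[OF that, of "gzero V" a] a zero closed val_mem_iff[OF specD[OF that]] by simp
    then show ?thesis
      using L.eq_iff_prime_filters[of "val V (?e a)" "val V a"] a closed by (simp add: spec_def)
  qed
  have "?e (gneg V a) = gneg V (?e a)" if "a \<in> gcar V" for a
    using G.nat_pow_inv[of a n] that closed by simp
  moreover have "?e (gadd V a b) = gadd V (?e a) (?e b)" if "a \<in> gcar V" "b \<in> gcar V" for a b
    using G.pow_mult_distrib[of a b n] G.m_comm[of a b] that by simp
  ultimately show ?thesis
    unfolding vl_hom_def using closed lattice val zero by auto
qed

section \<open>Boolean lattice and patching are necessary\<close>

context densely_valued_lgroup
begin

text \<open>At a \<open>degenerate\<close> prime filter all values are true, so that the group is trivial there.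
  Only one prime filter, \<open>lcar V - {lbot V}\<close>, can be degenerate; the group of another prime
  filter is put in its place, into which \<open>V\<close> is mapped by zero.\<close>

definition degenerate :: "'b set \<Rightarrow> bool" where
  "degenerate p \<longleftrightarrow> (\<forall>a\<in>gcar V. val V a \<in> p)"

definition stalk :: "'b set \<Rightarrow> 'b set" where
  "stalk p = (if degenerate p then SOME q. q \<in> spec \<and> \<not> degenerate q else p)"

text \<open>The index ranges over all sets of lattice elements, but the valuation reads only
  coordinates in \<open>spec\<close>; the others vanish in the densely valued quotient.\<close>

definition sections :: "('b set \<Rightarrow> 'a, 'b set set) vlgrp" where
  "sections = \<lparr>gcar = {f. \<forall>p. f p \<in> gcar V}, gzero = (\<lambda>_. gzero V),
     gadd = (\<lambda>f g p. gadd V (f p) (g p)), gneg = (\<lambda>f p. gneg V (f p)),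
     gmeet = (\<lambda>f g p. gmeet V (f p) (g p)), gjoin = (\<lambda>f g p. gjoin V (f p) (g p)),
     lcar = Pow spec, lbot = {}, ltop = spec, lmeet = (\<inter>), ljoin = (\<union>),
     val = (\<lambda>f. {p \<in> spec. val V (f p) \<in> stalk p})\<rparr>"

definition constant_section :: "'a \<Rightarrow> 'b set \<Rightarrow> 'a" where
  "constant_section a p = (if degenerate p then gzero V else a)"

text \<open>A nondegenerate prime filter exists because some value differs from top and is therefore
  omitted by some prime filter.\<close>

lemma stalk:
  assumes triv: "gcar V = {gzero V} \<longrightarrow> lbot V = ltop V" and p: "p \<in> spec"
  shows "stalk p \<in> spec \<and> \<not> degenerate (stalk p)"
proof (cases "degenerate p")
  case True
  have "lbot V \<noteq> ltop V" using L.prime_filterD(2,3)[OF specD[OF p]] by auto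
  then obtain b where b: "b \<in> gcar V" "val V b \<noteq> ltop V" using val_neq_top_exists triv by blast
  then have "\<exists>q. q \<in> spec \<and> \<not> degenerate q" by (auto simp: val_eq_top_iff degenerate_def)
  from someI_ex[OF this] show ?thesis using True by (simp add: stalk_def)
qed (use p in \<open>simp add: stalk_def\<close>)

lemma sections_valued_lgroup:
  assumes triv: "gcar V = {gzero V} \<longrightarrow> lbot V = ltop V"
  shows "valued_lgroup sections"
proof -
  note st = stalk[OF triv]
  have P: "L.prime_filter (stalk p)" if "p \<in> spec" for p using st[OF that] specD by blast
  note PD = L.prime_filterD[OF P]
  have grp: "comm_group (ggroup sections)"
  proof (rule comm_groupI)
    fix f assume "f \<in> carrier (ggroup sections)"
    then show "\<exists>g\<in>carrier (ggroup sections). g \<otimes>\<^bsub>ggroup sections\<^esub> f = \<one>\<^bsub>ggroup sections\<^esub>"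
      by (intro bexI[of _ "\<lambda>p. gneg V (f p)"]) (auto simp: sections_def)
  qed (auto simp: sections_def gadd_assoc intro: gadd_commute)
  then interpret G': comm_group "ggroup sections" .
  have neg': "gneg sections f = inv\<^bsub>ggroup sections\<^esub> f" if "f \<in> gcar sections" for f
    using that by (intro G'.inv_equality[symmetric]) (auto simp: sections_def)
  have glat: "lattice_on (gcar sections) (gmeet sections) (gjoin sections)"
    by unfold_locales
      (auto simp: sections_def GL.meet_assoc GL.join_assoc GL.meet_join_absorb GL.join_meet_absorb
        intro: GL.meet_commute GL.join_commute)
  have llat: "bounded_distrib_lattice_on (lcar sections) (lmeet sections) (ljoin sections)
      (lbot sections) (ltop sections)"
    by unfold_locales (auto simp: sections_def)
  have trans: "gle sections (gadd sections f k) (gadd sections g k)"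
    if "f \<in> gcar sections" "g \<in> gcar sections" "k \<in> gcar sections" "gle sections f g" for f g k
    using that translation unfolding gle_def sections_def by (simp add: fun_eq_iff)
  have surj: "\<exists>f\<in>gcar sections. x = val sections f" if x: "x \<in> lcar sections" for x
  proof -
    \<comment> \<open>This is what the replacement of degenerate filters achieves: every coordinate
      has an element of false value, so each set of prime filters is the value of a family.\<close>
    have "\<forall>p\<in>spec. \<exists>a\<in>gcar V. val V a \<notin> stalk p" using st by (auto simp: degenerate_def)
    then obtain a where a: "\<And>p. p \<in> spec \<Longrightarrow> a p \<in> gcar V \<and> val V (a p) \<notin> stalk p" by metis
    let ?f = "\<lambda>p. if p \<in> spec - x then a p else gzero V"
    have "?f \<in> gcar sections" using a by (simp add: sections_def)
    moreover have "x = val sections ?f"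
      using x a PD(2) by (auto simp: sections_def val_zero)
    ultimately show ?thesis by blast
  qed
  have add: "lle sections (lmeet sections (val sections f) (val sections g)) (val sections (gadd sections f g))"
    if fg: "f \<in> gcar sections" "g \<in> gcar sections" for f g
  proof -
    have "val V (gadd V (f p) (g p)) \<in> stalk p"
      if p: "p \<in> spec" "val V (f p) \<in> stalk p" "val V (g p) \<in> stalk p" for p
    proof -
      have c: "f p \<in> gcar V" "g p \<in> gcar V" using fg by (auto simp: sections_def)
      then have "lmeet V (val V (f p)) (val V (g p)) \<in> stalk p" using p PD(4)[OF p(1)] by simp
      then show ?thesis
        using L.prime_filter_mono[OF P[OF p(1)]] val_add[OF c] c by (simp add: lle_def L.leq_def)
    qed
    then show ?thesis by (auto simp: sections_def lle_def)
  qed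
  show ?thesis
  proof (intro valued_lgroup.intro grp neg' glat llat trans surj add)
    fix f g assume fg: "f \<in> gcar sections" "g \<in> gcar sections"
    then show "val sections (gmeet sections f g) = lmeet sections (val sections f) (val sections g)"
      "val sections (gjoin sections f g) = ljoin sections (val sections f) (val sections g)"
      using PD(4,5) by (auto simp: sections_def val_meet val_join)
  qed (auto simp: sections_def val_zero PD(2))
qed

text \<open>At a degenerate filter every value of \<open>V\<close> is true, and the zero placed
  there also has a true value, so values are preserved although another group sits at this
  coordinate.\<close>

lemma constant_section_hom:
  assumes triv: "gcar V = {gzero V} \<longrightarrow> lbot V = ltop V"
  shows "vl_hom constant_section basic V sections"
proof -
  have "basic (val V a) = val sections (constant_section a)" if "a \<in> gcar V" for a
  proof -
    have "val V (constant_section a p) \<in> stalk p \<longleftrightarrow> val V a \<in> p" if p: "p \<in> spec" for p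
    proof (cases "degenerate p")
      case True
      then show ?thesis
        using \<open>a \<in> gcar V\<close> stalk[OF triv p] L.prime_filterD(2)[OF specD]
        by (simp add: constant_section_def val_zero) (simp add: degenerate_def)
    qed (simp add: constant_section_def stalk_def)
    then show ?thesis by (auto simp: basic_def sections_def)
  qed
  moreover have "inj_on basic (lcar V)"
    using leq_iff_basic by (intro inj_onI L.leq_antisym) simp_all
  ultimately show ?thesis
    unfolding vl_hom_def using basic_subset
    by (auto simp: basic_bot basic_top basic_meet basic_join)
      (auto simp: sections_def constant_section_def fun_eq_iff GL.meet_idem GL.join_idem)
qed

end

section \<open>The equivalence\<close>

text \<open>Room for all extensions used: copies of \<open>V\<close> itself, families indexed by
  sets of lattice elements, and sets of prime filters. A family is stored as its graph, the pair
  \<open>(p, f p)\<close> being coded by \<open>Inl (f p)\<close> together with a tagged copy of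
  \<open>p\<close>.\<close>

lemma type_injections:
  shows "inj (\<lambda>a. {{Inl a}} :: ('g + 'l + nat) set set)"
    and "inj (\<lambda>x. {{Inr (Inl x)}} :: ('g + 'l + nat) set set)"
    and "inj (\<lambda>f :: 'l set \<Rightarrow> 'g. (\<lambda>p. insert (Inl (f p)) ((\<lambda>x. Inr (Inl x)) ` p)) ` UNIV
           :: ('g + 'l + nat) set set)"
    and "inj (\<lambda>A :: 'l set set. (\<lambda>p. (\<lambda>x. Inr (Inl x)) ` p) ` A :: ('g + 'l + nat) set set)"
proof -
  have im: "inj (\<lambda>p. (\<lambda>x. Inr (Inl x)) ` p :: ('g + 'l + nat) set)"
    by (rule injI) (auto simp: inj_image_eq_iff inj_def)
  then show "inj (\<lambda>A :: 'l set set. (\<lambda>p. (\<lambda>x. Inr (Inl x)) ` p) ` A :: ('g + 'l + nat) set set)"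
    by (intro injI) (simp add: inj_image_eq_iff)
  show "inj (\<lambda>f :: 'l set \<Rightarrow> 'g. (\<lambda>p. insert (Inl (f p)) ((\<lambda>x. Inr (Inl x)) ` p)) ` UNIV
      :: ('g + 'l + nat) set set)"
  proof (intro injI ext)
    fix f g :: "'l set \<Rightarrow> 'g" and p
    let ?c = "\<lambda>f p. insert (Inl (f p)) ((\<lambda>x. Inr (Inl x)) ` p) :: ('g + 'l + nat) set"
    assume "range (?c f) = range (?c g)"
    then have "?c f p \<in> range (?c g)" by blast
    then obtain q where q: "?c f p = ?c g q" by (rule rangeE)
    have "f p = g q" using q[THEN eqset_imp_iff, of "Inl (f p)"] by auto
    moreover have "x \<in> p \<longleftrightarrow> x \<in> q" for x using q[THEN eqset_imp_iff, of "Inr (Inl x)"] by auto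
    then have "p = q" by auto
    ultimately show "f p = g p" by simp
  qed
qed (auto intro!: injI)

lemma algebraically_closed_divisible:
  fixes V :: "('g, 'l) vlgrp" and h :: "'g \<Rightarrow> 'h" and k :: "'l \<Rightarrow> 'm"
  assumes ac: "algebraically_closed TYPE('h) TYPE('m) V" and V: "densely_valued_lgroup V"
    and hk: "inj h" "inj k"
  shows "divisible V"
  unfolding divisible_def
proof (intro allI impI ballI)
  interpret V: densely_valued_lgroup V by (rule V)
  fix n :: nat and a assume n: "n > 0" and a: "a \<in> gcar V"
  let ?e = "\<lambda>a. a [^]\<^bsub>ggroup V\<^esub> n" and ?v = "\<lambda>_ :: nat. a" and ?w = "\<lambda>_ :: nat. ltop V"
  let ?\<phi> = "ExG 1 (GEq (gpow (GVar 1) n) (GVar 0))"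
  have "?e a \<in> gcar V" using V.G.nat_pow_closed[of a n] a by simp
  \<comment> \<open>The embedding sends the parameter \<open>a\<close> to its \<open>n\<close>-th
    multiple, and \<open>a\<close> itself is the witness in the extension.\<close>
  then have "sat_on V V.spec ((?e \<circ> ?v)(1 := a)) (id \<circ> ?w) (GEq (gpow (GVar 1) n) (GVar 0))"
    using V.eq_at_refl[OF V.specD] by (simp add: geval_gpow)
  then have "sat_on V V.spec (?e \<circ> ?v) (id \<circ> ?w) ?\<phi>"
    unfolding sat_on.simps(5) using a by blast
  moreover have "range ?v \<subseteq> gcar V" "range ?w \<subseteq> lcar V" using a by auto
  ultimately have "sat V ?v ?w ?\<phi>"
    using algebraically_closedD[OF ac V V.valued_lgroup_axioms hk V.multiplication_hom[OF n]] by blast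
  then show "\<exists>b\<in>gcar V. ?e b = a" by (simp add: geval_gpow)
qed

lemma algebraically_closed_boolean_patching:
  fixes V :: "('g, 'l) vlgrp" and h :: "('l set \<Rightarrow> 'g) \<Rightarrow> 'h" and k :: "'l set set \<Rightarrow> 'm"
  assumes ac: "algebraically_closed TYPE('h) TYPE('m) V" and V: "densely_valued_lgroup V"
    and triv: "gcar V = {gzero V} \<longrightarrow> lbot V = ltop V" and hk: "inj h" "inj k"
  shows "boolean V" "patching V"
proof -
  interpret V: densely_valued_lgroup V by (rule V)
  let ?U = "V.sections" and ?e = V.constant_section and ?d = V.basic
  interpret U: valued_lgroup ?U by (rule V.sections_valued_lgroup[OF triv])
  note acD = algebraically_closedD[OF ac V U.valued_lgroup_axioms hk V.constant_section_hom[OF triv]]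
  have "\<exists>y\<in>lcar V. lmeet V x y = lbot V \<and> ljoin V x y = ltop V" if x: "x \<in> lcar V" for x
  proof -
    let ?v = "\<lambda>_ :: nat. gzero V" and ?w = "\<lambda>_ :: nat. x"
    let ?\<phi> = "ExL 1 (And (LEq (LMeet (LVar 0) (LVar 1)) LBot) (LEq (LJoin (LVar 0) (LVar 1)) LTop))"
    \<comment> \<open>In a power set the complement is available.\<close>
    let ?y = "V.spec - V.basic x"
    have y: "?y \<in> lcar ?U" by (auto simp: V.sections_def)
    have "lmeet ?U (V.basic x) ?y = lbot ?U" "ljoin ?U (V.basic x) ?y = ltop ?U"
      using V.basic_subset[of x] by (auto simp: V.sections_def)
    then have "sat_on ?U U.spec (?e \<circ> ?v) ((?d \<circ> ?w)(1 := ?y))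
        (And (LEq (LMeet (LVar 0) (LVar 1)) LBot) (LEq (LJoin (LVar 0) (LVar 1)) LTop))"
      by simp
    then have "sat_on ?U U.spec (?e \<circ> ?v) (?d \<circ> ?w) ?\<phi>"
      unfolding sat_on.simps(6) using y by blast
    moreover have "range ?v \<subseteq> gcar V" "range ?w \<subseteq> lcar V" using x by auto
    ultimately have "sat V ?v ?w ?\<phi>" using acD by blast
    then show ?thesis by simp
  qed
  then show "boolean V" unfolding boolean_def using V.llattice by blast
  show "patching V"
    unfolding patching_def
  proof (intro ballI impI)
    fix f g \<phi> \<psi> assume c: "f \<in> gcar V" "g \<in> gcar V" "\<phi> \<in> gcar V" "\<psi> \<in> gcar V"
      and le: "lle V (lmeet V (val V f) (val V g))
        (lmeet V (val V (gdiff V \<phi> \<psi>)) (val V (gdiff V \<psi> \<phi>)))"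
    let ?v = "(\<lambda>_ :: nat. gzero V)(0 := f, 1 := g, 2 := \<phi>, 3 := \<psi>)" and ?w = "\<lambda>_ :: nat. ltop V"
    let ?diff = "\<lambda>m n. LVal (GAdd (GVar m) (GNeg (GVar n)))"
    \<comment> \<open>The language has no order symbol, so an inequality is written as a meet
      equation. Variables 0 to 3 are the parameters, 4 is the unknown.\<close>
    let ?part = "\<lambda>m n. LEq (LMeet (LVal (GVar m)) (LMeet (?diff n 4) (?diff 4 n))) (LVal (GVar m))"
    let ?\<theta> = "ExG 4 (And (?part 0 2) (?part 1 3))"
    \<comment> \<open>The patched family follows \<open>\<phi>\<close> where \<open>f\<close> has a
      true value and \<open>\<psi>\<close> elsewhere; on the overlap with \<open>g\<close> the
      premise makes both agree.\<close>
    let ?c = "\<lambda>p. if p \<in> val ?U (?e f) then ?e \<phi> p else ?e \<psi> p"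
    have closed: "?e a \<in> gcar ?U" if "a \<in> gcar V" for a
      using that by (simp add: V.sections_def V.constant_section_def)
    have val_mem: "p \<in> val ?U (?e a) \<longleftrightarrow> p \<in> V.basic (val V a)" if "a \<in> gcar V" for p a
      using V.constant_section_hom[OF triv] that unfolding vl_hom_def by metis
    have same: "val V (gadd V (?e a p) (gneg V (?e a p))) \<in> V.stalk p"
      if "p \<in> V.spec" "a \<in> gcar V" for a p
      using V.stalk[OF triv that(1)] V.L.prime_filterD(2)[OF V.specD] that
      by (simp add: V.constant_section_def V.val_zero)
    have agree: "val V (gadd V (?e \<phi> p) (gneg V (?e \<psi> p))) \<in> V.stalk p \<and>
        val V (gadd V (?e \<psi> p) (gneg V (?e \<phi> p))) \<in> V.stalk p"
      if p: "p \<in> val ?U (?e f)" "p \<in> val ?U (?e g)" for p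
    proof (cases "V.degenerate p")
      case True
      then have "?e \<phi> p = ?e \<psi> p" by (simp add: V.constant_section_def)
      then show ?thesis using same[of p \<psi>] p c by (simp add: V.sections_def)
    next
      case False
      have pS: "p \<in> V.spec" "val V f \<in> p" "val V g \<in> p"
        using p c val_mem by (auto simp: V.basic_def)
      note P = V.specD[OF pS(1)]
      have "lmeet V (val V f) (val V g) \<in> p" using pS c V.L.prime_filterD(4)[OF P] by simp
      then have "lmeet V (val V (gdiff V \<phi> \<psi>)) (val V (gdiff V \<psi> \<phi>)) \<in> p"
        using le c V.L.prime_filter_mono[OF P] by (simp add: lle_def V.L.leq_def)
      then have "val V (gdiff V \<phi> \<psi>) \<in> p" "val V (gdiff V \<psi> \<phi>) \<in> p"
        using c V.L.prime_filterD(4)[OF P] by simp_all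
      then show ?thesis using False by (simp add: V.constant_section_def V.stalk_def gdiff_def)
    qed
    have cU: "?c \<in> gcar ?U" using c by (simp add: V.sections_def V.constant_section_def)
    have sub: "val ?U (?e f) \<inter> (val ?U (gadd ?U (?e \<phi>) (gneg ?U ?c)) \<inter> val ?U (gadd ?U ?c (gneg ?U (?e \<phi>)))) = val ?U (?e f)"
      "val ?U (?e g) \<inter> (val ?U (gadd ?U (?e \<psi>) (gneg ?U ?c)) \<inter> val ?U (gadd ?U ?c (gneg ?U (?e \<psi>)))) = val ?U (?e g)"
      using same c agree by (auto simp: V.sections_def)
    have "lmeet ?U = (\<inter>)" by (simp add: V.sections_def)
    then have "sat_on ?U U.spec ((?e \<circ> ?v)(4 := ?c)) (?d \<circ> ?w) (And (?part 0 2) (?part 1 3))"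
      using sub by simp
    then have "sat_on ?U U.spec (?e \<circ> ?v) (?d \<circ> ?w) ?\<theta>"
      using cU unfolding sat_on.simps by blast
    moreover have "range ?v \<subseteq> gcar V" "range ?w \<subseteq> lcar V" using c by auto
    ultimately have "sat V ?v ?w ?\<theta>" using acD by blast
    then show "\<exists>\<chi>\<in>gcar V.
        lle V (val V f) (lmeet V (val V (gdiff V \<phi> \<chi>)) (val V (gdiff V \<chi> \<phi>))) \<and>
        lle V (val V g) (lmeet V (val V (gdiff V \<psi> \<chi>)) (val V (gdiff V \<chi> \<psi>)))"
      by (simp add: lle_def gdiff_def)
  qed
qed

theorem mainTheorem6:
  fixes V :: "('g, 'l) vlgrp"
  assumes "densely_valued_lgroup V"
    and "gcar V = {gzero V} \<Longrightarrow> lbot V = ltop V"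
    and "\<exists>i :: ('g + 'l + nat) set set \<Rightarrow> 'h. inj i"
    and "\<exists>j :: ('g + 'l + nat) set set \<Rightarrow> 'm. inj j"
  shows "algebraically_closed TYPE('h) TYPE('m) V \<longleftrightarrow>
           divisible V \<and> boolean V \<and> patching V"
proof
  obtain i :: "('g + 'l + nat) set set \<Rightarrow> 'h" where i: "inj i" using assms(3) by blast
  obtain j :: "('g + 'l + nat) set set \<Rightarrow> 'm" where j: "inj j" using assms(4) by blast
  assume ac: "algebraically_closed TYPE('h) TYPE('m) V"
  have "divisible V"
    by (rule algebraically_closed_divisible[OF ac assms(1) inj_compose[OF i type_injections(1)]
          inj_compose[OF j type_injections(2)]])
  moreover have "boolean V" "patching V"
    by (rule algebraically_closed_boolean_patching[OF ac assms(1) impI inj_compose[OF i type_injections(3)]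
          inj_compose[OF j type_injections(4)]], erule assms(2))+
  ultimately show "divisible V \<and> boolean V \<and> patching V" by blast
next
  assume conds: "divisible V \<and> boolean V \<and> patching V"
  show "algebraically_closed TYPE('h) TYPE('m) V"
    unfolding algebraically_closed_def
    by (intro allI impI, rule sat_reflected[OF assms(1) _ _ assms(2)])
      (use conds in \<open>simp_all only: simp_thms\<close>)
qed

end
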